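(* Let $f:X\to X$ be a transitive (one-sided) subshift of finite type. There exist a countable set $\mathcal M_{\rm univ}\subset\mathcal M_E$, where $\mathcal M_E$ is the collection of ergodic invariant probability measures of $f$, and a countable set $E_{\rm univ}=\{h_\mu(f):\mu\in\mathcal M_{\rm univ}\}\subset[0,h_{\rm top}(f)]$ such that for all $\phi\in LC(X,\mathbb R)$ the zero-temperature measure $\mu_{\infty,\phi}$ is a finite convex sum (convex combination) of measures in $\mathcal M_{\rm univ}$ and $h_{\mu_{\infty,\phi}}(f)\in E_{\rm univ}$.
   Context: Let $\mathcal A=\{0,\dots,d-1\}$ and let $A$ be a $d\times d$ matrix with entries in $\{0,1\}$. The one-sided subshift of finite type is $X=X_A=\{x=(x_n)_{n\ge1}\in\mathcal A^{\mathbb N}: A_{x_n,x_{n+1}}=1 \text{ for all } n\}$ with the shift map $f(x)_n=x_{n+1}$; every letter is assumed to occur in some sequence in $X$. Transitive means topologically transitive, i.e. $A$ is irreducible. $LC_k(X,\mathbb R)$ is the space of functions $\phi:X\to\mathbb R$ constant on each cylinder $\{y\in X:y_1=x_1,\dots,y_k=x_k\}$ of length $k$, and $LC(X,\mathbb R)=\bigcup_{k\in\mathbb N}LC_k(X,\mathbb R)$ is the set of locally constant functions. $h_\mu(f)$ is the measure-theoretic entropy and $h_{\rm top}(f)$ the topological entropy. For locally constant $\phi$ and $t\ge0$, $\mu_{t\phi}$ is the unique equilibrium state of $t\phi$, i.e. the unique $f$-invariant Borel probability measure maximizing $h_\mu(f)+\int t\phi\,d\mu$. The zero-temperature measure is the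 weak$^*$ limit $\mu_{\infty,\phi}=\lim_{t\to\infty}\mu_{t\phi}$, which is known to exist for locally constant $\phi$. *)

theory Defs
  imports "HOL-Probability.Probability"
begin

section \<open>Topological dynamics\<close>

definition topologically_transitive :: "'a topology \<Rightarrow> ('a \<Rightarrow> 'a) \<Rightarrow> bool" where
  "topologically_transitive T f \<longleftrightarrow>
     (\<forall>U V. openin T U \<and> U \<noteq> {} \<and> openin T V \<and> V \<noteq> {} \<longrightarrow> (\<exists>n. (f ^^ n) ` U \<inter> V \<noteq> {}))"

text \<open>
  The join of the families \<open>\<U>\<close>, \<open>f\<^sup>-\<^sup>1 \<U>\<close>, ..., \<open>f\<^sup>-\<^sup>n\<^sup>+\<^sup>1 \<U>\<close> on the set \<open>S\<close>. For a partition the join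
  may contain the empty set, which contributes nothing to the Shannon entropy.
\<close>
definition dynamical_join :: "'a set \<Rightarrow> ('a \<Rightarrow> 'a) \<Rightarrow> 'a set set \<Rightarrow> nat \<Rightarrow> 'a set set" where
  "dynamical_join S f \<U> n = {S \<inter> (\<Inter>i<n. (f ^^ i) -` u i) | u. \<forall>i<n. u i \<in> \<U>}"

definition open_cover :: "'a topology \<Rightarrow> 'a set set \<Rightarrow> bool" where
  "open_cover T \<U> \<longleftrightarrow> (\<forall>U\<in>\<U>. openin T U) \<and> \<Union>\<U> = topspace T"

definition min_subcover_card :: "'a set \<Rightarrow> 'a set set \<Rightarrow> nat" where
  "min_subcover_card S \<U> = (LEAST k. \<exists>\<V>\<subseteq>\<U>. finite \<V> \<and> S \<subseteq> \<Union>\<V> \<and> card \<V> = k)"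

text \<open>Topological entropy via open covers (Adler, Konheim, McAndrew); the space is meant to be compact.\<close>
definition topological_entropy :: "'a topology \<Rightarrow> ('a \<Rightarrow> 'a) \<Rightarrow> ereal" where
  "topological_entropy T f =
     (SUP \<U>\<in>{\<U>. open_cover T \<U>}.
        ereal (lim (\<lambda>n. ln (real (min_subcover_card (topspace T)
                                   (dynamical_join (topspace T) f \<U> n))) / real n)))"

section \<open>Invariant measures and measure-theoretic entropy\<close>

definition borel_prob_measures :: "'a::topological_space set \<Rightarrow> 'a measure set" where
  "borel_prob_measures X = {\<mu>. prob_space \<mu> \<and> sets \<mu> = sets (restrict_space borel X)}"

definition invariant_measures :: "'a::topological_space set \<Rightarrow> ('a \<Rightarrow> 'a) \<Rightarrow> 'a measure set" where
  "invariant_measures X f =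
     {\<mu> \<in> borel_prob_measures X. f \<in> measurable \<mu> \<mu> \<and> distr \<mu> \<mu> f = \<mu>}"

definition ergodic_measures :: "'a::topological_space set \<Rightarrow> ('a \<Rightarrow> 'a) \<Rightarrow> 'a measure set" where
  "ergodic_measures X f =
     {\<mu> \<in> invariant_measures X f.
        \<forall>B\<in>sets \<mu>. f -` B \<inter> space \<mu> = B \<longrightarrow> measure \<mu> B = 0 \<or> measure \<mu> B = 1}"

text \<open>Since \<open>ln 0 = 0\<close>, the convention \<open>0 ln 0 = 0\<close> is built in.\<close>
definition partition_entropy :: "'a measure \<Rightarrow> 'a set set \<Rightarrow> real" where
  "partition_entropy \<mu> P = - (\<Sum>C\<in>P. measure \<mu> C * ln (measure \<mu> C))"

definition measure_entropy :: "'a measure \<Rightarrow> ('a \<Rightarrow> 'a) \<Rightarrow> ereal" where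
  "measure_entropy \<mu> f =
     (SUP P\<in>{P. finite P \<and> P \<subseteq> sets \<mu> \<and> partition_on (space \<mu>) P}.
        ereal (lim (\<lambda>n. partition_entropy \<mu> (dynamical_join (space \<mu>) f P n) / real n)))"

definition equilibrium_state ::
    "'a::topological_space set \<Rightarrow> ('a \<Rightarrow> 'a) \<Rightarrow> ('a \<Rightarrow> real) \<Rightarrow> 'a measure \<Rightarrow> bool" where
  "equilibrium_state X f \<psi> \<mu> \<longleftrightarrow>
     \<mu> \<in> invariant_measures X f \<and>
     (\<forall>\<nu>\<in>invariant_measures X f.
        measure_entropy \<nu> f + ereal (\<integral>x. \<psi> x \<partial>\<nu>) \<le> measure_entropy \<mu> f + ereal (\<integral>x. \<psi> x \<partial>\<mu>))"

text \<open>Weak-star convergence of Borel probability measures on \<open>X\<close>, which is meant to be compact.\<close>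
definition weak_star_limit ::
    "'a::topological_space set \<Rightarrow> ('b \<Rightarrow> 'a measure) \<Rightarrow> 'a measure \<Rightarrow> 'b filter \<Rightarrow> bool" where
  "weak_star_limit X m \<nu> F \<longleftrightarrow>
     \<nu> \<in> borel_prob_measures X \<and>
     (\<forall>g::'a \<Rightarrow> real. continuous_on X g \<longrightarrow> ((\<lambda>t. \<integral>x. g x \<partial>m t) \<longlongrightarrow> (\<integral>x. g x \<partial>\<nu>)) F)"

text \<open>
  \<open>zero_temperature_measure X f \<phi> \<nu>\<close> says that \<open>\<nu>\<close> is the weak-star limit, as \<open>t \<rightarrow> \<infinity>\<close>, of the
  equilibrium states of \<open>t \<phi>\<close>. For locally constant \<open>\<phi>\<close> on a transitive subshift of finite type
  these equilibrium states are unique, so the choice of the family \<open>m\<close> is immaterial.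
\<close>
definition zero_temperature_measure ::
    "'a::topological_space set \<Rightarrow> ('a \<Rightarrow> 'a) \<Rightarrow> ('a \<Rightarrow> real) \<Rightarrow> 'a measure \<Rightarrow> bool" where
  "zero_temperature_measure X f \<phi> \<nu> \<longleftrightarrow>
     (\<exists>m :: real \<Rightarrow> 'a measure.
        (\<forall>t\<ge>0. equilibrium_state X f (\<lambda>x. t * \<phi> x) (m t)) \<and> weak_star_limit X m \<nu> at_top)"

definition finite_convex_sum :: "'a measure set \<Rightarrow> 'a measure \<Rightarrow> bool" where
  "finite_convex_sum \<M> \<nu> \<longleftrightarrow>
     (\<exists>F c. finite F \<and> F \<subseteq> \<M> \<and> (\<forall>\<mu>\<in>F. 0 \<le> c \<mu> \<and> sets \<mu> = sets \<nu>) \<and> (\<Sum>\<mu>\<in>F. c \<mu>) = (1::real) \<and>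
        (\<forall>B\<in>sets \<nu>. measure \<nu> B = (\<Sum>\<mu>\<in>F. c \<mu> * measure \<mu> B)))"

section \<open>One-sided subshifts of finite type\<close>

text \<open>
  Sequences are indexed from \<open>0\<close>. The type \<^typ>\<open>nat \<Rightarrow> nat\<close> carries the product topology of the
  discrete space \<^typ>\<open>nat\<close>. Only the entries \<open>A i j\<close> with \<open>i, j < d\<close> matter.
\<close>
definition subshift :: "nat \<Rightarrow> (nat \<Rightarrow> nat \<Rightarrow> nat) \<Rightarrow> (nat \<Rightarrow> nat) set" where
  "subshift d A = {x. \<forall>n. x n < d \<and> A (x n) (x (Suc n)) = 1}"

definition shift_map :: "(nat \<Rightarrow> nat) \<Rightarrow> nat \<Rightarrow> nat" where
  "shift_map x = (\<lambda>n. x (Suc n))"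

definition LC_k :: "nat \<Rightarrow> (nat \<Rightarrow> nat) set \<Rightarrow> ((nat \<Rightarrow> nat) \<Rightarrow> real) set" where
  "LC_k k X = {\<phi>. \<forall>x\<in>X. \<forall>y\<in>X. (\<forall>i<k. x i = y i) \<longrightarrow> \<phi> x = \<phi> y}"

definition LC :: "(nat \<Rightarrow> nat) set \<Rightarrow> ((nat \<Rightarrow> nat) \<Rightarrow> real) set" where
  "LC X = (\<Union>k. LC_k k X)"

end

theory Submission imports Defs begin

text \<open>
  An invariant measure \<open>\<mu>\<close> is encoded by its weights \<open>w \<mapsto> \<mu>[w]\<close>; its entropy is the limit of the
  decreasing conditional entropies of the weights, since cylinders generate. Let \<open>\<phi>\<close> depend on \<open>k\<close>
  coordinates. A zero-temperature measure \<open>\<nu>\<close> maximizes \<open>\<integral>\<phi>\<close> and has maximal entropy among the measures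
  that do, because entropy is bounded and upper semicontinuous. The words of length \<open>k\<close> and \<open>k + 1\<close>
  charged by \<open>\<nu>\<close> form a graph, whose components are strongly connected by conservation of flow; \<open>\<nu>\<close> is
  the convex combination of its restrictions to the components. Every measure carried by the charged
  words also maximizes \<open>\<integral>\<phi>\<close>: otherwise moving the weights of \<open>\<nu>\<close> away from it and taking the Markov
  extension would increase \<open>\<integral>\<phi>\<close>. Hence each restriction has maximal entropy among the measures
  carried by its component. It is the only one, since a maximizer of entropy is Markov and strict
  concavity gives any two of them the same transition probabilities on a strongly connected graph.
  So it is extremal, and determined by a finite set of words, which leaves countably many candidates.
\<close>

section \<open>Real inequalities and sequences\<close>

text \<open>At finite \<open>t\<close> the equilibrium state enters through h(b) + t L(b) <= h(c_t)
  + t L(c_t), where h is the entropy rate and L the integral. Dividing by \<open>t\<close> shows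
  that the limit maximizes L. A competitor b with maximal L has L(b) >= L(c_t), so h(b) <= h(c_t);
  this bound survives the limit because h is an infimum of averaged block entropies, each continuous
  in finitely many weights. A Markov extension of order \<open>k\<close> keeps the weights up to
  length \<open>k + 1\<close>, which suffices for L and for admissibility, and does not lower the
  entropy rate; this is what reduces the problem to a finite graph. The obstacle outside this
  combinatorics is that \<open>measure_entropy\<close> is a supremum over all finite Borel
  partitions: identifying it with the rate of the weights needs approximation of partitions by
  cylinders. Dominance is phrased by comparing entropies because two entropies are always
  comparable, so a given \<open>k\<close> and set of charged words admit at most one dominant
  measure.\<close>

definition eta :: "real \<Rightarrow> real" where
  "eta x = - (x * ln x)"

lemma eta_0 [simp]: "eta 0 = 0" and eta_1 [simp]: "eta 1 = 0"
  by (simp_all add: eta_def)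

lemma eta_nonneg: "0 \<le> x \<Longrightarrow> x \<le> 1 \<Longrightarrow> 0 \<le> eta x"
  by (cases "x = 0") (auto simp: eta_def mult_nonneg_nonpos)

lemma eta_mult: "0 \<le> a \<Longrightarrow> 0 \<le> x \<Longrightarrow> eta (a * x) = a * eta x + x * eta a"
  by (cases "a = 0 \<or> x = 0") (auto simp: eta_def ln_mult algebra_simps)

text \<open>The right-hand side is the tangent line of the concave function \<open>eta\<close> at
  \<open>z\<close>, so the bound is ln y <= y - 1 at y = z / x. Summed over words it gives Gibbs'
  inequality.\<close>

lemma eta_tangent:
  assumes "0 \<le> x" "0 \<le> z" "x > 0 \<Longrightarrow> z > 0"
  shows "eta x \<le> - (x * ln z) + z - x"
proof (cases "x = 0")
  case False
  then have x: "x > 0" and z: "z > 0" using assms by auto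
  have "x * ln (z / x) \<le> x * (z / x - 1)"
    using x z by (intro mult_left_mono ln_le_minus_one) auto
  then show ?thesis using x z by (simp add: eta_def ln_div algebra_simps)
qed (use assms in auto)

text \<open>Both points are compared with the tangent at the convex combination \<open>z\<close>;
  averaging the two tangent values returns \<open>eta z\<close>.\<close>

lemma eta_concave:
  assumes "0 \<le> x" "0 \<le> y" "0 \<le> a" "a \<le> 1"
  shows "a * eta x + (1 - a) * eta y \<le> eta (a * x + (1 - a) * y)"
proof (cases "a = 0 \<or> a = 1")
  case False
  then have a: "0 < a" "a < 1" using assms by auto
  define z where "z = a * x + (1 - a) * y"
  have z0: "0 \<le> z" using assms by (simp add: z_def)
  have zx: "x > 0 \<Longrightarrow> z > 0" and zy: "y > 0 \<Longrightarrow> z > 0"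
    using assms a by (auto simp: z_def intro: add_pos_nonneg add_nonneg_pos)
  have "a * eta x \<le> a * (- (x * ln z) + z - x)"
    using a eta_tangent[OF assms(1) z0 zx] by (intro mult_left_mono) auto
  moreover have "(1 - a) * eta y \<le> (1 - a) * (- (y * ln z) + z - y)"
    using a eta_tangent[OF assms(2) z0 zy] by (intro mult_left_mono) auto
  moreover have "a * (- (x * ln z) + z - x) + (1 - a) * (- (y * ln z) + z - y) = eta z"
    by (simp add: eta_def z_def algebra_simps)
  ultimately show ?thesis by (simp add: z_def)
qed auto

lemma eta_add_le:
  assumes "0 \<le> x" "0 \<le> y"
  shows "eta (x + y) \<le> eta x + eta y"
proof -
  have *: "x * ln x \<le> x * ln (x + y)" if "0 \<le> x" "0 \<le> y" for x y :: real
    using that by (cases "x = 0") (auto intro!: mult_left_mono)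
  show ?thesis using *[OF assms] *[OF assms(2,1)]
    by (simp add: eta_def algebra_simps)
qed

text \<open>Summation of the tangent bounds. Allowing \<open>q\<close> less mass than
  \<open>p\<close> spares a proof that reference weights containing quotients
  \<open>0 / 0 = 0\<close> have full mass.\<close>

lemma gibbs:
  assumes "\<And>x. x \<in> S \<Longrightarrow> 0 \<le> p x" "\<And>x. x \<in> S \<Longrightarrow> 0 \<le> q x"
    and "\<And>x. x \<in> S \<Longrightarrow> p x > 0 \<Longrightarrow> q x > 0" and "sum q S \<le> sum p S"
  shows "(\<Sum>x\<in>S. eta (p x)) \<le> - (\<Sum>x\<in>S. p x * ln (q x))"
proof -
  have "(\<Sum>x\<in>S. eta (p x)) \<le> (\<Sum>x\<in>S. - (p x * ln (q x)) + q x - p x)"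
    by (intro sum_mono eta_tangent assms)
  also have "\<dots> = - (\<Sum>x\<in>S. p x * ln (q x)) + sum q S - sum p S"
    by (simp add: sum.distrib sum_subtractf sum_negf)
  finally show ?thesis using assms(4) by linarith
qed

text \<open>The termwise gaps are nonnegative with sum at most 0, so each vanishes, and ln y = y - 1
  only at y = 1.\<close>

lemma gibbs_eq:
  assumes fin: "finite S" and p: "\<And>x. x \<in> S \<Longrightarrow> 0 \<le> p x" and q: "\<And>x. x \<in> S \<Longrightarrow> 0 \<le> q x"
    and pq: "\<And>x. x \<in> S \<Longrightarrow> p x > 0 \<Longrightarrow> q x > 0" and le: "sum q S \<le> sum p S"
    and eq: "- (\<Sum>x\<in>S. p x * ln (q x)) \<le> (\<Sum>x\<in>S. eta (p x))" and x: "x \<in> S"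
  shows "p x = q x"
proof -
  define g where "g x = - (p x * ln (q x)) + q x - p x - eta (p x)" for x
  have g0: "0 \<le> g x" if "x \<in> S" for x
    using eta_tangent[OF p q pq] that by (simp add: g_def)
  have "sum g S = - (\<Sum>x\<in>S. p x * ln (q x)) + sum q S - sum p S - (\<Sum>x\<in>S. eta (p x))"
    by (simp add: g_def sum.distrib sum_subtractf sum_negf)
  then have "sum g S = 0" using le eq sum_nonneg[of S g] g0 by fastforce
  then have gx: "g x = 0" using sum_nonneg_eq_0_iff[OF fin, of g] g0 x by auto
  show ?thesis
  proof (cases "p x = 0")
    case True then show ?thesis using gx by (simp add: g_def)
  next
    case False
    then have pos: "p x > 0" "q x > 0" using p[OF x] pq[OF x] by auto
    have "p x * ln (q x / p x) = p x * (q x / p x - 1)"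
      using gx pos by (simp add: g_def eta_def ln_div algebra_simps)
    then have "ln (q x / p x) = q x / p x - 1" using pos by simp
    then have "q x / p x = 1" using pos by (intro ln_eq_minus_one) auto
    then show ?thesis using pos by simp
  qed
qed

lemma eta_le_sqrt:
  assumes "0 \<le> x" shows "eta x \<le> 2 * sqrt x"
proof (cases "x = 0")
  case False
  then have x: "x > 0" using assms by simp
  have "- ln x = 2 * ln (1 / sqrt x)" using x by (simp add: ln_div ln_sqrt)
  also have "\<dots> \<le> 2 * (1 / sqrt x)" using ln_le_minus_one[of "1 / sqrt x"] x by simp
  finally have "x * (- ln x) \<le> x * (2 * (1 / sqrt x))" using x by (intro mult_left_mono) auto
  also have "\<dots> = 2 * (x / sqrt x)" by simp
  finally show ?thesis using x by (simp add: eta_def real_div_sqrt)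
qed simp

text \<open>The product rule fails at \<open>l = 0\<close>, where \<open>ln\<close> is
  discontinuous; there \<open>eta\<close> is squeezed between 0 and twice the square root.\<close>

lemma tendsto_eta:
  assumes "(p \<longlongrightarrow> l) F" and nn: "\<forall>\<^sub>F t in F. 0 \<le> p t" and le: "\<forall>\<^sub>F t in F. p t \<le> 1"
  shows "((\<lambda>t. eta (p t)) \<longlongrightarrow> eta l) F"
proof (cases "l = 0")
  case True
  have sqrt: "((\<lambda>t. 2 * sqrt (p t)) \<longlongrightarrow> 2 * sqrt 0) F"
    using assms(1) True by (intro tendsto_intros) simp
  have "((\<lambda>t. eta (p t)) \<longlongrightarrow> 0) F"
  proof (rule tendsto_sandwich[where h = "\<lambda>t. 2 * sqrt (p t)" and f = "\<lambda>_. 0"])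
    show "\<forall>\<^sub>F t in F. 0 \<le> eta (p t)" using nn le by eventually_elim (rule eta_nonneg)
    show "\<forall>\<^sub>F t in F. eta (p t) \<le> 2 * sqrt (p t)" using nn by eventually_elim (rule eta_le_sqrt)
    show "((\<lambda>t. 2 * sqrt (p t)) \<longlongrightarrow> 0) F" using sqrt by simp
  qed simp
  then show ?thesis using True by simp
next
  case False
  then show ?thesis unfolding eta_def using assms(1) by (intro tendsto_intros)
qed

text \<open>Concavity and \<open>s 0 = 0\<close> put every increment below the preceding average, so
  the averages decrease to a limit \<open>l\<close>. An increment below \<open>l\<close> would keep
  all later increments below it and pull the averages under \<open>l\<close>.\<close>

lemma concave_seq_rate:
  fixes s :: "nat \<Rightarrow> real"
  assumes s0: "s 0 = 0" and nn: "\<And>n. 0 \<le> s n"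
    and dec: "\<And>n. s (Suc (Suc n)) - s (Suc n) \<le> s (Suc n) - s n"
  shows "\<exists>l. (\<lambda>n. s n / real n) \<longlonglongrightarrow> l \<and> (\<forall>n>0. l \<le> s n / real n) \<and> (\<forall>n. l \<le> s (Suc n) - s n)"
proof -
  define D where "D n = s (Suc n) - s n" for n
  have Ddec: "D n \<le> D m" if "m \<le> n" for m n
    by (rule lift_Suc_antimono_le[of D, OF _ that]) (use dec in \<open>simp add: D_def\<close>)
  have nD: "real n * D n \<le> s n" for n
  proof (induction n)
    case (Suc n)
    have "real (Suc n) * D (Suc n) \<le> real (Suc n) * D n"
      using Ddec[of n "Suc n"] by (intro mult_left_mono) auto
    also have "\<dots> = real n * D n + D n" by (simp add: algebra_simps)
    also have "\<dots> \<le> s (Suc n)" using Suc by (simp add: D_def)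
    finally show ?case .
  qed (simp add: s0)
  define f where "f n = s (Suc n) / real (Suc n)" for n
  have "f (Suc n) \<le> f n" for n
  proof -
    have "real (Suc n) * s (Suc (Suc n)) \<le> real (Suc (Suc n)) * s (Suc n)"
      using nD[of "Suc n"] by (simp add: D_def algebra_simps)
    then show ?thesis by (simp add: f_def field_simps)
  qed
  then have "decseq f" by (simp add: decseq_SucI)
  moreover have "\<bar>f n\<bar> \<le> f 0" for n
    using decseqD[OF \<open>decseq f\<close>, of 0 n] nn[of "Suc n"] by (simp add: f_def)
  ultimately obtain l where l: "f \<longlonglongrightarrow> l" "\<And>n. l \<le> f n"
    using decseq_convergent[of f 0] nn by (metis f_def divide_nonneg_nonneg of_nat_0_le_iff)
  have 1: "(\<lambda>n. s n / real n) \<longlonglongrightarrow> l"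
    using l(1) by (subst filterlim_sequentially_Suc[symmetric]) (simp add: f_def[abs_def])
  have 2: "l \<le> s n / real n" if "n > 0" for n
    using l(2)[of "n - 1"] that by (simp add: f_def)
  have 3: "l \<le> D m" for m
  proof (rule ccontr)
    assume "\<not> l \<le> D m"
    then have pos: "l - D m > 0" by simp
    have up: "s (m + n) \<le> s m + real n * D m" for n
    proof (induction n)
      case (Suc n)
      have "s (m + Suc n) = s (m + n) + D (m + n)" by (simp add: D_def)
      then show ?case using Suc Ddec[of m "m + n"] by (simp add: algebra_simps)
    qed simp
    obtain n where n: "s m - l * real m < real n * (l - D m)"
      using ex_less_of_nat_mult[OF pos] by blast
    have "l * real (m + Suc n) \<le> s (m + Suc n)"
      using 2[of "m + Suc n"] by (simp add: field_simps)
    also have "\<dots> \<le> s m + real (Suc n) * D m" by (rule up)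
    finally show False using n pos by (simp add: algebra_simps)
  qed
  show ?thesis using 1 2 3 by (auto simp: D_def)
qed

text \<open>Needed for word counts, which are submultiplicative but come with no concavity:
  \<open>topological_entropy\<close> is stated with \<open>lim\<close>, whose value says something
  only about convergent sequences.\<close>

lemma fekete:
  fixes a :: "nat \<Rightarrow> real"
  assumes nn: "\<And>n. 0 \<le> a n" and sub: "\<And>m n. a (m + n) \<le> a m + a n"
  shows "convergent (\<lambda>n. a n / real n)"
proof -
  define l where "l = (INF n\<in>{0<..}. a n / real n)"
  have bdd: "bdd_below ((\<lambda>n. a n / real n) ` {0<..})"
    using nn by (intro bdd_belowI[of _ 0]) auto
  have lb: "l \<le> a n / real n" if "n > 0" for n
    unfolding l_def using that by (intro cINF_lower bdd) auto
  have mul: "a (q * N) \<le> real q * a N" if "q > 0" for q N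
    using that
  proof (induction q)
    case (Suc q)
    then show ?case using sub[of N "q * N"] by (cases "q = 0") (auto simp: algebra_simps)
  qed simp
  have "(\<lambda>n. a n / real n) \<longlonglongrightarrow> l"
  proof (rule LIMSEQ_I)
    fix e :: real assume e: "e > 0"
    obtain N where N: "N > 0" "a N / real N < l + e / 2"
      using cINF_less_iff[of "{0<..}" "\<lambda>n. a n / real n" "l + e / 2"] bdd e
      by (auto simp: l_def)
    \<comment> \<open>\<open>B\<close> bounds the remainder term \<open>a (n mod N)\<close>
      uniformly in \<open>n\<close>; the index \<open>M\<close> below makes it at most
      \<open>n * (e / 2)\<close>.\<close>
    define B where "B = (\<Sum>r\<le>N. a r)"
    have B: "a r \<le> B" if "r \<le> N" for r
      unfolding B_def using that nn by (intro member_le_sum) auto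
    have B0: "0 \<le> B" using B[of 0] nn[of 0] by simp
    obtain M where M: "B < real M * (e / 2)" using ex_less_of_nat_mult[of "e / 2" B] e by auto
    show "\<exists>no. \<forall>n\<ge>no. norm (a n / real n - l) < e"
    proof (intro exI allI impI)
      fix n assume n: "max M (Suc N) \<le> n"
      have q: "n div N > 0" using n N(1) by (simp add: div_greater_zero_iff)
      have "a n \<le> a (n div N * N) + a (n mod N)"
        using sub[of "n div N * N" "n mod N"] by simp
      also have "\<dots> \<le> real (n div N) * a N + B"
        using mul[OF q, of N] B[of "n mod N"] N(1) by (simp add: add_mono mod_le_divisor)
      also have "real (n div N) * a N \<le> (real n / real N) * a N"
        using nn N(1) by (intro mult_right_mono of_nat_div_le_of_nat) auto
      also have "(real n / real N) * a N + B < real n * (l + e / 2) + real n * (e / 2)"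
      proof (rule add_less_le_mono)
        have "real n * (a N / real N) < real n * (l + e / 2)"
          using N n by (intro mult_strict_left_mono) auto
        then show "real n / real N * a N < real n * (l + e / 2)" by simp
        have "real M * (e / 2) \<le> real n * (e / 2)" using n e by (intro mult_right_mono) auto
        then show "B \<le> real n * (e / 2)" using M by simp
      qed
      finally have "a n < real n * (l + e)" by (simp add: algebra_simps)
      then have "a n / real n < l + e" using n by (simp add: field_simps)
      then show "norm (a n / real n - l) < e" using lb[of n] n by simp
    qed
  qed
  then show ?thesis by (rule convergentI)
qed

section \<open>Stationary word weights and their entropy rate\<close>

definition words :: "'k set \<Rightarrow> nat \<Rightarrow> 'k list set" where
  "words K n = {w. set w \<subseteq> K \<and> length w = n}"

text \<open>The functions \<open>w \<mapsto> \<mu>[w]\<close> of shift invariant probability measures on \<open>K\<^sup>\<nat>\<close>.\<close>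
definition stationary :: "'k set \<Rightarrow> ('k list \<Rightarrow> real) \<Rightarrow> bool" where
  "stationary K c \<longleftrightarrow>
     c [] = 1 \<and> (\<forall>w. 0 \<le> c w) \<and> (\<forall>w. \<not> set w \<subseteq> K \<longrightarrow> c w = 0) \<and>
     (\<forall>w. (\<Sum>a\<in>K. c (w @ [a])) = c w) \<and> (\<forall>w. (\<Sum>a\<in>K. c (a # w)) = c w)"

definition block_entropy :: "'k set \<Rightarrow> ('k list \<Rightarrow> real) \<Rightarrow> nat \<Rightarrow> real" where
  "block_entropy K c n = (\<Sum>w\<in>words K n. eta (c w))"

definition entropy_rate :: "'k set \<Rightarrow> ('k list \<Rightarrow> real) \<Rightarrow> real" where
  "entropy_rate K c = lim (\<lambda>n. block_entropy K c n / real n)"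

text \<open>The mean code length, in natural units, of the letter after a word of length
  \<open>n\<close> drawn from \<open>c\<close>, for a code built on the transition probabilities of
  \<open>r\<close>. For \<open>r = c\<close> it is the conditional entropy.\<close>

definition cross_entropy :: "'k set \<Rightarrow> nat \<Rightarrow> ('k list \<Rightarrow> real) \<Rightarrow> ('k list \<Rightarrow> real) \<Rightarrow> real" where
  "cross_entropy K n c r = - (\<Sum>w\<in>words K n. \<Sum>a\<in>K. c (w @ [a]) * ln (r (w @ [a]) / r w))"

text \<open>The coefficient is left free: values in the unit interval give convex combinations, a
  value above 1 extrapolates past \<open>c\<close>, away from \<open>c'\<close>.\<close>

definition mix :: "real \<Rightarrow> ('b \<Rightarrow> real) \<Rightarrow> ('b \<Rightarrow> real) \<Rightarrow> 'b \<Rightarrow> real" where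
  "mix a c c' = (\<lambda>w. a * c w + (1 - a) * c' w)"

section \<open>Sums over words of fixed length\<close>

lemma words_0 [simp]: "words K 0 = {[]}"
  by (auto simp: words_def)

lemma words_Suc_Cons: "words K (Suc n) = (\<lambda>(w, a). a # w) ` (words K n \<times> K)"
  by (fastforce simp: words_def length_Suc_conv image_def)

lemma words_Suc_snoc: "words K (Suc n) = (\<lambda>(w, a). w @ [a]) ` (words K n \<times> K)"
proof -
  have "w \<in> (\<lambda>(w, a). w @ [a]) ` (words K n \<times> K)" if "w \<in> words K (Suc n)" for w
    using that by (cases w rule: rev_cases) (auto simp: words_def)
  then show ?thesis by (auto simp: words_def)
qed

lemma sum_words_Cons: "(\<Sum>w\<in>words K (Suc n). g w) = (\<Sum>w\<in>words K n. \<Sum>a\<in>K. g (a # w))"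
  unfolding words_Suc_Cons
  by (subst sum.reindex) (auto simp: inj_on_def sum.cartesian_product case_prod_unfold)

lemma sum_words_snoc: "(\<Sum>w\<in>words K (Suc n). g w) = (\<Sum>w\<in>words K n. \<Sum>a\<in>K. g (w @ [a]))"
  unfolding words_Suc_snoc
  by (subst sum.reindex) (auto simp: inj_on_def sum.cartesian_product case_prod_unfold)

lemma sum_words_append:
  "(\<Sum>w\<in>words K (m + n). g w) = (\<Sum>u\<in>words K m. \<Sum>v\<in>words K n. g (u @ v))"
proof (induction n arbitrary: g)
  case (Suc n)
  show ?case using Suc[of "\<lambda>w. \<Sum>a\<in>K. g (w @ [a])"] by (simp add: sum_words_snoc)
qed simp

locale finite_alphabet =
  fixes K :: "'k set"
  assumes finite_K: "finite K"
begin

lemma finite_words [simp]: "finite (words K n)"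
  using finite_lists_length_eq[OF finite_K, of n] by (simp add: words_def)

context
  fixes c assumes c: "stationary K c"
begin

lemma stationary_Nil: "c [] = 1"
  and stationary_nonneg: "0 \<le> c w"
  and stationary_outside: "\<not> set w \<subseteq> K \<Longrightarrow> c w = 0"
  and stationary_snoc: "(\<Sum>a\<in>K. c (w @ [a])) = c w"
  and stationary_Cons: "(\<Sum>a\<in>K. c (a # w)) = c w"
  using c by (auto simp: stationary_def)

lemma stationary_sum_append: "(\<Sum>u\<in>words K n. c (w @ u)) = c w"
proof (induction n)
  case (Suc n)
  then show ?case by (simp add: sum_words_snoc stationary_snoc flip: append_assoc)
qed simp

lemma stationary_sum_prepend: "(\<Sum>u\<in>words K n. c (u @ w)) = c w"
proof (induction n)
  case (Suc n)
  then show ?case by (simp add: sum_words_Cons stationary_Cons)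
qed simp

lemma stationary_sum: "(\<Sum>w\<in>words K n. c w) = 1"
  using stationary_sum_append[of "[]" n] by (simp add: stationary_Nil)

lemma stationary_append_le: "c (w @ u) \<le> c w"
proof (cases "set u \<subseteq> K")
  case True
  then have "c (w @ u) \<le> (\<Sum>u\<in>words K (length u). c (w @ u))"
    by (intro member_le_sum) (auto simp: stationary_nonneg words_def[of K "length u"] finite_lists_length_eq[OF finite_K])
  then show ?thesis by (simp add: stationary_sum_append)
qed (auto simp: stationary_nonneg stationary_outside)

lemma stationary_prepend_le: "c (u @ w) \<le> c w"
proof (cases "set u \<subseteq> K")
  case True
  then have "c (u @ w) \<le> (\<Sum>u\<in>words K (length u). c (u @ w))"
    by (intro member_le_sum[of u _ "\<lambda>u. c (u @ w)"]) (auto simp: stationary_nonneg words_def[of K "length u"] finite_lists_length_eq[OF finite_K])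
  then show ?thesis by (simp add: stationary_sum_prepend)
qed (auto simp: stationary_nonneg stationary_outside)

lemma stationary_le_1: "c w \<le> 1"
  using stationary_append_le[of "[]" w] by (simp add: stationary_Nil)

lemma stationary_pos_append: "0 < c (u @ w) \<Longrightarrow> 0 < c u" "0 < c (u @ w) \<Longrightarrow> 0 < c w"
  using stationary_append_le[of u w] stationary_prepend_le[of u w] by linarith+

lemma block_entropy_0: "block_entropy K c 0 = 0"
  by (simp add: block_entropy_def stationary_Nil)

lemma block_entropy_nonneg: "0 \<le> block_entropy K c n"
  unfolding block_entropy_def
  by (intro sum_nonneg eta_nonneg stationary_nonneg stationary_le_1)

lemma block_entropy_snoc_sum:
  "(\<Sum>w\<in>words K n. \<Sum>a\<in>K. c (w @ [a]) * ln (c w)) = - block_entropy K c n"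
  by (simp add: block_entropy_def eta_def sum_negf stationary_snoc flip: sum_distrib_right)

text \<open>The chain rule. A term with \<open>c (w @ [a]) = 0\<close> vanishes on both sides;
  otherwise \<open>c w > 0\<close> as well and the logarithm of the quotient splits.\<close>

lemma block_entropy_increment: "block_entropy K c (Suc n) - block_entropy K c n = cross_entropy K n c c"
proof -
  have *: "c (w @ [a]) * ln (c (w @ [a]) / c w) = c (w @ [a]) * ln (c (w @ [a])) - c (w @ [a]) * ln (c w)"
    for w a
    using stationary_nonneg[of "w @ [a]"] stationary_pos_append(1)[of w "[a]"]
    by (cases "c (w @ [a]) = 0") (auto simp: ln_div algebra_simps)
  have "cross_entropy K n c c = block_entropy K c (Suc n) + (\<Sum>w\<in>words K n. \<Sum>a\<in>K. c (w @ [a]) * ln (c w))"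
    unfolding cross_entropy_def * sum_subtractf
    by (simp add: block_entropy_def sum_words_snoc eta_def sum_negf)
  then show ?thesis by (simp add: block_entropy_snoc_sum)
qed

text \<open>Strong subadditivity: Gibbs' inequality against the weights \<open>c(aw) c(wb) / c(w)\<close>.\<close>
lemma block_entropy_concave:
  "block_entropy K c (Suc (Suc n)) - block_entropy K c (Suc n)
     \<le> block_entropy K c (Suc n) - block_entropy K c n"
proof -
  define S where "S = words K n \<times> K \<times> K"
  define p where "p = (\<lambda>(w, b, a). c (a # w @ [b]))"
  define q where "q = (\<lambda>(w, b, a). c (a # w) * c (w @ [b]) / c w)"
  have S: "(\<Sum>x\<in>S. g x) = (\<Sum>w\<in>words K n. \<Sum>b\<in>K. \<Sum>a\<in>K. g (w, b, a))" for g :: "_ \<Rightarrow> real"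
    by (simp add: S_def sum.cartesian_product)
  have pos: "0 < c (a # w) \<and> 0 < c (w @ [b]) \<and> 0 < c w" if "0 < c (a # w @ [b])" for a w b
    using stationary_pos_append[of "a # w" "[b]"] stationary_pos_append[of "[a]" "w @ [b]"]
      stationary_pos_append[of "[a]" w] that by auto
  have sq: "sum q S = 1"
  proof -
    have "sum q S = (\<Sum>w\<in>words K n. (\<Sum>b\<in>K. \<Sum>a\<in>K. c (a # w) * c (w @ [b]) / c w))"
      by (simp add: S q_def)
    also have "\<dots> = (\<Sum>w\<in>words K n. c w * c w / c w)"
    proof (intro sum.cong refl)
      fix w
      have "(\<Sum>b\<in>K. \<Sum>a\<in>K. c (a # w) * c (w @ [b]) / c w) = (\<Sum>b\<in>K. c (w @ [b])) * (\<Sum>a\<in>K. c (a # w)) / c w"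
        unfolding sum_product sum_divide_distrib by (simp add: mult.commute)
      then show "(\<Sum>b\<in>K. \<Sum>a\<in>K. c (a # w) * c (w @ [b]) / c w) = c w * c w / c w"
        by (simp only: stationary_Cons stationary_snoc)
    qed
    also have "\<dots> = 1" by (simp add: stationary_sum)
    finally show ?thesis .
  qed
  have sp: "sum p S = 1"
    by (simp add: S p_def stationary_Cons stationary_snoc stationary_sum)
  have "(\<Sum>x\<in>S. eta (p x)) \<le> - (\<Sum>x\<in>S. p x * ln (q x))"
    by (intro gibbs) (auto simp: p_def q_def sp[unfolded p_def] sq[unfolded q_def] stationary_nonneg dest: pos)
  also have "(\<Sum>x\<in>S. eta (p x)) = block_entropy K c (Suc (Suc n))"
    by (simp add: S p_def block_entropy_def sum_words_Cons[where n = "Suc n"] sum_words_snoc[where n = n])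
  also have "(\<Sum>x\<in>S. p x * ln (q x)) = (\<Sum>w\<in>words K n. \<Sum>b\<in>K. \<Sum>a\<in>K.
      c (a # w @ [b]) * ln (c (a # w)) + c (a # w @ [b]) * ln (c (w @ [b])) - c (a # w @ [b]) * ln (c w))"
    unfolding S
  proof (intro sum.cong refl)
    fix w b a
    show "p (w, b, a) * ln (q (w, b, a)) =
      c (a # w @ [b]) * ln (c (a # w)) + c (a # w @ [b]) * ln (c (w @ [b])) - c (a # w @ [b]) * ln (c w)"
      using pos[of a w b] stationary_nonneg[of "a # w @ [b]"]
      by (cases "c (a # w @ [b]) = 0") (auto simp: p_def q_def ln_mult ln_div algebra_simps)
  qed
  also have "\<dots> = (\<Sum>w\<in>words K n. \<Sum>b\<in>K. \<Sum>a\<in>K. c (a # w @ [b]) * ln (c (a # w)))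
     + (\<Sum>w\<in>words K n. \<Sum>b\<in>K. \<Sum>a\<in>K. c (a # w @ [b]) * ln (c (w @ [b])))
     - (\<Sum>w\<in>words K n. \<Sum>b\<in>K. \<Sum>a\<in>K. c (a # w @ [b]) * ln (c w))"
    by (simp add: sum.distrib sum_subtractf)
  also have "(\<Sum>w\<in>words K n. \<Sum>b\<in>K. \<Sum>a\<in>K. c (a # w @ [b]) * ln (c w)) = - block_entropy K c n"
    by (simp add: stationary_Cons stationary_snoc block_entropy_def eta_def sum_negf flip: sum_distrib_right)
  also have "(\<Sum>w\<in>words K n. \<Sum>b\<in>K. \<Sum>a\<in>K. c (a # w @ [b]) * ln (c (w @ [b]))) = - block_entropy K c (Suc n)"
    by (simp add: stationary_Cons block_entropy_def sum_words_snoc eta_def sum_negf flip: sum_distrib_right)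
  also have "(\<Sum>w\<in>words K n. \<Sum>b\<in>K. \<Sum>a\<in>K. c (a # w @ [b]) * ln (c (a # w))) = - block_entropy K c (Suc n)"
  proof -
    have "(\<Sum>b\<in>K. \<Sum>a\<in>K. c (a # w @ [b]) * ln (c (a # w))) = (\<Sum>a\<in>K. c (a # w) * ln (c (a # w)))" for w
      using stationary_snoc[of "_ # w"]
      by (subst sum.swap) (simp flip: sum_distrib_right)
    then show ?thesis by (simp add: block_entropy_def sum_words_Cons eta_def sum_negf)
  qed
  finally show ?thesis by linarith
qed

lemma entropy_rate_tendsto: "(\<lambda>n. block_entropy K c n / real n) \<longlonglongrightarrow> entropy_rate K c"
  and entropy_rate_le_average: "n > 0 \<Longrightarrow> entropy_rate K c \<le> block_entropy K c n / real n"
  and entropy_rate_le_increment: "entropy_rate K c \<le> block_entropy K c (Suc n) - block_entropy K c n"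
proof -
  obtain l where l: "(\<lambda>n. block_entropy K c n / real n) \<longlonglongrightarrow> l"
      "\<forall>n>0. l \<le> block_entropy K c n / real n" "\<forall>n. l \<le> block_entropy K c (Suc n) - block_entropy K c n"
    using concave_seq_rate[of "block_entropy K c"] block_entropy_0 block_entropy_nonneg
      block_entropy_concave by blast
  then have "entropy_rate K c = l" by (auto simp: entropy_rate_def intro: limI)
  then show "(\<lambda>n. block_entropy K c n / real n) \<longlonglongrightarrow> entropy_rate K c"
    and "n > 0 \<Longrightarrow> entropy_rate K c \<le> block_entropy K c n / real n"
    and "entropy_rate K c \<le> block_entropy K c (Suc n) - block_entropy K c n"
    using l by auto
qed

lemma entropy_rate_nonneg: "0 \<le> entropy_rate K c"
  using block_entropy_nonneg by (intro LIMSEQ_le_const[OF entropy_rate_tendsto]) auto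

lemma increment_antimono:
  "m \<le> n \<Longrightarrow> block_entropy K c (Suc n) - block_entropy K c n
     \<le> block_entropy K c (Suc m) - block_entropy K c m"
  by (rule lift_Suc_antimono_le[of "\<lambda>n. block_entropy K c (Suc n) - block_entropy K c n"])
    (use block_entropy_concave in auto)

text \<open>Increments decrease, so a lower bound from some length on holds at every length, and
  telescoping bounds the averages. Increments of a Markov extension are computed only from length
  \<open>k\<close> on.\<close>

lemma entropy_rate_ge_increment:
  assumes g: "\<And>n. n \<ge> k \<Longrightarrow> g \<le> block_entropy K c (Suc n) - block_entropy K c n"
  shows "g \<le> entropy_rate K c"
proof -
  have g': "g \<le> block_entropy K c (Suc n) - block_entropy K c n" for n
    using g[of "max k n"] increment_antimono[of n "max k n"] by simp
  have "real n * g \<le> block_entropy K c n" for n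
  proof (induction n)
    case (Suc n)
    then show ?case using g'[of n] by (simp add: algebra_simps)
  qed (simp add: block_entropy_0)
  then have "g \<le> block_entropy K c n / real n" if "n \<ge> 1" for n
    using that by (simp add: field_simps)
  then show ?thesis by (intro LIMSEQ_le_const[OF entropy_rate_tendsto]) blast
qed

text \<open>Gibbs' inequality against the uniform distribution on \<open>S\<close>.\<close>

lemma block_entropy_le_ln_card:
  assumes "S \<subseteq> words K n" and S: "\<And>w. w \<in> words K n \<Longrightarrow> w \<notin> S \<Longrightarrow> c w = 0"
  shows "block_entropy K c n \<le> ln (real (card S))"
proof -
  have fin: "finite S" using assms(1) finite_words finite_subset by blast
  have sum1: "sum c S = 1"
    using sum.mono_neutral_left[of "words K n" S c] assms stationary_sum[of n] by auto
  then have card: "card S > 0" using fin by (cases "S = {}") (auto simp: card_gt_0_iff)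
  have "block_entropy K c n = (\<Sum>w\<in>S. eta (c w))"
    unfolding block_entropy_def using assms by (intro sum.mono_neutral_right) auto
  also have "\<dots> \<le> - (\<Sum>w\<in>S. c w * ln (1 / real (card S)))"
    using card sum1 by (intro gibbs) (auto simp: stationary_nonneg)
  also have "\<dots> = ln (real (card S))"
    using card sum1 by (simp add: ln_div flip: sum_distrib_right sum_negf)
  finally show ?thesis .
qed

text \<open>Gibbs' inequality against \<open>c\<close> followed by one transition of
  \<open>r\<close>. The equality case is what later turns equal entropies into equal transition
  probabilities.\<close>

lemma increment_le_cross_entropy:
  assumes "stationary K r" and ac: "\<And>v. v \<in> words K (Suc n) \<Longrightarrow> 0 < c v \<Longrightarrow> 0 < r v"
  shows "block_entropy K c (Suc n) - block_entropy K c n \<le> cross_entropy K n c r"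
    and "cross_entropy K n c r \<le> block_entropy K c (Suc n) - block_entropy K c n
      \<Longrightarrow> w \<in> words K n \<Longrightarrow> a \<in> K \<Longrightarrow> c (w @ [a]) = c w * (r (w @ [a]) / r w)"
proof -
  have r: "0 \<le> r w" "(\<Sum>a\<in>K. r (w @ [a])) = r w" for w
    using assms(1) by (auto simp: stationary_def)
  have r_le: "r (w @ [a]) \<le> r w" if "a \<in> K" for w a
    using member_le_sum[OF that, of "\<lambda>a. r (w @ [a])"] r finite_K by auto
  define S where "S = words K n \<times> K"
  define p where "p = (\<lambda>(w, a). c (w @ [a]))"
  define q where "q = (\<lambda>(w, a). c w * (r (w @ [a]) / r w))"
  have S: "(\<Sum>x\<in>S. g x) = (\<Sum>w\<in>words K n. \<Sum>a\<in>K. g (w, a))" for g :: "_ \<Rightarrow> real"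
    by (simp add: S_def sum.cartesian_product)
  have pos: "0 < r (w @ [a]) \<and> 0 < r w \<and> 0 < c w" if "w \<in> words K n" "a \<in> K" "0 < c (w @ [a])" for w a
    using ac[of "w @ [a]"] r_le[of a w] that stationary_pos_append(1)[of w "[a]"]
    by (fastforce simp: words_def)
  have sp: "sum p S = 1" by (simp add: S p_def stationary_snoc stationary_sum)
  have "sum q S = (\<Sum>w\<in>words K n. c w * (r w / r w))"
    unfolding S q_def prod.case by (simp only: r(2) flip: sum_distrib_left sum_divide_distrib)
  also have "\<dots> \<le> (\<Sum>w\<in>words K n. c w)"
    by (intro sum_mono) (auto simp: stationary_nonneg)
  finally have sq: "sum q S \<le> sum p S" by (simp add: sp stationary_sum)
  have nn: "0 \<le> p x" "0 \<le> q x" and ac': "x \<in> S \<Longrightarrow> 0 < p x \<Longrightarrow> 0 < q x" for x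
    by (auto simp: p_def q_def S_def stationary_nonneg r split: prod.splits dest!: pos)
  have eq1: "(\<Sum>x\<in>S. eta (p x)) = block_entropy K c (Suc n)"
    by (simp add: S p_def block_entropy_def sum_words_snoc)
  have "p (w, a) * ln (q (w, a)) = c (w @ [a]) * ln (c w) + c (w @ [a]) * ln (r (w @ [a]) / r w)"
    if "w \<in> words K n" "a \<in> K" for w a
    using pos[OF that] stationary_nonneg[of "w @ [a]"]
    by (cases "c (w @ [a]) = 0") (auto simp: p_def q_def ln_mult ln_div algebra_simps)
  then have "(\<Sum>x\<in>S. p x * ln (q x)) =
      (\<Sum>w\<in>words K n. \<Sum>a\<in>K. c (w @ [a]) * ln (c w) + c (w @ [a]) * ln (r (w @ [a]) / r w))"
    unfolding S by (intro sum.cong refl) auto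
  then have eq2: "- (\<Sum>x\<in>S. p x * ln (q x)) = block_entropy K c n + cross_entropy K n c r"
    by (simp add: sum.distrib block_entropy_snoc_sum cross_entropy_def)
  have "(\<Sum>x\<in>S. eta (p x)) \<le> - (\<Sum>x\<in>S. p x * ln (q x))"
    by (intro gibbs nn ac' sq)
  then show "block_entropy K c (Suc n) - block_entropy K c n \<le> cross_entropy K n c r"
    by (simp add: eq1 eq2)
  assume le: "cross_entropy K n c r \<le> block_entropy K c (Suc n) - block_entropy K c n"
    and wa: "w \<in> words K n" "a \<in> K"
  have "p (w, a) = q (w, a)"
    by (rule gibbs_eq[of S]) (use nn ac' sq eq1 eq2 le wa finite_K in \<open>auto simp: S_def\<close>)
  then show "c (w @ [a]) = c w * (r (w @ [a]) / r w)" by (simp add: p_def q_def)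
qed

end

section \<open>Convex combinations of stationary weights\<close>

lemma stationary_mix:
  assumes "stationary K c" "stationary K c'" "0 \<le> a" "a \<le> 1"
  shows "stationary K (mix a c c')"
  using assms by (auto simp: stationary_def mix_def sum.distrib simp flip: sum_distrib_left)

text \<open>Concavity of \<open>eta\<close> bounds the block entropy of the mixture from below,
  subadditivity from above, and the gap \<open>b\<close> is the entropy of the coin that selects
  \<open>c\<close> or \<open>c'\<close>. It does not depend on \<open>n\<close>, so division by
  \<open>n\<close> removes it and the rate is affine.\<close>

lemma entropy_rate_mix:
  assumes c: "stationary K c" "stationary K c'" and a: "0 \<le> a" "a \<le> 1"
  shows "entropy_rate K (mix a c c') = a * entropy_rate K c + (1 - a) * entropy_rate K c'"
proof -
  define s where "s n = (a * block_entropy K c n + (1 - a) * block_entropy K c' n) / real n" for n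
  define b where "b = eta a + eta (1 - a)"
  have m: "stationary K (mix a c c')" using assms by (rule stationary_mix)
  note nn = stationary_nonneg[OF c(1)] stationary_nonneg[OF c(2)]
  have lo: "a * block_entropy K c n + (1 - a) * block_entropy K c' n \<le> block_entropy K (mix a c c') n" for n
    unfolding block_entropy_def mix_def sum_distrib_left sum.distrib[symmetric]
    by (intro sum_mono eta_concave nn a)
  have hi: "block_entropy K (mix a c c') n \<le> a * block_entropy K c n + (1 - a) * block_entropy K c' n + b" for n
  proof -
    have "block_entropy K (mix a c c') n
        \<le> (\<Sum>w\<in>words K n. (a * eta (c w) + c w * eta a) + ((1 - a) * eta (c' w) + c' w * eta (1 - a)))"
      unfolding block_entropy_def
    proof (rule sum_mono)
      fix w
      have "eta (mix a c c' w) \<le> eta (a * c w) + eta ((1 - a) * c' w)"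
        unfolding mix_def using a by (intro eta_add_le) (auto simp: nn)
      then show "eta (mix a c c' w) \<le> (a * eta (c w) + c w * eta a) + ((1 - a) * eta (c' w) + c' w * eta (1 - a))"
        using a by (simp add: eta_mult nn)
    qed
    also have "\<dots> = a * block_entropy K c n + (1 - a) * block_entropy K c' n + b"
      unfolding b_def block_entropy_def
      by (simp add: sum.distrib stationary_sum[OF c(1)] stationary_sum[OF c(2)]
          flip: sum_distrib_left sum_distrib_right)
    finally show ?thesis .
  qed
  have s: "s \<longlonglongrightarrow> a * entropy_rate K c + (1 - a) * entropy_rate K c'"
    unfolding s_def add_divide_distrib times_divide_eq_right[symmetric]
    by (intro tendsto_intros entropy_rate_tendsto c)
  have "(\<lambda>n. b / real n) \<longlonglongrightarrow> 0" by (rule lim_const_over_n)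
  from tendsto_add[OF s this]
  have s': "(\<lambda>n. s n + b / real n) \<longlonglongrightarrow> a * entropy_rate K c + (1 - a) * entropy_rate K c'" by simp
  have "(\<lambda>n. block_entropy K (mix a c c') n / real n) \<longlonglongrightarrow> a * entropy_rate K c + (1 - a) * entropy_rate K c'"
    by (rule tendsto_sandwich[OF always_eventually always_eventually s s'])
      (auto simp: s_def lo hi divide_right_mono simp flip: add_divide_distrib)
  then show ?thesis using entropy_rate_tendsto[OF m] LIMSEQ_unique by blast
qed

end

section \<open>Markov extensions\<close>

text \<open>Lengths above \<open>k + 1\<close> are left unconstrained because an extrapolated
  mixture may be negative there.\<close>

definition consistent_upto :: "'k set \<Rightarrow> nat \<Rightarrow> ('k list \<Rightarrow> real) \<Rightarrow> bool" where
  "consistent_upto K k r \<longleftrightarrow>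
     r [] = 1 \<and> (\<forall>w. length w \<le> Suc k \<longrightarrow> 0 \<le> r w) \<and>
     (\<forall>w. length w \<le> Suc k \<longrightarrow> \<not> set w \<subseteq> K \<longrightarrow> r w = 0) \<and>
     (\<forall>w. length w \<le> k \<longrightarrow> (\<Sum>a\<in>K. r (w @ [a])) = r w) \<and>
     (\<forall>w. length w \<le> k \<longrightarrow> (\<Sum>a\<in>K. r (a # w)) = r w)"

text \<open>Words are read backwards, since a Markov extension appends letters on the right.\<close>
primrec markov_rev :: "nat \<Rightarrow> ('k list \<Rightarrow> real) \<Rightarrow> 'k list \<Rightarrow> real" where
  "markov_rev k r [] = r []"
| "markov_rev k r (a # u) = (if length u \<le> k then r (rev u @ [a])
     else markov_rev k r u * (r (rev (take k u) @ [a]) / r (rev (take k u))))"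

definition markov :: "nat \<Rightarrow> ('k list \<Rightarrow> real) \<Rightarrow> 'k list \<Rightarrow> real" where
  "markov k r w = markov_rev k r (rev w)"

abbreviation last_part :: "nat \<Rightarrow> 'k list \<Rightarrow> 'k list" where
  "last_part k w \<equiv> drop (length w - k) w"

lemma markov_short: "length w \<le> Suc k \<Longrightarrow> markov k r w = r w"
  by (cases w rule: rev_cases) (auto simp: markov_def)

lemma markov_snoc_aux:
  "length w > k \<Longrightarrow> markov k r (w @ [a]) = markov k r w * (r (last_part k w @ [a]) / r (last_part k w))"
  by (simp add: markov_def rev_take)

context finite_alphabet
begin

context
  fixes k r assumes r: "consistent_upto K k r"
begin

lemma consistent_uptoD:
  "length w \<le> Suc k \<Longrightarrow> 0 \<le> r w"
  "length w \<le> Suc k \<Longrightarrow> \<not> set w \<subseteq> K \<Longrightarrow> r w = 0"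
  "length w \<le> k \<Longrightarrow> (\<Sum>a\<in>K. r (w @ [a])) = r w"
  "length w \<le> k \<Longrightarrow> (\<Sum>a\<in>K. r (a # w)) = r w"
  using r by (auto simp: consistent_upto_def)

lemma consistent_upto_snoc_le:
  assumes "length w \<le> k" shows "r (w @ [a]) \<le> r w"
proof (cases "a \<in> K")
  case True
  then have "r (w @ [a]) \<le> (\<Sum>a\<in>K. r (w @ [a]))"
    using assms by (intro member_le_sum) (auto intro: consistent_uptoD finite_K)
  then show ?thesis using consistent_uptoD(3) assms by simp
qed (use assms consistent_uptoD(1)[of w] consistent_uptoD(2)[of "w @ [a]"] in auto)

lemma consistent_upto_Cons_le:
  assumes "length w \<le> k" shows "r (a # w) \<le> r w"
proof (cases "a \<in> K")
  case True
  then have "r (a # w) \<le> (\<Sum>a\<in>K. r (a # w))"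
    using assms by (intro member_le_sum[of a _ "\<lambda>a. r (a # w)"]) (auto intro: consistent_uptoD finite_K)
  then show ?thesis using consistent_uptoD(4) assms by simp
qed (use assms consistent_uptoD(1)[of w] consistent_uptoD(2)[of "a # w"] in auto)

text \<open>Adds the boundary length \<open>k\<close> to the recursion. If \<open>r w = 0\<close>
  there, then \<open>r (w @ [a]) = 0\<close> by monotonicity, in agreement with the value 0 of the
  quotient.\<close>

lemma markov_snoc:
  assumes "length w \<ge> k"
  shows "markov k r (w @ [a]) = markov k r w * (r (last_part k w @ [a]) / r (last_part k w))"
proof (cases "length w = k")
  case True
  then have "r (w @ [a]) = r w * (r (w @ [a]) / r w)"
    using consistent_upto_snoc_le[of w a] consistent_uptoD(1)[of "w @ [a]"] by auto
  then show ?thesis using True by (simp add: markov_short)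
next
  case False
  then show ?thesis using assms by (intro markov_snoc_aux) auto
qed

lemma markov_nonneg: "0 \<le> markov k r w"
proof (induction w rule: rev_induct)
  case (snoc a w)
  show ?case
  proof (cases "length w \<le> k")
    case False
    then show ?thesis using snoc
      by (subst markov_snoc) (auto intro!: mult_nonneg_nonneg divide_nonneg_nonneg consistent_uptoD)
  qed (simp add: markov_short consistent_uptoD)
qed (simp add: markov_short consistent_uptoD)

lemma markov_outside: "\<not> set w \<subseteq> K \<Longrightarrow> markov k r w = 0"
proof (induction w rule: rev_induct)
  case (snoc a w)
  show ?case
  proof (cases "length w \<le> k")
    case False
    then have "length w \<ge> k" by simp
    show ?thesis
    proof (cases "set w \<subseteq> K")
      case True
      then have "r (last_part k w @ [a]) = 0"
        using snoc.prems False by (intro consistent_uptoD) auto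
      then show ?thesis using markov_snoc[OF \<open>length w \<ge> k\<close>] by simp
    qed (use snoc.IH markov_snoc[OF \<open>length w \<ge> k\<close>] in simp)
  qed (use snoc.prems in \<open>simp add: markov_short consistent_uptoD\<close>)
qed (simp add: markov_short consistent_uptoD)

text \<open>Ensures that the quotient \<open>r u / r u\<close>, met when summing over the next
  letter, is 1 wherever the word has nonzero weight. In the step the new window is a word of length
  \<open>k + 1\<close> without its first letter, and dropping that letter cannot decrease
  \<open>r\<close>.\<close>

lemma markov_last_part:
  "length w \<ge> k \<Longrightarrow> markov k r w \<noteq> 0 \<Longrightarrow> r (last_part k w) \<noteq> 0"
proof (induction w rule: rev_induct)
  case Nil then show ?case using r by (simp add: consistent_upto_def)
next
  case (snoc a w)
  show ?case
  proof (cases "length w \<ge> k")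
    case True
    let ?u = "last_part k w @ [a]"
    have nz: "r ?u \<noteq> 0" using snoc.prems markov_snoc[OF True] by auto
    have u: "length ?u = Suc k" using True by simp
    have "last_part k (w @ [a]) = drop 1 (drop (length w - k) (w @ [a]))"
      using True by (simp add: Suc_diff_le)
    then have "last_part k (w @ [a]) = drop 1 ?u" by simp
    moreover obtain b v where bv: "?u = b # v" "length v = k" using u by (cases ?u) auto
    ultimately show ?thesis
      using consistent_upto_Cons_le[of v b] consistent_uptoD(1)[of "b # v"] nz by auto
  next
    case False
    then have "length w + 1 = k" using snoc.prems by simp
    then show ?thesis using snoc.prems by (simp add: markov_short)
  qed
qed

text \<open>For the sum over a preceding letter the induction removes letters on the right: once
  \<open>w\<close> has length at least \<open>k\<close>, the letter in front does not affect the
  last \<open>k\<close> letters, so both sides acquire the same factor.\<close>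

lemma stationary_markov: "stationary K (markov k r)"
proof -
  have right: "(\<Sum>a\<in>K. markov k r (w @ [a])) = markov k r w" for w
  proof (cases "length w \<le> k")
    case False
    then have "(\<Sum>a\<in>K. markov k r (w @ [a])) = markov k r w * (r (last_part k w) / r (last_part k w))"
      by (simp add: markov_snoc consistent_uptoD flip: sum_distrib_left sum_divide_distrib)
    then show ?thesis using markov_last_part[of w] False by auto
  qed (simp add: markov_short consistent_uptoD)
  have left: "(\<Sum>a\<in>K. markov k r (a # w)) = markov k r w" for w
  proof (induction w rule: rev_induct)
    case Nil show ?case by (simp add: markov_short consistent_uptoD)
  next
    case (snoc b w)
    show ?case
    proof (cases "length w < k")
      case False
      then have "markov k r (a # w @ [b]) = markov k r (a # w) * (r (last_part k w @ [b]) / r (last_part k w))" for a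
        using markov_snoc[of "a # w" b] by (simp add: Suc_diff_le)
      then show ?thesis using False snoc markov_snoc[of w b] by (simp flip: sum_distrib_right sum_divide_distrib)
    qed (simp add: markov_short consistent_uptoD)
  qed
  show ?thesis using left right r
    by (auto simp: stationary_def markov_nonneg markov_outside markov_short consistent_upto_def)
qed

text \<open>From length \<open>k\<close> on the transition ratio depends on the last
  \<open>k\<close> letters alone. Summing out everything before them leaves the same conditional
  entropy at every length, so the increments are constant.\<close>

lemma entropy_rate_markov: "cross_entropy K k r r \<le> entropy_rate K (markov k r)"
proof (rule entropy_rate_ge_increment[OF stationary_markov])
  fix n assume "k \<le> n"
  then obtain j where n: "n = j + k" by (metis add.commute le_Suc_ex)
  let ?m = "markov k r"
  note st = stationary_markov
  have "cross_entropy K n ?m ?m = - (\<Sum>u\<in>words K j. \<Sum>v\<in>words K k. \<Sum>a\<in>K.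
      ?m (u @ v @ [a]) * ln (r (v @ [a]) / r v))"
    unfolding cross_entropy_def n sum_words_append
  proof (intro arg_cong[of _ _ uminus] sum.cong refl)
    fix u v a assume v: "v \<in> words K k" and "u \<in> words K j"
    have "?m ((u @ v) @ [a]) = ?m (u @ v) * (r (v @ [a]) / r v)"
      using v by (subst markov_snoc) (auto simp: words_def)
    then show "?m ((u @ v) @ [a]) * ln (?m ((u @ v) @ [a]) / ?m (u @ v)) =
        ?m (u @ v @ [a]) * ln (r (v @ [a]) / r v)" by auto
  qed
  also have "\<dots> = - (\<Sum>v\<in>words K k. \<Sum>a\<in>K. \<Sum>u\<in>words K j. ?m (u @ v @ [a]) * ln (r (v @ [a]) / r v))"
    by (simp only: sum.swap[of _ "words K j"])
  also have "\<dots> = - (\<Sum>v\<in>words K k. \<Sum>a\<in>K. ?m (v @ [a]) * ln (r (v @ [a]) / r v))"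
    by (simp add: stationary_sum_prepend[OF st] flip: sum_distrib_right)
  also have "\<dots> = cross_entropy K k r r"
    unfolding cross_entropy_def
    by (intro arg_cong[of _ _ uminus] sum.cong refl) (auto simp: markov_short words_def)
  finally show "cross_entropy K k r r \<le> block_entropy K ?m (Suc n) - block_entropy K ?m n"
    by (simp add: block_entropy_increment[OF st])
qed

end

lemma stationary_consistent_upto: "stationary K c \<Longrightarrow> consistent_upto K k c"
  by (simp add: stationary_def consistent_upto_def)

end

section \<open>Maximizing weights of maximal entropy\<close>

definition sft_weights :: "'k set \<Rightarrow> ('k \<Rightarrow> 'k \<Rightarrow> bool) \<Rightarrow> ('k list \<Rightarrow> real) set" where
  "sft_weights K T = {c. stationary K c \<and> (\<forall>a b. c [a, b] \<noteq> 0 \<longrightarrow> T a b)}"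

text \<open>A dominant \<open>c\<close> is determined by \<open>k\<close> and the finite set of words of length \<open>k + 1\<close> that it charges:
  this makes the dominant measures countable.\<close>
definition dominant :: "'k set \<Rightarrow> ('k \<Rightarrow> 'k \<Rightarrow> bool) \<Rightarrow> nat \<Rightarrow> ('k list \<Rightarrow> real) \<Rightarrow> bool" where
  "dominant K T k c \<longleftrightarrow> c \<in> sft_weights K T \<and>
     (\<forall>c'\<in>sft_weights K T. (\<forall>v\<in>words K (Suc k). c' v \<noteq> 0 \<longrightarrow> c v \<noteq> 0) \<and>
        entropy_rate K c \<le> entropy_rate K c' \<longrightarrow> c' = c)"

lemma (in finite_alphabet) sft_weights_mix:
  assumes "c \<in> sft_weights K T" "c' \<in> sft_weights K T" "0 \<le> a" "a \<le> 1"
  shows "mix a c c' \<in> sft_weights K T"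
proof -
  have "T x y" if "mix a c c' [x, y] \<noteq> 0" for x y
    using assms(1,2) that by (cases "c [x, y] = 0"; cases "c' [x, y] = 0") (auto simp: sft_weights_def mix_def)
  then show ?thesis using assms stationary_mix by (auto simp: sft_weights_def)
qed

text \<open>The rate is affine, so \<open>c1\<close> or \<open>c2\<close> has at least the rate of
  \<open>c\<close>, and a proper combination charges every word that either of them charges.
  Dominance identifies that one with \<open>c\<close>; the equation then determines
  \<open>c1\<close>.\<close>

lemma (in finite_alphabet) dominant_extremal:
  assumes dom: "dominant K T k c" and c: "c1 \<in> sft_weights K T" "c2 \<in> sft_weights K T"
    and a: "0 < a" "a < 1" and eq: "c = mix a c1 c2"
  shows "c1 = c"
proof -
  have st: "stationary K c1" "stationary K c2" using c by (auto simp: sft_weights_def)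
  have nn: "0 \<le> c1 w" "0 \<le> c2 w" for w using st by (auto simp: stationary_def)
  have supp: "c w \<noteq> 0" if "c1 w \<noteq> 0 \<or> c2 w \<noteq> 0" for w
  proof -
    have "0 < a * c1 w + (1 - a) * c2 w"
      using that nn[of w] a
      by (metis add_nonneg_pos add_pos_nonneg diff_gt_0_iff_gt less_imp_le mult_nonneg_nonneg
          mult_pos_pos order.strict_iff_order)
    then show ?thesis by (simp add: eq mix_def)
  qed
  have dom': "c' = c" if "c' \<in> {c1, c2}" "entropy_rate K c \<le> entropy_rate K c'" for c'
    using dom c supp that unfolding dominant_def by blast
  have "entropy_rate K c = a * entropy_rate K c1 + (1 - a) * entropy_rate K c2"
    unfolding eq using a by (intro entropy_rate_mix st) auto
  then have "entropy_rate K c \<le> entropy_rate K c1 \<or> entropy_rate K c \<le> entropy_rate K c2"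
    using add_strict_mono[OF mult_strict_left_mono[of "entropy_rate K c1" "entropy_rate K c" a]
        mult_strict_left_mono[of "entropy_rate K c2" "entropy_rate K c" "1 - a"]] a
    by (force simp: algebra_simps not_le)
  then show ?thesis
  proof
    assume "entropy_rate K c \<le> entropy_rate K c2"
    then have c2: "c2 = c" by (intro dom') auto
    show ?thesis
    proof
      fix w
      have "c w = a * c1 w + (1 - a) * c w" using fun_cong[OF eq, of w] c2 by (simp add: mix_def)
      then have "a * (c1 w - c w) = 0" by (simp only: left_diff_distrib right_diff_distrib mult_1_left)
      then have "a = 0 \<or> c1 w - c w = 0" by (simp only: mult_eq_0_iff)
      then show "c1 w = c w" using a(1) by linarith
    qed
  qed (auto intro: dom')
qed

locale maximizing_weight = finite_alphabet K for K :: "'k set" +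
  fixes T :: "'k \<Rightarrow> 'k \<Rightarrow> bool" and k :: nat and \<phi> :: "'k list \<Rightarrow> real" and s :: "'k list \<Rightarrow> real"
  assumes k: "k \<ge> 1" and s: "s \<in> sft_weights K T"
    and max_integral: "c \<in> sft_weights K T \<Longrightarrow>
      (\<Sum>w\<in>words K k. \<phi> w * c w) \<le> (\<Sum>w\<in>words K k. \<phi> w * s w)"
    and max_entropy: "c \<in> sft_weights K T \<Longrightarrow>
      (\<Sum>w\<in>words K k. \<phi> w * c w) = (\<Sum>w\<in>words K k. \<phi> w * s w) \<Longrightarrow>
      entropy_rate K c \<le> entropy_rate K s"
begin

definition L :: "('k list \<Rightarrow> real) \<Rightarrow> real" where
  "L c = (\<Sum>w\<in>words K k. \<phi> w * c w)"

lemma L_le: "c \<in> sft_weights K T \<Longrightarrow> L c \<le> L s"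
  and rate_le: "c \<in> sft_weights K T \<Longrightarrow> L c = L s \<Longrightarrow> entropy_rate K c \<le> entropy_rate K s"
  using max_integral max_entropy by (auto simp: L_def)

lemma L_mix: "L (mix a c c') = a * L c + (1 - a) * L c'"
  by (simp add: L_def mix_def algebra_simps sum.distrib sum_subtractf sum_distrib_left)

lemma st: "stationary K s"
  using s by (simp add: sft_weights_def)

lemmas s_nonneg = stationary_nonneg[OF st]

text \<open>The extension changes no weight up to length \<open>k + 1\<close>. Two-letter words are
  that short because \<open>k \<ge> 1\<close>, and \<open>L\<close> reads words of length
  \<open>k\<close>.\<close>

lemma markov_mem:
  assumes r: "consistent_upto K k r" and T: "\<And>a b. r [a, b] \<noteq> 0 \<Longrightarrow> T a b"
  shows "markov k r \<in> sft_weights K T" "L (markov k r) = L r"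
proof -
  show "markov k r \<in> sft_weights K T"
    using stationary_markov[OF r] T k by (auto simp: sft_weights_def markov_short)
  show "L (markov k r) = L r"
    unfolding L_def by (intro sum.cong refl) (auto simp: markov_short words_def)
qed

text \<open>Moving from \<open>s\<close> slightly away from \<open>c\<close> keeps the weights of words of length \<open>k + 1\<close> nonnegative.\<close>
lemma carried_imp_maximizing:
  assumes c: "c \<in> sft_weights K T" and supp: "\<And>v. v \<in> words K (Suc k) \<Longrightarrow> s v = 0 \<Longrightarrow> c v = 0"
  shows "L c = L s"
proof -
  have stc: "stationary K c" using c by (simp add: sft_weights_def)
  \<comment> \<open>The least positive weight among words of length \<open>k + 1\<close>; the
    inserted 1 keeps the set nonempty. Since \<open>c v \<le> 1\<close>, subtracting
    \<open>\<epsilon> * c v\<close> from a positive \<open>s v\<close> stays nonnegative.\<close>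
  define \<epsilon> where "\<epsilon> = Min (insert 1 (s ` {v \<in> words K (Suc k). s v \<noteq> 0}))"
  have eps: "0 < \<epsilon>"
    unfolding \<epsilon>_def using s_nonneg by (subst Min_gr_iff) (auto simp: order.strict_iff_order)
  have eps_le: "\<epsilon> \<le> s v" if "v \<in> words K (Suc k)" "s v \<noteq> 0" for v
    unfolding \<epsilon>_def using that by (intro Min_le) auto
  define r where "r = mix (1 + \<epsilon>) s c"
  have r_long: "0 \<le> r v" if "v \<in> words K (Suc k)" for v
  proof (cases "s v = 0")
    case False
    have "\<epsilon> * c v \<le> \<epsilon>" using eps stationary_le_1[OF stc, of v] by simp
    then have "0 \<le> s v - \<epsilon> * c v" using eps_le[OF that False] by simp
    moreover have "0 \<le> \<epsilon> * s v" using eps s_nonneg[of v] by simp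
    ultimately show ?thesis by (simp add: r_def mix_def algebra_simps)
  qed (use supp that in \<open>simp add: r_def mix_def\<close>)
  have r_out: "r w = 0" if "\<not> set w \<subseteq> K" for w
    using that by (simp add: r_def mix_def stationary_outside[OF st] stationary_outside[OF stc])
  have r_nonneg: "0 \<le> r w" if "length w \<le> Suc k" for w
  proof (cases "set w \<subseteq> K")
    case True
    \<comment> \<open>A shorter word inherits nonnegativity as the sum over its extensions to length
      \<open>k + 1\<close>.\<close>
    have "r w = (\<Sum>u\<in>words K (Suc k - length w). r (w @ u))"
      unfolding r_def mix_def sum.distrib sum_distrib_left[symmetric]
      by (simp only: stationary_sum_append[OF st] stationary_sum_append[OF stc])
    also have "\<dots> \<ge> 0"
      using True that by (intro sum_nonneg r_long) (auto simp: words_def)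
    finally show ?thesis .
  qed (simp add: r_out)
  have "(\<Sum>a\<in>K. r (w @ [a])) = r w" "(\<Sum>a\<in>K. r (a # w)) = r w" for w
    unfolding r_def mix_def sum.distrib sum_distrib_left[symmetric]
    by (simp_all only: stationary_snoc[OF st] stationary_snoc[OF stc] stationary_Cons[OF st] stationary_Cons[OF stc])
  moreover have "r [] = 1"
    by (simp add: r_def mix_def stationary_Nil[OF st] stationary_Nil[OF stc])
  ultimately have "consistent_upto K k r"
    unfolding consistent_upto_def using r_nonneg r_out by blast
  moreover have "T a b" if "r [a, b] \<noteq> 0" for a b
    using s c that by (cases "s [a, b] = 0"; cases "c [a, b] = 0") (auto simp: r_def mix_def sft_weights_def)
  ultimately have "L r \<le> L s" using markov_mem[of r] L_le by metis
  \<comment> \<open>By affinity \<open>L r = L s + \<epsilon> * (L s - L c)\<close>.\<close>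
  then have "\<epsilon> * (L s - L c) \<le> 0" by (simp add: r_def L_mix algebra_simps)
  then have "L s \<le> L c" using eps by (simp add: mult_le_0_iff)
  then show ?thesis using L_le[OF c] by simp
qed

text \<open>An affine functional that attains its maximum at a proper mixture attains it at both
  parts. The integral comes first, since the entropy bound is available only for weights with
  maximal integral.\<close>

lemma face:
  assumes "c \<in> sft_weights K T" "c' \<in> sft_weights K T" "0 < a" "a < 1" "s = mix a c c'"
  shows "L c = L s" "entropy_rate K c = entropy_rate K s"
proof -
  have tight: "x = z" if "x \<le> z" "y \<le> z" "z = a * x + (1 - a) * y" for x y z :: real
  proof -
    have "a * (z - x) + (1 - a) * (z - y) = 0" using that(3) by (simp add: algebra_simps)
    moreover have "0 \<le> a * (z - x)" "0 \<le> (1 - a) * (z - y)" using that assms(3,4) by auto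
    ultimately have "a * (z - x) = 0" by linarith
    then show ?thesis using assms(3) by simp
  qed
  have Ls: "L s = a * L c + (1 - a) * L c'" using L_mix assms(5) by metis
  show Lc: "L c = L s" by (rule tight[OF L_le L_le Ls]) (use assms in auto)
  then have Lc': "L c' = L s" 
  proof -
    have "(1 - a) * (L c' - L s) = 0" using Ls Lc by (simp add: algebra_simps)
    then show ?thesis using assms(4) by simp
  qed
  have "entropy_rate K s = a * entropy_rate K c + (1 - a) * entropy_rate K c'"
    unfolding assms(5) using assms(1-4) by (intro entropy_rate_mix) (auto simp: sft_weights_def)
  then show "entropy_rate K c = entropy_rate K s"
    using assms Lc Lc' by (intro tight[OF rate_le rate_le]) auto
qed

subsection \<open>The graph of charged words\<close>

definition V :: "'k list set" where
  "V = {v \<in> words K k. s v > 0}"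

text \<open>The de Bruijn graph of order \<open>k\<close>, cut down to the charged words.\<close>

definition E :: "('k list \<times> 'k list) set" where
  "E = {(take k v, drop 1 v) | v. v \<in> words K (Suc k) \<and> s v > 0}"

text \<open>Membership is preserved in both directions, so the complement within \<open>V\<close> is
  closed too, and sliding a window along a charged word never changes membership.\<close>

definition closed :: "'k list set \<Rightarrow> bool" where
  "closed D \<longleftrightarrow> D \<subseteq> words K k \<and> (\<forall>(x, y)\<in>E. x \<in> D \<longleftrightarrow> y \<in> D)"

lemma E_subset: "E \<subseteq> V \<times> V"
proof -
  have "take k v \<in> V \<and> drop 1 v \<in> V" if "v \<in> words K (Suc k)" "s v > 0" for v
    using that stationary_pos_append(1)[OF st, of "take k v" "drop k v"]
      stationary_pos_append(2)[OF st, of "take 1 v" "drop 1 v"]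
    by (auto simp: V_def words_def dest: in_set_takeD in_set_dropD)
  then show ?thesis by (auto simp: E_def)
qed

lemma finite_V: "finite V"
  by (simp add: V_def)

text \<open>The flow into \<open>D\<close> equals the flow out of \<open>D\<close>.\<close>
lemma closedI:
  assumes D: "D \<subseteq> words K k" and forward: "\<And>x y. (x, y) \<in> E \<Longrightarrow> x \<in> D \<Longrightarrow> y \<in> D"
  shows "closed D"
proof -
  \<comment> \<open>The value is \<open>s v\<close> on an edge entering \<open>D\<close> and
    \<open>- s v\<close> on an edge leaving it. Forward closure excludes leaving edges, so total 0
    excludes entering ones.\<close>
  define g where "g v = s v * (of_bool (drop 1 v \<in> D) - of_bool (take k v \<in> D))" for v
  have "(\<Sum>v\<in>words K (Suc k). s v * of_bool (drop 1 v \<in> D)) = (\<Sum>w\<in>words K k. s w * of_bool (w \<in> D))"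
    by (simp add: sum_words_Cons stationary_Cons[OF st] flip: sum_distrib_right)
  moreover have "(\<Sum>v\<in>words K (Suc k). s v * of_bool (take k v \<in> D)) = (\<Sum>w\<in>words K k. s w * of_bool (w \<in> D))"
    unfolding sum_words_snoc
  proof (intro sum.cong refl)
    fix w assume "w \<in> words K k"
    then show "(\<Sum>a\<in>K. s (w @ [a]) * of_bool (take k (w @ [a]) \<in> D)) = s w * of_bool (w \<in> D)"
      by (simp add: words_def stationary_snoc[OF st] flip: sum_distrib_right)
  qed
  ultimately have sum: "(\<Sum>v\<in>words K (Suc k). g v) = 0"
    by (simp add: g_def right_diff_distrib sum_subtractf del: of_bool_eq_iff)
  have nn: "0 \<le> g v" if "v \<in> words K (Suc k)" for v
  proof (cases "s v > 0")
    case True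
    then have "(take k v, drop 1 v) \<in> E" using that by (auto simp: E_def)
    then show ?thesis using forward[of "take k v" "drop 1 v"] True by (auto simp: g_def)
  qed (use s_nonneg[of v] in \<open>simp add: g_def\<close>)
  have "g v = 0" if "v \<in> words K (Suc k)" for v
    using sum_nonneg_eq_0_iff[of "words K (Suc k)" g] nn sum that by simp
  then show ?thesis using D by (fastforce simp: closed_def E_def g_def split: if_splits)
qed

definition component :: "'k list \<Rightarrow> 'k list set" where
  "component u = {w. (u, w) \<in> E\<^sup>*}"

lemma component_subset: "u \<in> V \<Longrightarrow> component u \<subseteq> V"
proof
  fix w assume "w \<in> component u" and u: "u \<in> V"
  then have "(u, w) \<in> E\<^sup>*" by (simp add: component_def)
  then show "w \<in> V" by (induction rule: rtrancl_induct) (use u E_subset in auto)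
qed

lemma closed_component: "u \<in> V \<Longrightarrow> closed (component u)"
  using component_subset[of u]
  by (intro closedI) (auto simp: component_def V_def intro: rtrancl_into_rtrancl)

text \<open>The set reachable from \<open>w\<close> is forward closed, hence by conservation of flow
  also backward closed; so it contains every vertex from which \<open>w\<close> can be
  reached.\<close>

lemma E_rtrancl_sym:
  assumes "w \<in> V" "(u, w) \<in> E\<^sup>*" shows "(w, u) \<in> E\<^sup>*"
proof -
  have "u \<in> component w" using assms(2)
  proof (induction rule: converse_rtrancl_induct)
    case (step y z)
    then show ?case using closed_component[OF assms(1)] by (auto simp: closed_def)
  qed (simp add: component_def)
  then show ?thesis by (simp add: component_def)
qed

lemma component_eq:
  assumes "u \<in> V" "w \<in> component u" shows "component w = component u"
  using assms E_rtrancl_sym[of w u] component_subset[of u]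
  by (auto simp: component_def intro: rtrancl_trans)

lemma components_disjoint:
  assumes "C \<in> component ` V" "C' \<in> component ` V" "C \<noteq> C'" shows "C \<inter> C' = {}"
  using assms component_eq by blast

lemma Union_components: "\<Union>(component ` V) = V"
  using component_subset by (auto simp: component_def)

subsection \<open>Restriction to a closed set of words\<close>

definition mass :: "'k list set \<Rightarrow> real" where
  "mass D = (\<Sum>u\<in>D. s u)"

text \<open>\<open>s\<close> conditioned on the \<open>k\<close> letters following \<open>w\<close>
  lying in \<open>D\<close>. Placing the window after \<open>w\<close> gives one formula for all
  lengths, including those below \<open>k\<close>.\<close>

definition restr :: "'k list set \<Rightarrow> 'k list \<Rightarrow> real" where
  "restr D w = (\<Sum>u\<in>D. s (w @ u)) / mass D"

text \<open>Consecutive windows of length \<open>k\<close> in a charged word are joined by an edge,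
  because the factor of length \<open>k + 1\<close> containing both is charged.\<close>

lemma closed_path:
  assumes D: "closed D"
  shows "length w \<ge> k \<Longrightarrow> s w > 0 \<Longrightarrow> take k w \<in> D \<longleftrightarrow> last_part k w \<in> D"
proof (induction w)
  case (Cons a w)
  show ?case
  proof (cases "length w \<ge> k")
    case True
    have pos: "s w > 0" using stationary_pos_append[OF st, of "[a]" w] Cons.prems by simp
    define v where "v = take (Suc k) (a # w)"
    have "s v > 0" using stationary_pos_append(1)[OF st, of v "drop (Suc k) (a # w)"] Cons.prems
      unfolding v_def append_take_drop_id by simp
    moreover have "set v \<subseteq> K" using calculation stationary_outside[OF st, of v] by force
    ultimately have "v \<in> words K (Suc k)" "s v > 0" using True by (auto simp: words_def v_def)
    then have "(take k v, drop 1 v) \<in> E" by (auto simp: E_def)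
    then have "take k (a # w) \<in> D \<longleftrightarrow> take k w \<in> D"
    proof -
      have "take k v = take k (a # w)" "drop 1 v = take k w" unfolding v_def take_take by (simp_all add: min_def)
      then show ?thesis using D \<open>(take k v, drop 1 v) \<in> E\<close> unfolding closed_def by auto
    qed
    then show ?thesis using Cons.IH[OF True pos] True by (simp add: Suc_diff_le)
  next
    case False
    then have "length (a # w) = k" using Cons.prems by simp
    then show ?thesis by simp
  qed
qed simp

lemma closed_sum:
  fixes f :: "_ \<Rightarrow> real"
  assumes D: "closed D"
  shows "(\<Sum>u\<in>D. f u) = (\<Sum>u\<in>words K k. f u * of_bool (u \<in> D))"
  using D by (intro sum.mono_neutral_cong_left) (auto simp: closed_def)

lemma restr_mem:
  assumes D: "closed D" and m: "mass D > 0"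
  shows "restr D \<in> sft_weights K T"
proof -
  have DK: "D \<subseteq> words K k" using D by (simp add: closed_def)
  have le: "restr D w \<noteq> 0 \<Longrightarrow> s w > 0" for w
  proof (rule ccontr)
    assume "restr D w \<noteq> 0" and "\<not> s w > 0"
    then have "s (w @ u) = 0" for u
      using stationary_append_le[OF st, of w u] s_nonneg[of "w @ u"] by linarith
    then show False using \<open>restr D w \<noteq> 0\<close> by (simp add: restr_def)
  qed
  \<comment> \<open>Closedness enters here: appending a letter to \<open>w\<close> moves the window
    along one edge. For a preceding letter the window does not move, so stationarity of
    \<open>s\<close> is enough.\<close>
  have right: "(\<Sum>a\<in>K. \<Sum>u\<in>D. s (w @ a # u)) = (\<Sum>u\<in>D. s (w @ u))" for w
  proof -
    have "(\<Sum>a\<in>K. \<Sum>u\<in>D. s (w @ a # u)) = (\<Sum>v\<in>words K (Suc k). s (w @ v) * of_bool (drop 1 v \<in> D))"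
      by (subst sum.swap) (simp add: closed_sum[OF D] sum_words_Cons sum_distrib_right)
    also have "\<dots> = (\<Sum>v\<in>words K (Suc k). s (w @ v) * of_bool (take k v \<in> D))"
    proof (intro sum.cong refl)
      fix v assume v: "v \<in> words K (Suc k)"
      show "s (w @ v) * of_bool (drop 1 v \<in> D) = s (w @ v) * of_bool (take k v \<in> D)"
      proof (cases "s v > 0")
        case True
        then have "(take k v, drop 1 v) \<in> E" using v by (auto simp: E_def)
        then show ?thesis using D by (auto simp: closed_def)
      next
        case False
        then have "s (w @ v) = 0" using stationary_prepend_le[OF st, of w v] s_nonneg[of "w @ v"] by simp
        then show ?thesis by simp
      qed
    qed
    also have "\<dots> = (\<Sum>u\<in>words K k. \<Sum>b\<in>K. s (w @ u @ [b]) * of_bool (u \<in> D))"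
      unfolding sum_words_snoc by (intro sum.cong refl) (auto simp: words_def)
    also have "\<dots> = (\<Sum>u\<in>D. s (w @ u))"
      using stationary_snoc[OF st, of "w @ _"]
      by (simp add: closed_sum[OF D] flip: sum_distrib_right)
    finally show ?thesis .
  qed
  have "stationary K (restr D)"
    unfolding stationary_def restr_def
  proof (intro conjI allI impI)
    show "(\<Sum>u\<in>D. s ([] @ u)) / mass D = 1" using m by (simp add: mass_def)
    show "0 \<le> (\<Sum>u\<in>D. s (w @ u)) / mass D" for w
      using m by (intro divide_nonneg_pos sum_nonneg s_nonneg)
    show "(\<Sum>u\<in>D. s (w @ u)) / mass D = 0" if "\<not> set w \<subseteq> K" for w
      using that by (simp add: stationary_outside[OF st])
    show "(\<Sum>a\<in>K. (\<Sum>u\<in>D. s ((w @ [a]) @ u)) / mass D) = (\<Sum>u\<in>D. s (w @ u)) / mass D" for w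
      using right[of w] by (simp flip: sum_divide_distrib)
    show "(\<Sum>a\<in>K. (\<Sum>u\<in>D. s ((a # w) @ u)) / mass D) = (\<Sum>u\<in>D. s (w @ u)) / mass D" for w
      unfolding sum_divide_distrib[symmetric] by (subst sum.swap) (simp add: stationary_Cons[OF st])
  qed
  then show ?thesis using le s by (force simp: sft_weights_def)
qed

lemma restr_eq:
  assumes D: "closed D" and w: "length w \<ge> k"
  shows "restr D w = s w * of_bool (take k w \<in> D) / mass D"
proof -
  have "s (w @ u) * of_bool (u \<in> D) = s (w @ u) * of_bool (take k w \<in> D)" if "u \<in> words K k" for u
  proof (cases "s (w @ u) > 0")
    case True
    then show ?thesis using closed_path[OF D, of "w @ u"] w that by (simp add: words_def)
  qed (use s_nonneg[of "w @ u"] in simp)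
  then have "(\<Sum>u\<in>D. s (w @ u)) = (\<Sum>u\<in>words K k. s (w @ u) * of_bool (take k w \<in> D))"
    unfolding closed_sum[OF D] by (intro sum.cong refl) auto
  also have "\<dots> = s w * of_bool (take k w \<in> D)"
    by (simp add: stationary_sum_append[OF st] flip: sum_distrib_right)
  finally show ?thesis by (simp add: restr_def)
qed

lemma sum_V: "(\<Sum>u\<in>V. s (w @ u)) = s w"
proof -
  have "s (w @ u) = 0" if "u \<in> words K k - V" for u
    using that stationary_prepend_le[OF st, of w u] s_nonneg[of u] s_nonneg[of "w @ u"]
    by (auto simp: V_def)
  then have "(\<Sum>u\<in>V. s (w @ u)) = (\<Sum>u\<in>words K k. s (w @ u))"
    by (intro sum.mono_neutral_left) (auto simp: V_def)
  then show ?thesis by (simp add: stationary_sum_append[OF st])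
qed

lemma mass_V: "mass V = 1"
  using sum_V[of "[]"] by (simp add: mass_def stationary_Nil[OF st])

lemma mass_pos: "D \<subseteq> V \<Longrightarrow> D \<noteq> {} \<Longrightarrow> mass D > 0"
  unfolding mass_def using finite_V by (intro sum_pos) (auto simp: V_def intro: finite_subset)

text \<open>\<open>s\<close> is the mixture of its restrictions to \<open>D\<close> and to
  \<open>V - D\<close>, with coefficient the mass of \<open>D\<close>, so \<open>face\<close>
  applies. The case \<open>D = V\<close> is separate because the other part would have mass
  0.\<close>

lemma restr_maximizing:
  assumes D: "closed D" "D \<subseteq> V" "D \<noteq> {}"
  shows "L (restr D) = L s \<and> entropy_rate K (restr D) = entropy_rate K s"
proof (cases "D = V")
  case True
  then have "restr D = s" by (auto simp: restr_def mass_V sum_V)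
  then show ?thesis by simp
next
  case False
  let ?D' = "V - D"
  have cl: "closed ?D'"
    using D(1) E_subset by (auto simp: closed_def V_def)
  have split: "(\<Sum>u\<in>V. f u) = (\<Sum>u\<in>D. f u) + (\<Sum>u\<in>?D'. f u)" for f :: "_ \<Rightarrow> real"
    using sum.subset_diff[OF D(2) finite_V, of f] by simp
  have pos: "mass D > 0" "mass ?D' > 0" using D False by (auto intro!: mass_pos)
  have m: "mass ?D' = 1 - mass D" using mass_V split[of s] by (simp add: mass_def)
  have "s = mix (mass D) (restr D) (restr ?D')"
  proof
    fix w show "s w = mix (mass D) (restr D) (restr ?D') w"
      using pos split[of "\<lambda>u. s (w @ u)"] by (simp add: mix_def restr_def sum_V flip: m)
  qed
  then show ?thesis
    using face[OF restr_mem[OF D(1) pos(1)] restr_mem[OF cl pos(2)]] pos m by auto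
qed

lemma restr_pos_iff:
  assumes "closed D" "D \<subseteq> V" "D \<noteq> {}" "length w \<ge> k"
  shows "restr D w > 0 \<longleftrightarrow> s w > 0 \<and> take k w \<in> D"
  using restr_eq[OF assms(1,4)] mass_pos[OF assms(2,3)] by (auto simp: zero_less_divide_iff)

text \<open>Equality in Gibbs' inequality for the midpoint of two maximizers of the entropy rate gives them
  the same transition probabilities. The ratio of their weights on words of length \<open>k\<close> is then
  harmonic along the edges of the component, hence constant.\<close>
lemma dominant_restr:
  assumes u: "u \<in> V"
  shows "dominant K T k (restr (component u))"
  unfolding dominant_def
proof (intro conjI ballI impI; (elim conjE)?)
  define D where "D = component u"
  define c where "c = restr D"
  have D: "closed D" "D \<subseteq> V" "D \<noteq> {}"
    using closed_component[OF u] component_subset[OF u] by (auto simp: D_def component_def)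
  then have DK: "D \<subseteq> words K k" by (simp add: closed_def)
  have c: "c \<in> sft_weights K T" unfolding c_def by (intro restr_mem mass_pos D)
  then show "restr (component u) \<in> sft_weights K T" by (simp add: c_def D_def)
  fix c' assume c': "c' \<in> sft_weights K T"
    and carried: "\<forall>v\<in>words K (Suc k). c' v \<noteq> 0 \<longrightarrow> restr (component u) v \<noteq> 0"
    and "entropy_rate K (restr (component u)) \<le> entropy_rate K c'"
  then have ge: "entropy_rate K c \<le> entropy_rate K c'" by (simp add: c_def D_def)
  have supp: "c' v = 0" if "v \<in> words K (Suc k)" "c v = 0" for v
    using that carried by (auto simp: c_def D_def)
  have stc: "stationary K c" and stc': "stationary K c'" using c c' by (auto simp: sft_weights_def)
  note nn = stationary_nonneg[OF stc] and nn' = stationary_nonneg[OF stc']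
  define h where "h = entropy_rate K s"
  have Lc: "L c = L s" and hc: "entropy_rate K c = h"
    using restr_maximizing[OF D] by (auto simp: c_def h_def)
  have c_pos: "c w > 0 \<longleftrightarrow> s w > 0 \<and> take k w \<in> D" if "length w \<ge> k" for w
    unfolding c_def by (rule restr_pos_iff[OF D that])
  have "c v = 0" if "v \<in> words K (Suc k)" "s v = 0" for v
    using c_pos[of v] nn[of v] that by (auto simp: words_def)
  then have Lc': "L c' = L s" by (intro carried_imp_maximizing c') (auto intro: supp)
  have hc': "entropy_rate K c' = h" using rate_le[OF c' Lc'] ge hc by (simp add: h_def)
  define r where "r = mix (1 / 2) c c'"
  have r: "r \<in> sft_weights K T" unfolding r_def by (intro sft_weights_mix c c') auto
  then have str: "stationary K r" by (simp add: sft_weights_def)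
  have r_eq: "r w = (c w + c' w) / 2" for w by (simp add: r_def mix_def)
  \<comment> \<open>The Markov extension of the midpoint also maximizes \<open>L\<close>, so its
    rate is at most \<open>h\<close>. This caps the conditional entropy of \<open>r\<close> at order
    \<open>k\<close>, hence at every higher order.\<close>
  have "L (markov k r) = L s" "markov k r \<in> sft_weights K T"
    using markov_mem[OF stationary_consistent_upto[OF str]] r Lc Lc'
    by (auto simp: sft_weights_def r_def L_mix)
  then have "cross_entropy K k r r \<le> h"
    using entropy_rate_markov[OF stationary_consistent_upto[OF str], of k] rate_le[of "markov k r"]
    by (simp add: h_def)
  then have cross_r: "cross_entropy K n r r \<le> h" if "n \<ge> k" for n
    using increment_antimono[OF str that] by (simp add: block_entropy_increment[OF str])
  have cross_half: "cross_entropy K n r r = (cross_entropy K n c r + cross_entropy K n c' r) / 2" for n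
  proof -
    have *: "r (w @ [a]) * x = c (w @ [a]) * x / 2 + c' (w @ [a]) * x / 2" for w a x
      by (simp add: r_eq add_divide_distrib distrib_right)
    show ?thesis
      unfolding cross_entropy_def * by (simp add: sum.distrib add_divide_distrib flip: sum_divide_distrib)
  qed
  define q where "q w a = r (w @ [a]) / r w" for w a
  have q_nonneg: "0 \<le> q w a" for w a by (simp add: q_def stationary_nonneg[OF str])
  have trans: "c (w @ [a]) = c w * q w a" "c' (w @ [a]) = c' w * q w a"
    if "w \<in> words K n" "a \<in> K" "n \<ge> k" for w a n
  proof -
    have ac: "0 < r v" if "0 < c v \<or> 0 < c' v" for v
      using that nn[of v] nn'[of v] by (auto simp: r_eq)
    note gc = increment_le_cross_entropy[OF stc str, of n] and gc' = increment_le_cross_entropy[OF stc' str, of n]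
    have acc: "0 < c v \<Longrightarrow> 0 < r v" "0 < c' v \<Longrightarrow> 0 < r v" for v using ac by auto
    \<comment> \<open>Each cross entropy is at least an increment and so at least \<open>h\<close>,
      while their average is at most \<open>h\<close>; hence both equal \<open>h\<close> and the
      equality case of Gibbs' inequality holds for \<open>c\<close> and for
      \<open>c'\<close>.\<close>
    have "cross_entropy K n c r \<le> block_entropy K c (Suc n) - block_entropy K c n"
      "cross_entropy K n c' r \<le> block_entropy K c' (Suc n) - block_entropy K c' n"
      using gc(1) gc'(1) entropy_rate_le_increment[OF stc, of n] entropy_rate_le_increment[OF stc', of n]
        cross_r[OF that(3)] cross_half[of n] acc by (simp_all add: hc hc')
    then show "c (w @ [a]) = c w * q w a" "c' (w @ [a]) = c' w * q w a"
      unfolding q_def using gc(2)[OF acc(1) _ that(1,2)] gc'(2)[OF acc(2) _ that(1,2)] by blast+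
  qed
  define g where "g w = c' w / c w" for w
  have "finite D" using DK finite_words finite_subset by blast
  then have "Max (g ` D) \<in> g ` D" "\<And>w. w \<in> D \<Longrightarrow> g w \<le> Max (g ` D)" using D(3) by auto
  then obtain w0 where w0: "w0 \<in> D" "\<And>w. w \<in> D \<Longrightarrow> g w \<le> g w0" by force
  define G where "G = g w0"
  have cD: "c w > 0" if "w \<in> D" for w using that D DK c_pos[of w] by (auto simp: V_def words_def)
  \<comment> \<open>The support of \<open>c'\<close> is controlled only at length
    \<open>k + 1\<close>, so a word of length \<open>k\<close> is treated by summing over its
    one-letter extensions.\<close>
  have zero: "c w = 0 \<and> c' w = 0" if "w \<in> words K k" "w \<notin> D" for w
  proof -
    have c0: "c w = 0" using c_pos[of w] that nn[of w] by (auto simp: words_def)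
    have "c (w @ [a]) = 0" for a using stationary_append_le[OF stc, of w "[a]"] c0 nn[of "w @ [a]"] by simp
    then have "c' (w @ [a]) = 0" if "a \<in> K" for a
      using supp[of "w @ [a]"] \<open>w \<in> words K k\<close> that by (simp add: words_def)
    then have "c' w = 0" using stationary_snoc[OF stc', of w] by simp
    then show ?thesis using c0 by simp
  qed
  have G_le: "c' w \<le> G * c w" if "w \<in> words K k" for w
    using w0(2)[of w] cD[of w] zero[OF that] by (cases "w \<in> D") (auto simp: G_def g_def field_simps)
  \<comment> \<open>The maximum principle, run backwards along an edge. If \<open>y\<close> has the
    maximal ratio \<open>G\<close>, the gaps \<open>G * c - c'\<close> of the words
    \<open>b # y\<close> are nonnegative with sum 0, so all vanish; the edge word \<open>v\<close>
    is one of them, and cancelling the common transition probability leaves its first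
    \<open>k\<close> letters \<open>x\<close>.\<close>
  have pred: "x \<in> D \<and> c' x = G * c x" if xy: "(x, y) \<in> E" and y: "y \<in> D" "c' y = G * c y" for x y
  proof -
    obtain v where v: "x = take k v" "y = drop 1 v" "v \<in> words K (Suc k)" "s v > 0"
      using xy by (auto simp: E_def)
    have xD: "x \<in> D" using xy y(1) D(1) by (auto simp: closed_def)
    have decomp: "\<exists>e\<in>K. w = take k w @ [e] \<and> take k w \<in> words K k" if "w \<in> words K (Suc k)" for w
      using that by (auto simp: words_Suc_snoc) (auto simp: words_def)
    have le: "c' (b # y) \<le> G * c (b # y)" if b: "b \<in> K" for b
    proof -
      have "b # y \<in> words K (Suc k)" using b v by (auto simp: words_def dest: in_set_dropD)
      from decomp[OF this] obtain z e where z: "b # y = z @ [e]" "z \<in> words K k" "e \<in> K" by metis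
      have "c' z * q z e \<le> (G * c z) * q z e" by (intro mult_right_mono G_le z q_nonneg)
      then show ?thesis using trans[OF z(2,3)] by (simp add: z(1))
    qed
    have "(\<Sum>b\<in>K. G * c (b # y) - c' (b # y)) = 0"
      using y(2) by (simp add: sum_subtractf stationary_Cons[OF stc] stationary_Cons[OF stc'] flip: sum_distrib_left)
    then have eq: "c' (b # y) = G * c (b # y)" if "b \<in> K" for b
      using sum_nonneg_eq_0_iff[OF finite_K, of "\<lambda>b. G * c (b # y) - c' (b # y)"] le that by simp
    have "\<exists>b\<in>K. v = b # y" using v by (cases v) (auto simp: words_def)
    then have eqv: "c' v = G * c v" using eq by auto
    from decomp[OF v(3)] obtain e where e: "v = x @ [e]" "x \<in> words K k" "e \<in> K" using v(1) by metis
    have "c v > 0" using c_pos[of v] v xD by (auto simp: words_def)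
    then have "q x e \<noteq> 0" using trans(1)[OF e(2,3)] e(1) by auto
    moreover have "c' x * q x e = G * c x * q x e" using eqv trans[OF e(2,3)] e(1) by simp
    ultimately show ?thesis using xD by simp
  qed
  have onD: "c' w = G * c w" if w: "w \<in> D" for w
  proof -
    have "(w, w0) \<in> E\<^sup>*" using component_eq[OF u, of w] w w0(1) by (auto simp: D_def component_def)
    then have "w \<in> D \<and> c' w = G * c w"
    proof (induction rule: converse_rtrancl_induct)
      case base
      then show ?case using w0(1) cD[of w0] by (simp add: G_def g_def)
    next
      case (step x y)
      then show ?case using pred by blast
    qed
    then show ?thesis by simp
  qed
  have onk: "c' w = G * c w" if "w \<in> words K k" for w
    using onD zero that by (cases "w \<in> D") auto
  then have "(\<Sum>w\<in>words K k. c' w) = G * (\<Sum>w\<in>words K k. c w)"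
    by (simp add: sum_distrib_left)
  then have "G = 1" by (simp add: stationary_sum[OF stc] stationary_sum[OF stc'])
  have long: "c' w = c w" if "n \<ge> k" "w \<in> words K n" for n w
    using that
  proof (induction n arbitrary: w rule: dec_induct)
    case base
    then show ?case using onk \<open>G = 1\<close> by simp
  next
    case (step n)
    then obtain v a where "w = v @ [a]" "v \<in> words K n" "a \<in> K" by (auto simp: words_Suc_snoc)
    then show ?case using step.IH[of v] trans[of v n a] step.hyps by simp
  qed
  have "c' w = c w" for w
  proof (cases "set w \<subseteq> K")
    case True
    have "(\<Sum>u\<in>words K k. c' (w @ u)) = (\<Sum>u\<in>words K k. c (w @ u))"
      using True by (intro sum.cong refl long[of "length w + k"]) (auto simp: words_def)
    then show ?thesis by (simp add: stationary_sum_append[OF stc] stationary_sum_append[OF stc'])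
  qed (simp add: stationary_outside[OF stc] stationary_outside[OF stc'])
  then show "c' = restr (component u)" by (auto simp: c_def D_def)
qed

theorem dominant_decomposition:
  "\<exists>F z. finite F \<and> F \<noteq> {} \<and> (\<forall>c\<in>F. dominant K T k c \<and> entropy_rate K c = entropy_rate K s \<and> 0 \<le> z c) \<and>
     sum z F = 1 \<and> (\<forall>w. s w = (\<Sum>c\<in>F. z c * c w))"
proof -
  define P where "P = component ` V"
  have P: "closed C" "C \<subseteq> V" "C \<noteq> {}" if "C \<in> P" for C
    using that closed_component component_subset by (auto simp: P_def component_def)
  \<comment> \<open>A component is recovered from its restriction, which makes \<open>restr\<close>
    injective on components and lets the coefficients be indexed by the weights themselves.\<close>
  have "C = {w \<in> words K k. restr C w > 0}" if "C \<in> P" for C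
    using restr_pos_iff[OF P[OF that]] P[OF that] by (auto simp: words_def V_def)
  then have inj: "inj_on restr P" by (intro inj_onI) metis
  have finP: "finite P" using finite_V by (simp add: P_def)
  have sums: "(\<Sum>C\<in>P. \<Sum>u\<in>C. f u) = (\<Sum>u\<in>V. f u)" for f :: "_ \<Rightarrow> real"
  proof -
    have "(\<Sum>u\<in>\<Union>P. f u) = (\<Sum>C\<in>P. \<Sum>u\<in>C. f u)"
      using finP P(2) finite_V components_disjoint
      by (subst sum.Union_disjoint) (auto simp: P_def intro: finite_subset)
    then show ?thesis by (simp add: P_def Union_components)
  qed
  define z where "z c = mass (inv_into P restr c)" for c
  have z: "z (restr C) = mass C" if "C \<in> P" for C using that inj by (simp add: z_def)
  have pos: "mass C > 0" if "C \<in> P" for C using P[OF that] mass_pos by blast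
  have "V \<noteq> {}" using mass_V by (auto simp: mass_def)
  show ?thesis
  proof (intro exI[of _ "restr ` P"] exI[of _ z] conjI ballI allI)
    show "finite (restr ` P)" using finP by simp
    show "restr ` P \<noteq> {}" using \<open>V \<noteq> {}\<close> by (simp add: P_def)
    show "sum z (restr ` P) = 1"
      using sums[of s] mass_V by (simp add: sum.reindex[OF inj] z mass_def)
    show "s w = (\<Sum>c\<in>restr ` P. z c * c w)" for w
    proof -
      have "(\<Sum>c\<in>restr ` P. z c * c w) = (\<Sum>C\<in>P. \<Sum>u\<in>C. s (w @ u))"
        unfolding sum.reindex[OF inj]
      proof (intro sum.cong refl)
        fix C assume "C \<in> P"
        then show "((\<lambda>c. z c * c w) \<circ> restr) C = (\<Sum>u\<in>C. s (w @ u))"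
          using pos[of C] by (simp add: z restr_def)
      qed
      then show ?thesis by (simp add: sums sum_V)
    qed
    fix c assume "c \<in> restr ` P"
    then obtain C where C: "C \<in> P" "c = restr C" by auto
    show "dominant K T k c" using C dominant_restr by (auto simp: P_def)
    show "entropy_rate K c = entropy_rate K s" using C restr_maximizing[OF P[OF C(1)]] by simp
    show "0 \<le> z c" using C z pos[OF C(1)] by simp
  qed
qed

end

section \<open>Cylinders and invariant measures\<close>

definition cylinder :: "(nat \<Rightarrow> 'k) set \<Rightarrow> 'k list \<Rightarrow> (nat \<Rightarrow> 'k) set" where
  "cylinder X w = {x \<in> X. map x [0..<length w] = w}"

definition weight :: "(nat \<Rightarrow> nat) set \<Rightarrow> (nat \<Rightarrow> nat) measure \<Rightarrow> nat list \<Rightarrow> real" where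
  "weight X \<mu> w = measure \<mu> (cylinder X w)"

section \<open>Cylinders as an intersection-stable generator\<close>

lemma cylinder_Nil [simp]: "cylinder X [] = X"
  by (simp add: cylinder_def)

lemma cylinder_restrict: "cylinder X w = X \<inter> cylinder UNIV w"
  by (auto simp: cylinder_def)

lemma map_upt_eq_iff: "map x [0..<length w] = w \<longleftrightarrow> (\<forall>i<length w. x i = w ! i)"
  using list_eq_iff_nth_eq[of "map x [0..<length w]" w] by simp

lemma map_upt_Cons_iff: "map x [0..<Suc n] = a # w \<longleftrightarrow> x 0 = a \<and> map (\<lambda>i. x (Suc i)) [0..<n] = w"
proof -
  have "map x [0..<Suc n] = x 0 # map (\<lambda>i. x (Suc i)) [0..<n]"
    unfolding upt_conv_Cons[OF zero_less_Suc] map_Suc_upt[symmetric] by simp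
  then show ?thesis by simp
qed

lemma disjoint_cylinders_snoc: "disjoint_family_on (\<lambda>a. cylinder X (w @ [a])) S"
  by (auto simp: disjoint_family_on_def cylinder_def)

lemma disjoint_cylinders_Cons: "disjoint_family_on (\<lambda>a. cylinder X (a # w)) S"
  by (auto simp: disjoint_family_on_def cylinder_def map_upt_Cons_iff simp del: upt_Suc)

text \<open>Two cylinders are nested or disjoint; the empty set is adjoined for the second
  case.\<close>

lemma Int_stable_cylinders: "Int_stable (insert {} (range (cylinder X)))"
proof (rule Int_stableI)
  fix A B assume "A \<in> insert {} (range (cylinder X))" "B \<in> insert {} (range (cylinder X))"
  moreover have "cylinder X v \<inter> cylinder X w \<in> insert {} (range (cylinder X))"
    if "length v \<le> length w" for v w
  proof (cases "cylinder X v \<inter> cylinder X w = {}")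
    case False
    then obtain y where y: "y \<in> cylinder X v" "y \<in> cylinder X w" by auto
    have "cylinder X w \<subseteq> cylinder X v"
      using y that unfolding cylinder_def map_upt_eq_iff by auto
    then have "cylinder X v \<inter> cylinder X w = cylinder X w" by auto
    then show ?thesis by simp
  qed simp
  then have "cylinder X v \<inter> cylinder X w \<in> insert {} (range (cylinder X))" for v w
    by (metis Int_commute nat_le_linear)
  ultimately show "A \<inter> B \<in> insert {} (range (cylinder X))"
    by (elim insertE rangeE) auto
qed

lemma cylinder_UNIV_borel: "cylinder UNIV w \<in> sets (borel :: (nat \<Rightarrow> nat) measure)"
proof -
  have "cylinder UNIV w = (\<Inter>i\<in>{..<length w}. {x :: nat \<Rightarrow> nat. x i = w ! i}) \<inter> space borel"
    unfolding cylinder_def map_upt_eq_iff by auto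
  also have "\<dots> \<in> sets borel"
    by (cases "w = []") (auto intro!: sets.finite_INT pred_sets1 simp: space_borel[symmetric] simp del: space_borel)
  finally show ?thesis .
qed

lemma sets_borel_cylinders:
  "sets (borel :: (nat \<Rightarrow> nat) measure) = sigma_sets UNIV (range (cylinder UNIV))"
proof
  have "sets (borel :: (nat \<Rightarrow> nat) measure) = sets (Pi\<^sub>M UNIV (\<lambda>_. borel))"
    by (simp add: sets_PiM_equal_borel)
  also have "\<dots> = sigma_sets UNIV {{f. f i \<in> A} | i A. True}"
    by (simp add: sets_PiM_single sets_borel_eq_count_space)
  also have "\<dots> \<subseteq> sigma_sets UNIV (range (cylinder UNIV))"
  proof (rule sigma_sets_mono, safe)
    fix i :: nat and A :: "nat set"
    have "{f. f i \<in> A} = \<Union>(cylinder UNIV ` {w. length w = Suc i \<and> w ! i \<in> A})"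
    proof (intro equalityI subsetI)
      fix f assume "f \<in> {f. f i \<in> A}"
      then have "f \<in> cylinder UNIV (map f [0..<Suc i])" "map f [0..<Suc i] ! i \<in> A"
        by (auto simp: cylinder_def simp del: upt_Suc)
      then show "f \<in> \<Union>(cylinder UNIV ` {w. length w = Suc i \<and> w ! i \<in> A})"
        by (intro UN_I[of "map f [0..<Suc i]"]) auto
    qed (auto simp: cylinder_def nth_append)
    also have "\<dots> \<in> sigma_sets UNIV (range (cylinder UNIV))"
      by (intro sigma_sets_UNION) auto
    finally show "{f. f i \<in> A} \<in> sigma_sets UNIV (range (cylinder UNIV))" .
  qed
  finally show "sets (borel :: (nat \<Rightarrow> nat) measure) \<subseteq> sigma_sets UNIV (range (cylinder UNIV))" .
  show "sigma_sets UNIV (range (cylinder UNIV)) \<subseteq> sets (borel :: (nat \<Rightarrow> nat) measure)"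
    using sets.sigma_sets_subset[of "range (cylinder UNIV)" "borel :: (nat \<Rightarrow> nat) measure"]
      cylinder_UNIV_borel by auto
qed

lemma sets_restrict_cylinders:
  fixes X :: "(nat \<Rightarrow> nat) set"
  assumes "X \<in> sets borel"
  shows "sets (restrict_space borel X) = sigma_sets X (insert {} (range (cylinder X)))"
proof -
  have "sets (restrict_space borel X) = sigma_sets X ((\<inter>) X ` range (cylinder UNIV))"
    using sigma_sets_Int[of X UNIV "range (cylinder UNIV)"] assms
    by (simp add: sets_restrict_space sets_borel_cylinders)
  also have "(\<inter>) X ` range (cylinder UNIV) = range (cylinder X)"
    by (auto simp: image_image cylinder_restrict[symmetric])
  also have "sigma_sets X (range (cylinder X)) = sigma_sets X (insert {} (range (cylinder X)))"
    by (intro equalityI sigma_sets_mono) (auto intro: sigma_sets.Empty)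
  finally show ?thesis .
qed

text \<open>One Dynkin-class argument serves two purposes: uniqueness of a measure with given
  weights, where \<open>F\<close> is a singleton, and the passage of a decomposition of weights to
  all measurable sets.\<close>

lemma measure_eq_sum_of_cylinders:
  fixes X :: "(nat \<Rightarrow> nat) set"
  assumes X: "X \<in> sets borel" and \<nu>: "\<nu> \<in> borel_prob_measures X" and F: "F \<subseteq> borel_prob_measures X"
    and eq: "\<And>w. weight X \<nu> w = (\<Sum>\<mu>\<in>F. c \<mu> * weight X \<mu> w)" and B: "B \<in> sets \<nu>"
  shows "measure \<nu> B = (\<Sum>\<mu>\<in>F. c \<mu> * measure \<mu> B)"
proof -
  have sets: "sets \<mu> = sets (restrict_space borel X)" "space \<mu> = X" "prob_space \<mu>"
    if "\<mu> \<in> insert \<nu> F" for \<mu>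
    using that \<nu> F sets_eq_imp_space_eq[of \<mu> "restrict_space borel X"]
    by (auto simp: borel_prob_measures_def space_restrict_space)
  let ?G = "insert {} (range (cylinder X))"
  have G: "sigma_sets X ?G = sets \<mu>" if "\<mu> \<in> insert \<nu> F" for \<mu>
    using sets_restrict_cylinders[OF X] sets[OF that] by simp
  have "B \<in> sigma_sets X ?G" using B G[of \<nu>] by simp
  then show ?thesis
  proof (rule sigma_sets_induct_disjoint[OF Int_stable_cylinders, rotated])
    show "?G \<subseteq> Pow X" by (auto simp: cylinder_def)
    show "measure \<nu> A = (\<Sum>\<mu>\<in>F. c \<mu> * measure \<mu> A)" if "A \<in> ?G" for A
      using that eq by (auto simp: weight_def)
    show "measure \<nu> {} = (\<Sum>\<mu>\<in>F. c \<mu> * measure \<mu> {})" by simp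
    show "measure \<nu> (X - A) = (\<Sum>\<mu>\<in>F. c \<mu> * measure \<mu> (X - A))"
      if A: "A \<in> sigma_sets X ?G" "measure \<nu> A = (\<Sum>\<mu>\<in>F. c \<mu> * measure \<mu> A)" for A
    proof -
      have compl: "measure \<mu> (X - A) = measure \<mu> X - measure \<mu> A" if "\<mu> \<in> insert \<nu> F" for \<mu>
        using prob_space.prob_compl[OF sets(3)[OF that], of A] G[OF that] A(1)
          prob_space.prob_space[OF sets(3)[OF that]] sets(2)[OF that] by simp
      have "measure \<nu> X = (\<Sum>\<mu>\<in>F. c \<mu> * measure \<mu> X)" using eq[of "[]"] by (simp add: weight_def)
      then show ?thesis using A(2) compl by (simp add: right_diff_distrib sum_subtractf)
    qed
    show "measure \<nu> (\<Union>i. A i) = (\<Sum>\<mu>\<in>F. c \<mu> * measure \<mu> (\<Union>i. A i))"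
      if A: "disjoint_family A" "range A \<subseteq> sigma_sets X ?G"
        "\<And>i. measure \<nu> (A i) = (\<Sum>\<mu>\<in>F. c \<mu> * measure \<mu> (A i))" for A :: "nat \<Rightarrow> _"
    proof -
      have un: "(\<lambda>i. measure \<mu> (A i)) sums measure \<mu> (\<Union>i. A i)" if "\<mu> \<in> insert \<nu> F" for \<mu>
      proof -
        interpret prob_space \<mu> by (rule sets(3)[OF that])
        show ?thesis using A(1,2) G[OF that] by (intro finite_measure_UNION) auto
      qed
      have "(\<lambda>i. \<Sum>\<mu>\<in>F. c \<mu> * measure \<mu> (A i)) sums (\<Sum>\<mu>\<in>F. c \<mu> * measure \<mu> (\<Union>i. A i))"
        by (intro sums_sum sums_mult un) auto
      then show ?thesis using un[of \<nu>] A(3) sums_unique2 by force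
    qed
  qed
qed

lemma borel_prob_measure_eqI:
  fixes X :: "(nat \<Rightarrow> nat) set"
  assumes "X \<in> sets borel" "\<mu> \<in> borel_prob_measures X" "\<nu> \<in> borel_prob_measures X"
    and "\<And>w. weight X \<mu> w = weight X \<nu> w"
  shows "\<mu> = \<nu>"
proof (rule measure_eqI)
  show sets: "sets \<mu> = sets \<nu>" using assms by (simp add: borel_prob_measures_def)
  interpret \<mu>: prob_space \<mu> using assms(2) by (simp add: borel_prob_measures_def)
  interpret \<nu>: prob_space \<nu> using assms(3) by (simp add: borel_prob_measures_def)
  fix B assume "B \<in> sets \<mu>"
  then have "measure \<mu> B = (\<Sum>\<mu>\<in>{\<nu>}. 1 * measure \<mu> B)"
    using assms by (intro measure_eq_sum_of_cylinders[of X]) auto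
  then show "emeasure \<mu> B = emeasure \<nu> B"
    by (simp add: \<mu>.emeasure_eq_measure \<nu>.emeasure_eq_measure)
qed

subsection \<open>Extension of consistent word weights to measures\<close>

text \<open>\<open>\<omega>\<close> is a rule that prescribes a letter after every finite history;
  following it from the empty history generates a sequence.\<close>

primrec history :: "('k list \<Rightarrow> 'k) \<Rightarrow> nat \<Rightarrow> 'k list" where
  "history \<omega> 0 = []"
| "history \<omega> (Suc n) = history \<omega> n @ [\<omega> (history \<omega> n)]"

definition path :: "('k list \<Rightarrow> 'k) \<Rightarrow> nat \<Rightarrow> 'k" where
  "path \<omega> n = \<omega> (history \<omega> n)"

lemma length_history [simp]: "length (history \<omega> n) = n"
  by (induction n) auto

lemma map_path: "map (path \<omega>) [0..<n] = history \<omega> n"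
  by (induction n) (auto simp: path_def)

lemma history_eq_iff: "history \<omega> (length w) = w \<longleftrightarrow> (\<forall>i<length w. \<omega> (take i w) = w ! i)"
proof (induction w rule: rev_induct)
  case (snoc a w)
  have "(\<forall>i<length (w @ [a]). \<omega> (take i (w @ [a])) = (w @ [a]) ! i) \<longleftrightarrow>
      (\<forall>i<length w. \<omega> (take i w) = w ! i) \<and> \<omega> w = a"
    by (auto simp: less_Suc_eq nth_append)
  then show ?case using snoc by auto
qed simp

text \<open>The letter following a history \<open>h\<close> is drawn independently for every \<open>h\<close> from the conditional
  distribution \<open>c(ha) / c(h)\<close>; a single product measure over all histories then suffices.\<close>
lemma ex_measure_with_weights:
  fixes c :: "nat list \<Rightarrow> real"
  assumes c: "stationary {..<d} c"
  shows "\<exists>\<nu>. prob_space \<nu> \<and> sets \<nu> = sets borel \<and> (\<forall>w. measure \<nu> (cylinder UNIV w) = c w)"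
proof -
  interpret K: finite_alphabet "{..<d}" by unfold_locales simp
  \<comment> \<open>After a history of weight 0 any law will do; the point mass at 0 keeps
    \<open>g h\<close> a probability.\<close>
  define g where "g h a = (if c h > 0 then c (h @ [a]) / c h else of_bool (a = 0))" for h a
  define pm where "pm h = embed_pmf (g h)" for h
  have g0: "0 \<le> g h a" for h a using K.stationary_nonneg[OF c] by (simp add: g_def)
  have gsum: "(\<integral>\<^sup>+ a. ennreal (g h a) \<partial>count_space UNIV) = 1" for h
  proof (cases "c h > 0")
    case True
    have "(\<integral>\<^sup>+ a. ennreal (g h a) \<partial>count_space UNIV) = (\<Sum>a<d. ennreal (g h a))"
      using True K.stationary_outside[OF c] by (intro nn_integral_count_space') (auto simp: g_def)
    also have "\<dots> = ennreal (\<Sum>a<d. g h a)" using g0 by simp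
    also have "(\<Sum>a<d. g h a) = 1"
      using True K.stationary_snoc[OF c, of h] by (simp add: g_def flip: sum_divide_distrib)
    finally show ?thesis by simp
  next
    case False
    have "(\<integral>\<^sup>+ a. ennreal (g h a) \<partial>count_space UNIV) = (\<Sum>a\<in>{0}. ennreal (g h a))"
      using False by (intro nn_integral_count_space') (auto simp: g_def)
    then show ?thesis using False by (simp add: g_def)
  qed
  have pm: "pmf (pm h) a = g h a" for h a unfolding pm_def by (rule pmf_embed_pmf) (auto simp: g0 gsum)
  interpret P: product_prob_space "\<lambda>h. measure_pmf (pm h)" UNIV by unfold_locales
  define M where "M = Pi\<^sub>M UNIV (\<lambda>h. measure_pmf (pm h))"
  interpret M: prob_space M unfolding M_def by (rule P.prob_space_axioms)
  have spM: "space M = UNIV" by (simp add: M_def space_PiM)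
  have H: "{\<omega>. history \<omega> (length w) = w} \<in> sets M \<and> measure M {\<omega>. history \<omega> (length w) = w} = c w" for w
  proof -
    \<comment> \<open>The event fixes the rule \<open>\<omega>\<close> at the proper prefixes of
      \<open>w\<close>. These are pairwise distinct coordinates, so the product measure multiplies
      their probabilities.\<close>
    define J where "J = (\<lambda>i. take i w) ` {..<length w}"
    have inj: "inj_on (\<lambda>i. take i w) {..<length w}"
      by (intro inj_onI) (metis length_take lessThan_iff min.absorb4 min.commute)
    have eq: "{\<omega>. history \<omega> (length w) = w} = {\<omega> \<in> space M. \<forall>h\<in>J. \<omega> h \<in> {w ! length h}}"
      by (auto simp: history_eq_iff J_def spM)
    have "emeasure M {\<omega>. history \<omega> (length w) = w} = (\<Prod>h\<in>J. emeasure (measure_pmf (pm h)) {w ! length h})"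
      unfolding eq M_def by (rule P.emeasure_PiM_Collect) (auto simp: J_def)
    also have "\<dots> = ennreal (\<Prod>h\<in>J. g h (w ! length h))"
      by (simp add: emeasure_pmf_single pm prod_ennreal g0)
    also have "(\<Prod>h\<in>J. g h (w ! length h)) = (\<Prod>i<length w. g (take i w) (w ! i))"
      unfolding J_def by (subst prod.reindex[OF inj]) auto
    \<comment> \<open>The conditional weights telescope; once a prefix has weight 0, both sides
      remain 0.\<close>
    also have "(\<Prod>i<n. g (take i w) (w ! i)) = c (take n w)" if "n \<le> length w" for n
      using that
    proof (induction n)
      case (Suc n)
      have tk: "take (Suc n) w = take n w @ [w ! n]" using Suc.prems by (simp add: take_Suc_conv_app_nth)
      show ?case
      proof (cases "c (take n w) > 0")
        case False
        then have "c (take n w) = 0" "c (take (Suc n) w) = 0"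
          using K.stationary_append_le[OF c, of "take n w" "[w ! n]"] K.stationary_nonneg[OF c]
          by (auto simp: tk order.antisym not_less)
        then show ?thesis using Suc by simp
      qed (use Suc in \<open>simp add: tk g_def\<close>)
    qed (simp add: K.stationary_Nil[OF c])
    from this[of "length w"] have "(\<Prod>i<length w. g (take i w) (w ! i)) = c w" by simp
    finally have em: "emeasure M {\<omega>. history \<omega> (length w) = w} = ennreal (c w)" .
    have "{\<omega>. history \<omega> (length w) = w} \<in> sets M"
    proof -
      have "(\<lambda>\<omega>. \<omega> h) \<in> measurable M (count_space UNIV)" for h
      proof -
        have "(\<lambda>\<omega>. \<omega> h) \<in> measurable M (measure_pmf (pm h))"
          unfolding M_def by (rule measurable_component_singleton) simp
        then show ?thesis by (simp cong: measurable_cong_sets)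
      qed
      then have "(\<lambda>\<omega>. \<omega> h) -` {a} \<inter> space M \<in> sets M" for h a by (rule measurable_sets) simp
      then have s: "{\<omega>. \<omega> h = a} \<in> sets M" for h a by (simp add: spM vimage_def)
      have "{\<omega>. history \<omega> (length w) = w} = (\<Inter>i\<in>{..<length w}. {\<omega>. \<omega> (take i w) = w ! i}) \<inter> space M"
        by (auto simp: history_eq_iff spM)
      also have "\<dots> \<in> sets M" using s by (cases "w = []") auto
      finally show ?thesis .
    qed
    then show ?thesis using em K.stationary_nonneg[OF c, of w] by (simp add: measure_def)
  qed
  have "path \<in> measurable M borel"
  proof (rule measurable_coordinatewise_then_product)
    fix n
    have "(\<lambda>\<omega>. path \<omega> n) \<in> measurable M (count_space UNIV)"
      unfolding measurable_count_space_eq2_countable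
    proof (intro conjI ballI)
      fix a :: nat
      have "(\<lambda>\<omega>. path \<omega> n) -` {a} \<inter> space M = (\<Union>h\<in>{h. length h = n}. {\<omega>. history \<omega> (length (h @ [a])) = h @ [a]})"
        by (auto simp: path_def spM)
      also have "\<dots> \<in> sets M" by (intro sets.countable_UN'' conjunct1[OF H]) auto
      finally show "(\<lambda>\<omega>. path \<omega> n) -` {a} \<inter> space M \<in> sets M" .
    qed simp
    then show "(\<lambda>\<omega>. path \<omega> n) \<in> borel_measurable M"
      using measurable_cong_sets[OF refl sets_borel_eq_count_space, of M] by blast
  qed
  note meas = this
  show ?thesis
  proof (intro exI[of _ "distr M borel path"] conjI allI)
    show "prob_space (distr M borel path)" by (rule M.prob_space_distr[OF meas])
    show "measure (distr M borel path) (cylinder UNIV w) = c w" for w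
      using H[of w]
      by (subst measure_distr[OF meas cylinder_UNIV_borel]) (simp add: cylinder_def vimage_def map_path spM)
  qed simp
qed


subsection \<open>Invariant measures of a subshift\<close>

locale sft =
  fixes d :: nat and A :: "nat \<Rightarrow> nat \<Rightarrow> nat" and X :: "(nat \<Rightarrow> nat) set"
  assumes X: "X = subshift d A"

sublocale sft \<subseteq> K: finite_alphabet "{..<d}"
  by unfold_locales simp

context sft
begin

abbreviation weights :: "(nat list \<Rightarrow> real) set" where
  "weights \<equiv> sft_weights {..<d} (\<lambda>a b. A a b = 1)"

lemma X_borel: "X \<in> sets borel"
proof -
  have meas: "(\<lambda>x :: nat \<Rightarrow> nat. x n) \<in> measurable borel (count_space UNIV)" for n
    using measurable_product_coordinates[of n] measurable_cong_sets[OF refl sets_borel_eq_count_space] by blast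
  have "X = (\<Inter>n. {x \<in> space borel. x n < d \<and> A (x n) (x (Suc n)) = 1})"
    by (auto simp: X subshift_def)
  also have "\<dots> \<in> sets borel"
    using meas by (intro sets.countable_INT') (auto intro!: sets.sets_Collect_conj)
  finally show ?thesis .
qed

lemma shift_in_X: "x \<in> X \<Longrightarrow> shift_map x \<in> X"
  by (auto simp: X subshift_def shift_map_def)

lemma letters_X: "x \<in> X \<Longrightarrow> x n < d"
  by (auto simp: X subshift_def)

lemma borel_prob_measuresD:
  assumes "\<mu> \<in> borel_prob_measures X"
  shows "prob_space \<mu>" "sets \<mu> = sets (restrict_space borel X)" "space \<mu> = X"
  using assms sets_eq_imp_space_eq[of \<mu> "restrict_space borel X"]
  by (auto simp: borel_prob_measures_def space_restrict_space)

lemma invariant_measuresD: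
  assumes "\<mu> \<in> invariant_measures X shift_map"
  shows "\<mu> \<in> borel_prob_measures X" "shift_map \<in> measurable \<mu> \<mu>" "distr \<mu> \<mu> shift_map = \<mu>"
  using assms by (auto simp: invariant_measures_def)

lemma shift_measurable:
  assumes "\<mu> \<in> borel_prob_measures X"
  shows "shift_map \<in> measurable \<mu> \<mu>"
proof -
  have "shift_map \<in> measurable borel borel"
    by (rule measurable_coordinatewise_then_product) (simp add: shift_map_def)
  then have "shift_map \<in> measurable (restrict_space borel X) (restrict_space borel X)"
    by (intro measurable_restrict_space3) (auto intro: shift_in_X)
  then show ?thesis
    using borel_prob_measuresD(2)[OF assms] by (simp cong: measurable_cong_sets)
qed

lemma cylinder_sets: "\<mu> \<in> borel_prob_measures X \<Longrightarrow> cylinder X w \<in> sets \<mu>"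
  using sets_restrict_cylinders[OF X_borel] borel_prob_measuresD(2)[of \<mu>] by (auto intro: sigma_sets.Basic)

lemma cylinder_snoc: "cylinder X w = (\<Union>a<d. cylinder X (w @ [a]))"
  using letters_X by (auto simp: cylinder_def)

lemma weight_snoc:
  assumes "\<mu> \<in> borel_prob_measures X"
  shows "(\<Sum>a<d. weight X \<mu> (w @ [a])) = weight X \<mu> w"
proof -
  interpret prob_space \<mu> using borel_prob_measuresD[OF assms] by simp
  show ?thesis
    unfolding weight_def cylinder_snoc[of w]
    using cylinder_sets[OF assms]
    by (intro finite_measure_finite_Union[symmetric] disjoint_cylinders_snoc) auto
qed

lemma shift_vimage_cylinder: "shift_map -` cylinder X w \<inter> X = (\<Union>a<d. cylinder X (a # w))"
proof -
  have "x \<in> shift_map -` cylinder X w \<inter> X \<longleftrightarrow> x \<in> (\<Union>a<d. cylinder X (a # w))" for x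
    using letters_X[of x 0] shift_in_X[of x]
    by (auto simp: cylinder_def map_upt_Cons_iff shift_map_def simp del: upt_Suc)
  then show ?thesis by blast
qed

lemma measure_shift_vimage_cylinder:
  assumes "\<mu> \<in> borel_prob_measures X"
  shows "measure \<mu> (shift_map -` cylinder X w \<inter> X) = (\<Sum>a<d. weight X \<mu> (a # w))"
proof -
  interpret prob_space \<mu> using borel_prob_measuresD[OF assms] by simp
  show ?thesis
    unfolding weight_def shift_vimage_cylinder
    using cylinder_sets[OF assms]
    by (intro finite_measure_finite_Union disjoint_cylinders_Cons) auto
qed

lemma cylinder_empty:
  assumes "\<not> set w \<subseteq> {..<d}" shows "cylinder X w = {}"
proof -
  have "set (map x [0..<length w]) \<subseteq> {..<d}" if "x \<in> X" for x using that letters_X by auto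
  then show ?thesis using assms by (fastforce simp: cylinder_def)
qed

lemma weight_mem:
  assumes "\<mu> \<in> invariant_measures X shift_map"
  shows "weight X \<mu> \<in> weights"
proof -
  note inv = invariant_measuresD[OF assms] and D = borel_prob_measuresD[OF invariant_measuresD(1)[OF assms]]
  interpret prob_space \<mu> by (rule D)
  have "(\<Sum>a<d. weight X \<mu> (a # w)) = weight X \<mu> w" for w
    using measure_distr[OF inv(2) cylinder_sets[OF inv(1), of w]]
    by (simp add: inv(3) D(3) measure_shift_vimage_cylinder[OF inv(1)] weight_def)
  moreover have "weight X \<mu> [] = 1" using prob_space by (simp add: weight_def D(3))
  moreover have "A a b = 1" if "weight X \<mu> [a, b] \<noteq> 0" for a b
  proof -
    have "cylinder X [a, b] \<noteq> {}" using that by (auto simp: weight_def)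
    then obtain x where "x \<in> X" "x 0 = a" "x (Suc 0) = b" by (auto simp: cylinder_def)
    then show ?thesis by (auto simp: X subshift_def)
  qed
  ultimately show ?thesis
    unfolding sft_weights_def stationary_def
    using weight_snoc[OF inv(1)] cylinder_empty by (auto simp: weight_def)
qed

text \<open>The preimage of a cylinder is the disjoint union of the cylinders with one more letter
  in front, and measures are determined by their weights.\<close>

lemma invariantI:
  assumes \<mu>: "\<mu> \<in> borel_prob_measures X" and st: "\<And>w. (\<Sum>a<d. weight X \<mu> (a # w)) = weight X \<mu> w"
  shows "\<mu> \<in> invariant_measures X shift_map"
proof -
  note D = borel_prob_measuresD[OF \<mu>] and meas = shift_measurable[OF \<mu>]
  interpret prob_space \<mu> by (rule D)
  have "distr \<mu> \<mu> shift_map = \<mu>"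
  proof (rule borel_prob_measure_eqI[OF X_borel _ \<mu>])
    show "distr \<mu> \<mu> shift_map \<in> borel_prob_measures X"
      using prob_space_distr[OF meas] D by (simp add: borel_prob_measures_def)
    show "weight X (distr \<mu> \<mu> shift_map) w = weight X \<mu> w" for w
      using measure_distr[OF meas cylinder_sets[OF \<mu>, of w]] st[of w]
      by (simp add: D(3) measure_shift_vimage_cylinder[OF \<mu>] weight_def)
  qed
  then show ?thesis using \<mu> meas by (simp add: invariant_measures_def)
qed

text \<open>The measure is first built on all sequences. A sequence outside \<open>X\<close> has a
  prefix ending in a forbidden letter or transition, which has weight 0; countably many such null
  cylinders cover the complement, so restricting to \<open>X\<close> loses nothing.\<close>

lemma ex_invariant_measure:
  assumes c: "c \<in> weights"
  shows "\<exists>\<mu>\<in>invariant_measures X shift_map. weight X \<mu> = c"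
proof -
  have st: "stationary {..<d} c" using c by (simp add: sft_weights_def)
  obtain \<nu> where \<nu>: "prob_space \<nu>" "sets \<nu> = sets borel" "\<And>w. measure \<nu> (cylinder UNIV w) = c w"
    using ex_measure_with_weights[OF st] by blast
  interpret \<nu>: prob_space \<nu> by (rule \<nu>)
  have sp: "space \<nu> = UNIV" using sets_eq_imp_space_eq[OF \<nu>(2)] by simp
  have "UNIV - X \<subseteq> (\<Union>w\<in>{w. c w = 0}. cylinder UNIV w)"
  proof
    fix x assume "x \<in> UNIV - X"
    then obtain n where n: "\<not> (x n < d \<and> A (x n) (x (Suc n)) = 1)" by (auto simp: X subshift_def)
    have "c (map x [0..<n] @ [x n, x (Suc n)]) = 0"
    proof (cases "x n < d")
      case False
      then show ?thesis by (intro K.stationary_outside[OF st]) auto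
    next
      case True
      then have "c [x n, x (Suc n)] = 0" using n c by (auto simp: sft_weights_def)
      then show ?thesis
        using K.stationary_prepend_le[OF st, of "map x [0..<n]" "[x n, x (Suc n)]"]
          K.stationary_nonneg[OF st, of "map x [0..<n] @ [x n, x (Suc n)]"] by simp
    qed
    then show "x \<in> (\<Union>w\<in>{w. c w = 0}. cylinder UNIV w)"
      by (intro UN_I[of "map x [0..<n] @ [x n, x (Suc n)]"]) (auto simp: cylinder_def)
  qed
  moreover have "(\<Union>w\<in>{w. c w = 0}. cylinder UNIV w) \<in> null_sets \<nu>"
    using \<nu> cylinder_UNIV_borel
    by (intro null_sets_UN') (auto simp: \<nu>.emeasure_eq_measure null_sets_def)
  ultimately have ae: "AE x in \<nu>. x \<in> X" by (intro AE_I'[of _ \<nu>]) (auto simp: sp)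
  have X\<nu>: "X \<in> sets \<nu>" using X_borel \<nu>(2) by simp
  have "emeasure \<nu> X = 1" using ae \<nu>.emeasure_eq_1_AE X\<nu> by blast
  define \<mu> where "\<mu> = restrict_space \<nu> X"
  have \<mu>: "\<mu> \<in> borel_prob_measures X"
    using prob_space_restrict_space[OF X\<nu> \<open>emeasure \<nu> X = 1\<close>] sets_restrict_space_cong[OF \<nu>(2)]
    by (simp add: \<mu>_def borel_prob_measures_def)
  have "weight X \<mu> w = c w" for w
  proof -
    have "weight X \<mu> w = measure \<nu> (X \<inter> cylinder UNIV w)"
      unfolding weight_def \<mu>_def cylinder_restrict[of X] using X\<nu> by (intro measure_restrict_space) (auto simp: sp)
    also have "\<dots> = measure \<nu> (cylinder UNIV w)"
      using ae X\<nu> cylinder_UNIV_borel[of w] \<nu>(2) by (intro measure_eq_AE) auto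
    finally show ?thesis using \<nu>(3) by simp
  qed
  then have w: "weight X \<mu> = c" by auto
  then have "\<mu> \<in> invariant_measures X shift_map"
    using K.stationary_Cons[OF st] by (intro invariantI[OF \<mu>]) simp
  then show ?thesis using w by blast
qed

lemma weight_inj:
  assumes "\<mu> \<in> borel_prob_measures X" "\<nu> \<in> borel_prob_measures X" "weight X \<mu> = weight X \<nu>"
  shows "\<mu> = \<nu>"
  using borel_prob_measure_eqI[OF X_borel assms(1,2)] assms(3) by simp

text \<open>\<open>\<phi>\<close> is a finite combination of indicators of cylinders. On an empty
  cylinder the point chosen by \<open>SOME\<close> is arbitrary, but indicator and weight
  vanish.\<close>

lemma integral_LC:
  assumes \<mu>: "\<mu> \<in> borel_prob_measures X" and \<phi>: "\<phi> \<in> LC_k k X"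
  shows "(\<integral>x. \<phi> x \<partial>\<mu>) = (\<Sum>w\<in>words {..<d} k. \<phi> (SOME x. x \<in> cylinder X w) * weight X \<mu> w)"
proof -
  note D = borel_prob_measuresD[OF \<mu>]
  interpret prob_space \<mu> by (rule D)
  have eq: "\<phi> x = (\<Sum>w\<in>words {..<d} k. \<phi> (SOME x. x \<in> cylinder X w) * indicator (cylinder X w) x)"
    if x: "x \<in> X" for x
  proof -
    let ?w = "map x [0..<k]"
    have w: "?w \<in> words {..<d} k" using letters_X[OF x] by (auto simp: words_def)
    have xw: "x \<in> cylinder X ?w" using x by (simp add: cylinder_def)
    then have "(SOME x. x \<in> cylinder X ?w) \<in> cylinder X ?w"
      using someI[of "\<lambda>x. x \<in> cylinder X ?w" x] by blast
    then have "(SOME x. x \<in> cylinder X ?w) \<in> X" "\<forall>i<k. (SOME x. x \<in> cylinder X ?w) i = x i"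
      unfolding cylinder_def map_upt_eq_iff by auto
    then have \<phi>w: "\<phi> (SOME x. x \<in> cylinder X ?w) = \<phi> x"
      using \<phi> x unfolding LC_k_def by blast
    have "indicator (cylinder X w) x = (of_bool (w = ?w) :: real)" if "w \<in> words {..<d} k" for w
      using x that by (auto simp: cylinder_def words_def indicator_def)
    then have "(\<Sum>w\<in>words {..<d} k. \<phi> (SOME x. x \<in> cylinder X w) * indicator (cylinder X w) x)
        = (\<Sum>w\<in>words {..<d} k. \<phi> (SOME x. x \<in> cylinder X w) * of_bool (w = ?w))"
      by (intro sum.cong refl) simp
    also have "\<dots> = \<phi> (SOME x. x \<in> cylinder X ?w)"
      using w by (subst sum.remove[of _ ?w]) (auto intro!: sum.neutral)
    finally show ?thesis using \<phi>w by simp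
  qed
  have "(\<integral>x. \<phi> x \<partial>\<mu>) = (\<integral>x. (\<Sum>w\<in>words {..<d} k. \<phi> (SOME x. x \<in> cylinder X w) * indicator (cylinder X w) x) \<partial>\<mu>)"
    using eq D(3) by (intro Bochner_Integration.integral_cong) auto
  also have "\<dots> = (\<Sum>w\<in>words {..<d} k. \<phi> (SOME x. x \<in> cylinder X w) * weight X \<mu> w)"
    using cylinder_sets[OF \<mu>] by (subst Bochner_Integration.integral_sum) (auto simp: weight_def less_top[symmetric])
  finally show ?thesis .
qed

lemma continuous_on_indicator_cylinder: "continuous_on X (indicator (cylinder X w) :: _ \<Rightarrow> real)"
proof -
  have "continuous_on X (\<lambda>x. \<Prod>i<length w. of_bool (x i = w ! i) :: real)"
  proof (intro continuous_on_prod)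
    fix i
    have "continuous_on X (\<lambda>x :: nat \<Rightarrow> nat. x i)"
      by (rule continuous_on_subset[OF continuous_on_product_coordinates]) simp
    then have "continuous_on X ((\<lambda>a. of_bool (a = w ! i) :: real) \<circ> (\<lambda>x. x i))"
      by (rule continuous_on_compose) simp
    then show "continuous_on X (\<lambda>x. of_bool (x i = w ! i) :: real)" by (simp add: o_def)
  qed
  moreover have "indicator (cylinder X w) x = (\<Prod>i<length w. of_bool (x i = w ! i) :: real)" if "x \<in> X" for x
    using that by (auto simp: cylinder_def map_upt_eq_iff indicator_def prod_zero_iff)
  ultimately show ?thesis by (subst continuous_on_cong[OF refl]) auto
qed

text \<open>Indicators of cylinders are continuous and hence admissible test functions. The premise
  on \<open>m\<close> is only eventual because equilibrium states are given for
  \<open>t \<ge> 0\<close>.\<close>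

lemma weak_star_limit_weight:
  assumes lim: "weak_star_limit X m \<nu> F" and m: "\<forall>\<^sub>F t in F. m t \<in> borel_prob_measures X"
  shows "((\<lambda>t. weight X (m t) w) \<longlongrightarrow> weight X \<nu> w) F"
proof -
  have int: "(\<integral>x. indicator (cylinder X w) x \<partial>\<mu>) = weight X \<mu> w" if \<mu>: "\<mu> \<in> borel_prob_measures X" for \<mu>
  proof -
    interpret prob_space \<mu> using borel_prob_measuresD[OF \<mu>] by simp
    show ?thesis using cylinder_sets[OF \<mu>] by (simp add: weight_def)
  qed
  have \<nu>: "\<nu> \<in> borel_prob_measures X" using lim by (simp add: weak_star_limit_def)
  have "((\<lambda>t. \<integral>x. indicator (cylinder X w) x \<partial>m t) \<longlongrightarrow> weight X \<nu> w) F"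
    using lim continuous_on_indicator_cylinder unfolding weak_star_limit_def int[OF \<nu>, symmetric] by blast
  moreover have "\<forall>\<^sub>F t in F. (\<integral>x. indicator (cylinder X w) x \<partial>m t) = weight X (m t) w"
    using m by eventually_elim (rule int)
  ultimately show ?thesis by (rule Lim_transform_eventually)
qed

text \<open>The two conditional measures of an invariant set exhibit the weight as a proper mixture.\<close>
lemma ergodicI:
  assumes \<mu>: "\<mu> \<in> invariant_measures X shift_map"
    and ext: "\<And>c1 c2 a. c1 \<in> weights \<Longrightarrow> c2 \<in> weights \<Longrightarrow> 0 < a \<Longrightarrow> a < 1 \<Longrightarrow>
      weight X \<mu> = mix a c1 c2 \<Longrightarrow> c1 = weight X \<mu>"
  shows "\<mu> \<in> ergodic_measures X shift_map"
  unfolding ergodic_measures_def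
proof (intro CollectI conjI ballI impI \<mu>)
  note inv = invariant_measuresD[OF \<mu>] and D = borel_prob_measuresD[OF invariant_measuresD(1)[OF \<mu>]]
  interpret prob_space \<mu> by (rule D)
  fix B assume B: "B \<in> sets \<mu>" "shift_map -` B \<inter> space \<mu> = B"
  define a where "a = measure \<mu> B"
  have a01: "0 \<le> a" "a \<le> 1" by (auto simp: a_def)
  have BX: "B \<subseteq> X" using sets.sets_into_space[OF B(1)] D(3) by simp
  have cond: "uniform_measure \<mu> C \<in> invariant_measures X shift_map"
    "measure (uniform_measure \<mu> C) S = measure \<mu> (C \<inter> S) / measure \<mu> C"
    if C: "C \<in> sets \<mu>" "shift_map -` C \<inter> X = C" "measure \<mu> C > 0" and S: "S \<in> sets \<mu>" for C S
  proof -
    have em: "emeasure \<mu> C \<noteq> 0" using C(3) by (auto simp: measure_def)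
    have meas: "measure (uniform_measure \<mu> C) S = measure \<mu> (C \<inter> S) / measure \<mu> C" if "S \<in> sets \<mu>" for S
      using em that by (intro measure_uniform_measure) auto
    then show "measure (uniform_measure \<mu> C) S = measure \<mu> (C \<inter> S) / measure \<mu> C" using S by blast
    have prob: "uniform_measure \<mu> C \<in> borel_prob_measures X"
      using prob_space_uniform_measure[OF em] D by (simp add: borel_prob_measures_def)
    show "uniform_measure \<mu> C \<in> invariant_measures X shift_map"
    proof (rule invariantI[OF prob])
      fix w
      have "(\<Sum>a<d. weight X (uniform_measure \<mu> C) (a # w)) = measure (uniform_measure \<mu> C) (shift_map -` cylinder X w \<inter> X)"
        by (rule measure_shift_vimage_cylinder[OF prob, symmetric])
      \<comment> \<open>\<open>C\<close> is its own preimage, so intersecting with \<open>C\<close>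
        commutes with taking preimages, and invariance of \<open>\<mu>\<close> applies to
        \<open>C \<inter> cylinder X w\<close>.\<close>
      also have "\<dots> = measure \<mu> (shift_map -` (C \<inter> cylinder X w) \<inter> X) / measure \<mu> C"
        using C(2) measurable_sets[OF inv(2) cylinder_sets[OF inv(1), of w]]
        by (subst meas) (auto simp: D(3) intro!: arg_cong2[of _ _ _ _ "(/)"] arg_cong[of _ _ "measure \<mu>"])
      also have "measure \<mu> (shift_map -` (C \<inter> cylinder X w) \<inter> X) = measure \<mu> (C \<inter> cylinder X w)"
        using measure_distr[OF inv(2), of "C \<inter> cylinder X w"] C(1) cylinder_sets[OF inv(1), of w]
        by (simp add: inv(3) D(3) sets.Int)
      finally show "(\<Sum>a<d. weight X (uniform_measure \<mu> C) (a # w)) = weight X (uniform_measure \<mu> C) w"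
        by (simp add: weight_def meas[OF cylinder_sets[OF inv(1)]])
    qed
  qed
  have B': "X - B \<in> sets \<mu>" "shift_map -` (X - B) \<inter> X = X - B"
    using B sets.compl_sets[OF B(1)] shift_in_X D(3) by (simp_all, blast)
  have mB': "measure \<mu> (X - B) = 1 - a" using prob_compl[OF B(1)] by (simp add: a_def D(3))
  show "measure \<mu> B = 0 \<or> measure \<mu> B = 1"
  proof (rule ccontr)
    assume "\<not> (measure \<mu> B = 0 \<or> measure \<mu> B = 1)"
    then have a: "0 < a" "a < 1" using a01 by (auto simp: a_def order.strict_iff_order)
    let ?\<beta> = "uniform_measure \<mu> B" and ?\<gamma> = "uniform_measure \<mu> (X - B)"
    have pos: "measure \<mu> B > 0" "measure \<mu> (X - B) > 0" using a mB' by (auto simp: a_def)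
    note \<beta> = cond[OF B(1) B(2)[unfolded D(3)] pos(1)] and \<gamma> = cond[OF B' pos(2)]
    have "weight X \<mu> w = mix a (weight X ?\<beta>) (weight X ?\<gamma>) w" for w
    proof -
      have c: "cylinder X w \<in> sets \<mu>" by (rule cylinder_sets[OF inv(1)])
      have "cylinder X w = (B \<inter> cylinder X w) \<union> ((X - B) \<inter> cylinder X w)" by (auto simp: cylinder_def)
      then have "measure \<mu> (cylinder X w) = measure \<mu> (B \<inter> cylinder X w) + measure \<mu> ((X - B) \<inter> cylinder X w)"
        using finite_measure_Union[of "B \<inter> cylinder X w" "(X - B) \<inter> cylinder X w"] c B(1) B'(1)
        by (metis Diff_disjoint Int_assoc inf_bot_left inf_left_commute sets.Int)
      then show ?thesis using a by (simp add: mix_def weight_def \<beta>(2)[OF c] \<gamma>(2)[OF c] mB' flip: a_def)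
    qed
    then have "weight X ?\<beta> = weight X \<mu>"
      using a by (intro ext[OF weight_mem[OF \<beta>(1)[OF sets.top]] weight_mem[OF \<gamma>(1)[OF sets.top]] a] HOL.ext)
    then have "?\<beta> = \<mu>"
      using weight_inj[OF invariant_measuresD(1)[OF \<beta>(1)[OF sets.top]] inv(1)] by simp
    then have "measure \<mu> (X - B) = 0" using \<beta>(2)[OF B'(1)] by (simp add: Int_Diff) 
    then show False using pos(2) by simp
  qed
qed

end

section \<open>Entropy of finite-valued random variables\<close>

context prob_space
begin

text \<open>Variables stand in for partitions: a common refinement becomes a tuple or a list, and a
  coarser partition a composition.\<close>

definition ent :: "('a \<Rightarrow> 'b) \<Rightarrow> real" where
  "ent Z = (\<Sum>z\<in>Z ` space M. eta (prob (Z -` {z} \<inter> space M)))"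

definition cond_ent :: "('a \<Rightarrow> 'b) \<Rightarrow> ('a \<Rightarrow> 'c) \<Rightarrow> real" where
  "cond_ent X Y = ent (\<lambda>x. (X x, Y x)) - ent Y"

lemma ent_cong: "(\<And>x. x \<in> space M \<Longrightarrow> Y x = Z x) \<Longrightarrow> ent Y = ent Z"
  unfolding ent_def by (intro sum.cong image_cong arg_cong[of _ _ eta] arg_cong[of _ _ prob]) auto

lemma ent_superset:
  assumes "finite S" "Z ` space M \<subseteq> S"
  shows "ent Z = (\<Sum>z\<in>S. eta (prob (Z -` {z} \<inter> space M)))"
proof -
  have "Z -` {z} \<inter> space M = {}" if "z \<notin> Z ` space M" for z using that by auto
  then show ?thesis unfolding ent_def using assms
    by (intro sum.mono_neutral_left) (auto simp del: vimage_eq)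
qed

lemma ent_eq_entropy:
  assumes "simple_function M Z"
  shows "ent Z = information_space.entropy_Pow M (exp 1) Z"
proof -
  interpret information_space M "exp 1" by unfold_locales simp
  show ?thesis
    by (subst entropy_simple_distributed[OF simple_distributedI[OF assms measure_nonneg refl]])
      (simp add: ent_def eta_def log_def sum_negf)
qed

lemma ent_comp_le: "simple_function M Z \<Longrightarrow> ent (\<lambda>x. f (Z x)) \<le> ent Z"
proof -
  interpret information_space M "exp 1" by unfold_locales simp
  assume Z: "simple_function M Z"
  then show ?thesis
    using entropy_data_processing[OF Z, of f] ent_eq_entropy[OF Z]
      ent_eq_entropy[OF simple_function_compose[OF Z, of f]] by (simp add: o_def)
qed

lemma ent_eqI:
  assumes "simple_function M Y" "simple_function M Z"
    and "\<And>x. x \<in> space M \<Longrightarrow> Y x = f (Z x)" "\<And>x. x \<in> space M \<Longrightarrow> Z x = g (Y x)"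
  shows "ent Y = ent Z"
proof (rule antisym)
  have "ent Y = ent (\<lambda>x. f (Z x))" by (rule ent_cong) (rule assms(3))
  then show "ent Y \<le> ent Z" using ent_comp_le[OF assms(2), of f] by (rule ord_eq_le_trans)
  have "ent Z = ent (\<lambda>x. g (Y x))" by (rule ent_cong) (rule assms(4))
  then show "ent Z \<le> ent Y" using ent_comp_le[OF assms(1), of g] by (rule ord_eq_le_trans)
qed

lemma expectation_simple:
  fixes g :: "'b \<Rightarrow> real"
  assumes Z: "simple_function M Z"
  shows "(\<integral>x. g (Z x) \<partial>M) = (\<Sum>z\<in>Z ` space M. prob (Z -` {z} \<inter> space M) * g z)"
proof -
  have fin: "finite (Z ` space M)" and ev: "z \<in> Z ` space M \<Longrightarrow> Z -` {z} \<inter> space M \<in> events" for z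
    using Z by (auto simp: simple_function_def)
  have "(\<integral>x. g (Z x) \<partial>M) = (\<integral>x. (\<Sum>z\<in>Z ` space M. g z * indicator (Z -` {z} \<inter> space M) x) \<partial>M)"
  proof (intro Bochner_Integration.integral_cong refl)
    fix x assume "x \<in> space M"
    then show "g (Z x) = (\<Sum>z\<in>Z ` space M. g z * indicator (Z -` {z} \<inter> space M) x)"
      using fin by (subst sum.remove[of _ "Z x"]) (auto intro!: sum.neutral simp: indicator_def)
  qed
  also have "\<dots> = (\<Sum>z\<in>Z ` space M. g z * prob (Z -` {z} \<inter> space M))"
    using ev by (subst Bochner_Integration.integral_sum) (auto simp: less_top[symmetric])
  finally show ?thesis by (simp add: mult.commute)
qed

lemma ent_eq_expectation:
  assumes "simple_function M Z"
  shows "ent Z = - (\<integral>x. ln (prob (Z -` {Z x} \<inter> space M)) \<partial>M)"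
  using expectation_simple[OF assms, of "\<lambda>z. ln (prob (Z -` {z} \<inter> space M))"]
  by (simp add: ent_def eta_def sum_negf)

text \<open>Nonnegativity of the conditional mutual information of \<open>X\<close> and
  \<open>Y\<close> given \<open>Z\<close>. Its logarithm splits into four because the marginal
  probabilities dominate the joint one, so none is 0 where the joint one is positive.\<close>

lemma strong_subadditivity:
  assumes X: "simple_function M X" and Y: "simple_function M Y" and Z: "simple_function M Z"
  shows "ent (\<lambda>x. (X x, Y x, Z x)) + ent Z \<le> ent (\<lambda>x. (X x, Z x)) + ent (\<lambda>x. (Y x, Z x))"
proof -
  interpret information_space M "exp 1" by unfold_locales simp
  define T where "T = (\<lambda>x. (X x, Y x, Z x))"
  have XZ: "simple_function M (\<lambda>x. (X x, Z x))" and YZ: "simple_function M (\<lambda>x. (Y x, Z x))"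
    and T: "simple_function M T"
    using X Y Z unfolding T_def by (auto intro: simple_function_Pair)
  have T': "simple_function M (\<lambda>x. (X x, Y x, Z x))" using T by (simp add: T_def)
  define P where "P t = prob (T -` {t} \<inter> space M)" for t
  define Pxz where "Pxz t = prob ((\<lambda>x. (X x, Z x)) -` {t} \<inter> space M)" for t
  define Pyz where "Pyz t = prob ((\<lambda>x. (Y x, Z x)) -` {t} \<inter> space M)" for t
  define Pz where "Pz t = prob (Z -` {t} \<inter> space M)" for t
  note sd = simple_distributedI[OF _ measure_nonneg refl]
  let ?R = "T ` space M"
  have "0 \<le> conditional_mutual_information (exp 1) (count_space (X ` space M)) (count_space (Y ` space M))
      (count_space (Z ` space M)) X Y Z" by (rule conditional_mutual_information_nonneg[OF X Y Z])
  also have "\<dots> = (\<Sum>(x, y, z)\<in>?R. P (x, y, z) * log (exp 1) (P (x, y, z) / (Pxz (x, z) * (Pyz (y, z) / Pz z))))"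
    unfolding P_def Pxz_def Pyz_def Pz_def T_def
    by (rule conditional_mutual_information_eq[OF sd[OF Z] sd[OF YZ] sd[OF XZ] sd[OF T']])
  also have "\<dots> = (\<Sum>(x, y, z)\<in>?R. P (x, y, z) * ln (P (x, y, z)) - P (x, y, z) * ln (Pxz (x, z))
      - P (x, y, z) * ln (Pyz (y, z)) + P (x, y, z) * ln (Pz z))"
  proof (intro sum.cong refl, safe)
    fix x y z
    have ev: "(\<lambda>x. (X x, Z x)) -` {(x, z)} \<inter> space M \<in> events" "(\<lambda>x. (Y x, Z x)) -` {(y, z)} \<inter> space M \<in> events"
      "Z -` {z} \<inter> space M \<in> events"
      by (rule simple_functionD(2), fact)+
    have "P (x, y, z) \<le> Pxz (x, z)" "P (x, y, z) \<le> Pyz (y, z)" "P (x, y, z) \<le> Pz z"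
      unfolding P_def Pxz_def Pyz_def Pz_def using ev by (auto intro!: finite_measure_mono simp: T_def)
    moreover have "0 \<le> P (x, y, z)" by (simp add: P_def)
    ultimately show "P (x, y, z) * log (exp 1) (P (x, y, z) / (Pxz (x, z) * (Pyz (y, z) / Pz z))) =
        P (x, y, z) * ln (P (x, y, z)) - P (x, y, z) * ln (Pxz (x, z))
        - P (x, y, z) * ln (Pyz (y, z)) + P (x, y, z) * ln (Pz z)"
      by (cases "P (x, y, z) = 0") (auto simp: log_def ln_div ln_mult algebra_simps)
  qed
  also have "\<dots> = (\<Sum>t\<in>?R. P t * ln (P t)) - (\<Sum>t\<in>?R. P t * ln (Pxz (fst t, snd (snd t))))
      - (\<Sum>t\<in>?R. P t * ln (Pyz (snd t))) + (\<Sum>t\<in>?R. P t * ln (Pz (snd (snd t))))"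
    by (simp add: sum.distrib sum_subtractf case_prod_unfold)
  also have "(\<Sum>t\<in>?R. P t * ln (Pxz (fst t, snd (snd t)))) = - ent (\<lambda>x. (X x, Z x))"
    unfolding P_def Pxz_def ent_eq_expectation[OF XZ] expectation_simple[OF T, symmetric] by (simp add: T_def)
  also have "(\<Sum>t\<in>?R. P t * ln (Pyz (snd t))) = - ent (\<lambda>x. (Y x, Z x))"
    unfolding P_def Pyz_def ent_eq_expectation[OF YZ] expectation_simple[OF T, symmetric] by (simp add: T_def)
  also have "(\<Sum>t\<in>?R. P t * ln (Pz (snd (snd t)))) = - ent Z"
    unfolding P_def Pz_def ent_eq_expectation[OF Z] expectation_simple[OF T, symmetric] by (simp add: T_def)
  also have "(\<Sum>t\<in>?R. P t * ln (P t)) = - ent T"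
    unfolding P_def ent_eq_expectation[OF T] expectation_simple[OF T, symmetric] by simp
  finally show ?thesis by (simp add: T_def)
qed

lemma ent_const: "ent (\<lambda>_. k) = 0"
  using not_empty by (simp add: ent_def image_constant_conv prob_space vimage_def)

lemma ent_Pair_le:
  assumes X: "simple_function M X" and Y: "simple_function M Y"
  shows "ent (\<lambda>x. (X x, Y x)) \<le> ent X + ent Y"
proof -
  have u: "simple_function M (\<lambda>_. ())" by simp
  have "ent (\<lambda>x. (X x, Y x, ())) = ent (\<lambda>x. (X x, Y x))"
    by (rule ent_eqI[where f = "\<lambda>(a, b). (a, b, ())" and g = "\<lambda>(a, b, _). (a, b)"])
      (auto intro!: simple_function_Pair assms)
  moreover have "ent (\<lambda>x. (X x, ())) = ent X"
    by (rule ent_eqI[where f = "\<lambda>a. (a, ())" and g = fst]) (auto intro!: simple_function_Pair assms)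
  moreover have "ent (\<lambda>x. (Y x, ())) = ent Y"
    by (rule ent_eqI[where f = "\<lambda>a. (a, ())" and g = fst]) (auto intro!: simple_function_Pair assms)
  ultimately show ?thesis using strong_subadditivity[OF X Y u] ent_const[of "()"] by simp
qed

lemma cond_ent_Pair_le:
  assumes "simple_function M X" "simple_function M X'" "simple_function M Y"
  shows "cond_ent (\<lambda>x. (X x, X' x)) Y \<le> cond_ent X Y + cond_ent X' Y"
proof -
  have "ent (\<lambda>x. ((X x, X' x), Y x)) = ent (\<lambda>x. (X x, X' x, Y x))"
    by (rule ent_eqI[where f = "\<lambda>(a, b, c). ((a, b), c)" and g = "\<lambda>((a, b), c). (a, b, c)"])
      (auto intro!: simple_function_Pair assms)
  then show ?thesis using strong_subadditivity[OF assms] by (simp add: cond_ent_def)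
qed

text \<open>Strong subadditivity with \<open>g (Y x)\<close> as the conditioning variable, since
  adjoining it to \<open>Y\<close> leaves entropies unchanged.\<close>

lemma cond_ent_antimono:
  assumes X: "simple_function M X" and Y: "simple_function M Y"
  shows "cond_ent X Y \<le> cond_ent X (\<lambda>x. g (Y x))"
proof -
  have gY: "simple_function M (\<lambda>x. g (Y x))" using simple_function_compose[OF Y, of g] by (simp add: o_def)
  have "ent (\<lambda>x. (X x, Y x, g (Y x))) = ent (\<lambda>x. (X x, Y x))"
    by (rule ent_eqI[where f = "\<lambda>(a, b). (a, b, g b)" and g = "\<lambda>(a, b, _). (a, b)"])
      (auto intro!: simple_function_Pair assms gY)
  moreover have "ent (\<lambda>x. (Y x, g (Y x))) = ent Y"
    by (rule ent_eqI[where f = "\<lambda>b. (b, g b)" and g = fst]) (auto intro!: simple_function_Pair assms gY)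
  ultimately show ?thesis using strong_subadditivity[OF X Y gY] by (simp add: cond_ent_def)
qed

lemma cond_ent_comp_le:
  assumes "simple_function M X" "simple_function M Y"
  shows "cond_ent (\<lambda>x. f (X x)) Y \<le> cond_ent X Y"
  using ent_comp_le[OF simple_function_Pair[OF assms], of "\<lambda>(a, b). (f a, b)"] by (simp add: cond_ent_def)

lemma ent_le_cond_ent:
  assumes "simple_function M X" "simple_function M Y"
  shows "ent X \<le> ent Y + cond_ent X Y"
  using ent_comp_le[OF simple_function_Pair[OF assms], of fst] by (simp add: cond_ent_def)

lemma cond_ent_cong:
  "(\<And>x. x \<in> space M \<Longrightarrow> X x = X' x) \<Longrightarrow> (\<And>x. x \<in> space M \<Longrightarrow> Y x = Y' x) \<Longrightarrow> cond_ent X Y = cond_ent X' Y'"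
  unfolding cond_ent_def by (intro arg_cong2[of _ _ _ _ "(-)"] ent_cong) auto

lemma simple_function_map:
  assumes "\<And>i. i < n \<Longrightarrow> simple_function M (Z i)"
  shows "simple_function M (\<lambda>x. map (\<lambda>i. Z i x) [0..<n])"
  using assms
proof (induction n)
  case (Suc n)
  then show ?case
    using simple_function_compose[OF simple_function_Pair[OF Suc.IH Suc.prems[of n]], of "\<lambda>(l, z). l @ [z]"]
    by (simp add: o_def)
qed simp

lemma cond_ent_map_le:
  fixes Z :: "nat \<Rightarrow> 'a \<Rightarrow> 'd"
  assumes Z: "\<And>i. i < n \<Longrightarrow> simple_function M (Z i)" and Y: "simple_function M Y"
  shows "cond_ent (\<lambda>x. map (\<lambda>i. Z i x) [0..<n]) Y \<le> (\<Sum>i<n. cond_ent (Z i) Y)"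
  using Z
proof (induction n)
  case 0
  have "ent (\<lambda>x. ([] :: 'd list, Y x)) = ent Y"
    by (rule ent_eqI[where f = "Pair []" and g = snd]) (auto intro!: simple_function_Pair Y)
  then show ?case by (simp add: cond_ent_def)
next
  case (Suc n)
  let ?m = "\<lambda>x. map (\<lambda>i. Z i x) [0..<n]"
  have m: "simple_function M ?m" and Zn: "simple_function M (Z n)"
    using Suc.prems by (auto intro: simple_function_map)
  have "cond_ent (\<lambda>x. ?m x @ [Z n x]) Y \<le> cond_ent (\<lambda>x. (?m x, Z n x)) Y"
    using cond_ent_comp_le[OF simple_function_Pair[OF m Zn] Y, of "\<lambda>(l, z). l @ [z]"] by simp
  also have "\<dots> \<le> cond_ent ?m Y + cond_ent (Z n) Y" by (rule cond_ent_Pair_le[OF m Zn Y])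
  also have "\<dots> \<le> (\<Sum>i<Suc n. cond_ent (Z i) Y)" using Suc by simp
  finally show ?case by simp
qed

section \<open>Entropy of indicators of events\<close>

lemma vimage_bool:
  assumes "B \<in> events"
  shows "(\<lambda>x. x \<in> B) -` {True} \<inter> space M = B" "(\<lambda>x. x \<in> B) -` {False} \<inter> space M = space M - B"
  using sets.sets_into_space[OF assms] by auto

lemma simple_function_bool:
  assumes "B \<in> events"
  shows "simple_function M (\<lambda>x. x \<in> B)"
  unfolding simple_function_def
proof (intro conjI ballI)
  show "finite ((\<lambda>x. x \<in> B) ` space M)" by (rule finite_subset[of _ UNIV]) auto
  show "(\<lambda>x. x \<in> B) -` {b} \<inter> space M \<in> events" for b
    using vimage_bool[OF assms] assms by (cases b) (simp_all only: sets.compl_sets)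
qed

text \<open>With p = \<open>prob B\<close>, the tangent of \<open>eta\<close> at 1 bounds
  \<open>eta (1 - p)\<close> by p, and \<open>eta_le_sqrt\<close> bounds
  \<open>eta p\<close>.\<close>

lemma ent_bool_le:
  assumes "B \<in> events"
  shows "ent (\<lambda>x. x \<in> B) \<le> prob B + 2 * sqrt (prob B)"
proof -
  have "ent (\<lambda>x. x \<in> B) = (\<Sum>z\<in>{True, False}. eta (prob ((\<lambda>x. x \<in> B) -` {z} \<inter> space M)))"
    by (rule ent_superset) auto
  also have "\<dots> = eta (prob ((\<lambda>x. x \<in> B) -` {True} \<inter> space M)) + eta (prob ((\<lambda>x. x \<in> B) -` {False} \<inter> space M))"
    by (subst sum.insert) simp_all
  finally have "ent (\<lambda>x. x \<in> B) = eta (prob B) + eta (1 - prob B)"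
    unfolding vimage_bool[OF assms] prob_compl[OF assms] .
  moreover have "eta (1 - prob B) \<le> prob B" using eta_tangent[of "1 - prob B" 1] by simp
  ultimately show ?thesis using eta_le_sqrt[OF measure_nonneg[of M B]] by linarith
qed

text \<open>Replace the pair of indicators of \<open>B\<close> and \<open>D\<close> by those of \<open>B \<Delta> D\<close> and \<open>D\<close>.\<close>
lemma cond_ent_bool_le:
  assumes B: "B \<in> events" and Y: "simple_function M Y" and E: "{x \<in> space M. (x \<in> B) \<noteq> h (Y x)} \<in> events"
  shows "cond_ent (\<lambda>x. x \<in> B) Y \<le> prob {x \<in> space M. (x \<in> B) \<noteq> h (Y x)} + 2 * sqrt (prob {x \<in> space M. (x \<in> B) \<noteq> h (Y x)})"
proof -
  let ?E = "{x \<in> space M. (x \<in> B) \<noteq> h (Y x)}"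
  have hY: "simple_function M (\<lambda>x. h (Y x))" using simple_function_compose[OF Y, of h] by (simp add: o_def)
  have sB: "simple_function M (\<lambda>x. x \<in> B)" and sE: "simple_function M (\<lambda>x. x \<in> ?E)"
    by (rule simple_function_bool; fact)+
  have "cond_ent (\<lambda>x. x \<in> B) Y \<le> cond_ent (\<lambda>x. x \<in> B) (\<lambda>x. h (Y x))"
    by (rule cond_ent_antimono[OF sB Y])
  also have "\<dots> = ent (\<lambda>x. (x \<in> ?E, h (Y x))) - ent (\<lambda>x. h (Y x))"
    unfolding cond_ent_def
    by (subst ent_eqI[where Z = "\<lambda>x. (x \<in> ?E, h (Y x))" and f = "\<lambda>(e, d). (e \<noteq> d, d)" and g = "\<lambda>(b, d). (b \<noteq> d, d)"])
      (auto intro!: simple_function_Pair sB hY sE[simplified])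
  also have "\<dots> \<le> ent (\<lambda>x. x \<in> ?E)" using ent_Pair_le[OF sE hY] by simp
  also have "\<dots> \<le> prob ?E + 2 * sqrt (prob ?E)" by (rule ent_bool_le[OF E])
  finally show ?thesis .
qed

section \<open>Invariance of entropy under measure preserving maps\<close>

lemma measure_preserving_vimage:
  assumes f: "f \<in> measurable M M" "distr M M f = M" and S: "S \<in> events"
  shows "prob (f -` S \<inter> space M) = prob S"
  using measure_distr[OF f(1) S] f(2) by simp

lemma ent_measure_preserving:
  assumes f: "f \<in> measurable M M" "distr M M f = M" and Z: "simple_function M Z"
  shows "ent (\<lambda>x. Z (f x)) = ent Z"
proof -
  have "f x \<in> space M" if "x \<in> space M" for x using measurable_space[OF f(1) that] .
  then have "ent (\<lambda>x. Z (f x)) = (\<Sum>z\<in>Z ` space M. eta (prob ((\<lambda>x. Z (f x)) -` {z} \<inter> space M)))"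
    using simple_functionD(1)[OF Z] by (intro ent_superset) auto
  also have "\<dots> = ent Z"
    unfolding ent_def
  proof (intro sum.cong refl arg_cong[of _ _ eta])
    fix z assume "z \<in> Z ` space M"
    have "prob (f -` (Z -` {z} \<inter> space M) \<inter> space M) = prob (Z -` {z} \<inter> space M)"
      using f simple_functionD(2)[OF Z] by (intro measure_preserving_vimage)
    moreover have "f -` (Z -` {z} \<inter> space M) \<inter> space M = (\<lambda>x. Z (f x)) -` {z} \<inter> space M"
      using measurable_space[OF f(1)] by auto
    ultimately show "prob ((\<lambda>x. Z (f x)) -` {z} \<inter> space M) = prob (Z -` {z} \<inter> space M)" by simp
  qed
  finally show ?thesis .
qed

end

section \<open>Itineraries and the generator theorem for cylinders\<close>

definition itinerary :: "('a \<Rightarrow> 'a) \<Rightarrow> ('a \<Rightarrow> 'k) \<Rightarrow> nat \<Rightarrow> 'a \<Rightarrow> 'k list" where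
  "itinerary f L n x = map (\<lambda>i. L ((f ^^ i) x)) [0..<n]"

lemma length_itinerary [simp]: "length (itinerary f L n x) = n"
  by (simp add: itinerary_def)

lemma itinerary_0 [simp]: "itinerary f L 0 x = []"
  by (simp add: itinerary_def)

lemma itinerary_snoc: "itinerary f L (Suc n) x = itinerary f L n x @ [L ((f ^^ n) x)]"
  by (simp add: itinerary_def)

lemma itinerary_Cons: "itinerary f L (Suc n) x = L x # itinerary f L n (f x)"
  unfolding itinerary_def upt_conv_Cons[OF zero_less_Suc] map_Suc_upt[symmetric]
  by (simp add: funpow_swap1)

lemma funpow_closed: "(\<And>x. x \<in> S \<Longrightarrow> f x \<in> S) \<Longrightarrow> x \<in> S \<Longrightarrow> (f ^^ i) x \<in> S"
  by (induction i) auto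

text \<open>A nonempty member of the join is determined by the itinerary of any of its points.
  Fibres over attained itineraries are nonempty, hence the removal of the empty set.\<close>

lemma dynamical_join_fibres:
  assumes f: "\<And>x. x \<in> S \<Longrightarrow> f x \<in> S"
  shows "dynamical_join S f ((\<lambda>k. L -` {k} \<inter> S) ` (L ` S)) n - {{}}
    = (\<lambda>l. itinerary f L n -` {l} \<inter> S) ` (itinerary f L n ` S)"
proof (intro equalityI subsetI)
  let ?P = "(\<lambda>k. L -` {k} \<inter> S) ` (L ` S)"
  fix C assume "C \<in> dynamical_join S f ?P n - {{}}"
  then obtain u x where u: "C = S \<inter> (\<Inter>i<n. (f ^^ i) -` u i)" "\<forall>i<n. u i \<in> ?P" and x: "x \<in> C"
    unfolding dynamical_join_def by blast
  have "u i = L -` {L ((f ^^ i) x)} \<inter> S" if "i < n" for i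
  proof -
    from u(2) that have "u i \<in> ?P" by blast
    then obtain y where "u i = L -` {L y} \<inter> S" by (elim imageE) blast
    moreover have "(f ^^ i) x \<in> u i" using x u(1) that by auto
    ultimately show ?thesis by auto
  qed
  then have "C = itinerary f L n -` {itinerary f L n x} \<inter> S"
    unfolding u(1) using funpow_closed[OF f] by (auto simp: itinerary_def)
  then show "C \<in> (\<lambda>l. itinerary f L n -` {l} \<inter> S) ` (itinerary f L n ` S)" using x u(1) by blast
next
  let ?P = "(\<lambda>k. L -` {k} \<inter> S) ` (L ` S)"
  fix C assume "C \<in> (\<lambda>l. itinerary f L n -` {l} \<inter> S) ` (itinerary f L n ` S)"
  then obtain x where x: "x \<in> S" "C = itinerary f L n -` {itinerary f L n x} \<inter> S" by blast
  have "C = S \<inter> (\<Inter>i<n. (f ^^ i) -` (L -` {L ((f ^^ i) x)} \<inter> S))"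
    unfolding x(2) using funpow_closed[OF f] by (auto simp: itinerary_def)
  moreover have "\<forall>i<n. L -` {L ((f ^^ i) x)} \<inter> S \<in> ?P" using funpow_closed[of S f x] f x(1) by blast
  ultimately have "C \<in> dynamical_join S f ?P n"
    unfolding dynamical_join_def by (intro CollectI exI[of _ "\<lambda>i. L -` {L ((f ^^ i) x)} \<inter> S"] conjI)
  then show "C \<in> dynamical_join S f ?P n - {{}}" using x by auto
qed

lemma (in finite_alphabet) tendsto_average:
  assumes "stationary K c"
  shows "(\<lambda>n. block_entropy K c (n + m) / real n) \<longlonglongrightarrow> entropy_rate K c"
proof -
  have "(\<lambda>n. block_entropy K c (n + m) / real (n + m)) \<longlonglongrightarrow> entropy_rate K c"
    using LIMSEQ_ignore_initial_segment[OF entropy_rate_tendsto[OF assms], of m] by simp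
  moreover have "(\<lambda>n. real (n + m) / real n) \<longlonglongrightarrow> 1" by real_asymp
  ultimately have "(\<lambda>n. block_entropy K c (n + m) / real (n + m) * (real (n + m) / real n)) \<longlonglongrightarrow> entropy_rate K c"
    using tendsto_mult by fastforce
  then show ?thesis
    by (rule Lim_transform_eventually) (auto intro!: eventually_sequentiallyI[of 1])
qed

text \<open>The alphabet is a parameter because two kinds of labels occur: the first letter of a
  sequence, and the atom of an arbitrary finite partition.\<close>

locale finite_process = prob_space M + K: finite_alphabet K
  for M :: "'a measure" and K :: "'k set" +
  fixes f :: "'a \<Rightarrow> 'a" and L :: "'a \<Rightarrow> 'k"
  assumes f: "f \<in> measurable M M" and pres: "distr M M f = M"
    and L: "simple_function M L" and LK: "L ` space M \<subseteq> K"
begin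

definition pw :: "'k list \<Rightarrow> real" where
  "pw w = prob {x \<in> space M. itinerary f L (length w) x = w}"

lemma f_space: "x \<in> space M \<Longrightarrow> f x \<in> space M"
  using f by (rule measurable_space)

lemma f_iter: "f ^^ i \<in> measurable M M" "distr M M (f ^^ i) = M"
proof -
  have "f ^^ i \<in> measurable M M \<and> distr M M (f ^^ i) = M"
  proof (induction i)
    case 0
    then show ?case by (simp add: id_def distr_id2)
  next
    case (Suc i)
    then have "distr M M (f \<circ> f ^^ i) = distr (distr M M (f ^^ i)) M f"
      using f by (intro distr_distr[symmetric]) auto
    then show ?case using Suc f pres measurable_comp[of "f ^^ i" M M f M] by (simp add: o_def)
  qed
  then show "f ^^ i \<in> measurable M M" "distr M M (f ^^ i) = M" by auto
qed

lemma simple_shifted: "simple_function M Z \<Longrightarrow> simple_function M (\<lambda>x. Z ((f ^^ i) x))"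
  using f_iter(1) by (rule simple_function_comp)

lemma simple_itinerary: "simple_function M (itinerary f L n)"
  unfolding itinerary_def[abs_def] by (intro simple_function_map simple_shifted L)

lemma itinerary_event: "{x \<in> space M. itinerary f L n x = w} \<in> events"
proof -
  have "{x \<in> space M. itinerary f L n x = w} = itinerary f L n -` {w} \<inter> space M" by auto
  then show ?thesis using simple_functionD(2)[OF simple_itinerary] by metis
qed

lemma itinerary_words: "x \<in> space M \<Longrightarrow> itinerary f L n x \<in> words K n"
  using LK funpow_closed[of "space M" f x] f_space by (auto simp: itinerary_def words_def)

lemma stationary_pw: "stationary K pw"
  unfolding stationary_def
proof (intro conjI allI impI)
  show "pw [] = 1" by (simp add: pw_def prob_space)
  show "0 \<le> pw w" for w by (simp add: pw_def)
  show "pw w = 0" if "\<not> set w \<subseteq> K" for w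
  proof -
    have "set w \<subseteq> K" if "x \<in> space M" "itinerary f L (length w) x = w" for x
      using itinerary_words[OF that(1), of "length w"] that(2) by (simp add: words_def)
    then have "{x \<in> space M. itinerary f L (length w) x = w} = {}" using that by auto
    then show ?thesis by (simp only: pw_def measure_empty)
  qed
  show "(\<Sum>a\<in>K. pw (w @ [a])) = pw w" for w
  proof -
    have "L ((f ^^ length w) x) \<in> K" if "x \<in> space M" for x
      using LK funpow_closed[of "space M" f x] f_space that by auto
    then have "{x \<in> space M. itinerary f L (length w) x = w}
        = (\<Union>a\<in>K. {x \<in> space M. itinerary f L (length (w @ [a])) x = w @ [a]})"
      by (auto simp: itinerary_snoc)
    also have "prob \<dots> = (\<Sum>a\<in>K. pw (w @ [a]))"
    proof -
      have "disjoint_family_on (\<lambda>a. {x \<in> space M. itinerary f L (length (w @ [a])) x = w @ [a]}) K"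
        by (auto simp: disjoint_family_on_def itinerary_snoc)
      then show ?thesis
        unfolding pw_def using K.finite_K itinerary_event by (intro finite_measure_finite_Union) auto
    qed
    finally show ?thesis by (simp add: pw_def)
  qed
  show "(\<Sum>a\<in>K. pw (a # w)) = pw w" for w
  proof -
    let ?S = "{x \<in> space M. itinerary f L (length w) x = w}"
    have "f -` ?S \<inter> space M = (\<Union>a\<in>K. {x \<in> space M. itinerary f L (length (a # w)) x = a # w})"
      using LK f_space by (auto simp: itinerary_Cons)
    also have "prob \<dots> = (\<Sum>a\<in>K. pw (a # w))"
    proof -
      have "disjoint_family_on (\<lambda>a. {x \<in> space M. itinerary f L (length (a # w)) x = a # w}) K"
        by (auto simp: disjoint_family_on_def itinerary_Cons)
      then show ?thesis
        unfolding pw_def using K.finite_K itinerary_event by (intro finite_measure_finite_Union) auto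
    qed
    finally show ?thesis
      using measure_preserving_vimage[OF f pres itinerary_event, of "length w" w] by (simp add: pw_def)
  qed
qed

lemma ent_itinerary: "ent (itinerary f L n) = block_entropy K pw n"
proof -
  have "ent (itinerary f L n) = (\<Sum>w\<in>words K n. eta (prob (itinerary f L n -` {w} \<inter> space M)))"
    using itinerary_words by (intro ent_superset) auto
  also have "\<dots> = block_entropy K pw n"
    unfolding block_entropy_def
  proof (intro sum.cong refl arg_cong[of _ _ eta])
    fix w assume "w \<in> words K n"
    then have "itinerary f L n -` {w} \<inter> space M = {x \<in> space M. itinerary f L (length w) x = w}"
      by (auto simp: words_def)
    then show "prob (itinerary f L n -` {w} \<inter> space M) = pw w" unfolding pw_def by simp
  qed
  finally show ?thesis .
qed

lemma partition_entropy_join: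
  "partition_entropy M (dynamical_join (space M) f ((\<lambda>k. L -` {k} \<inter> space M) ` (L ` space M)) n) = block_entropy K pw n"
proof -
  let ?J = "dynamical_join (space M) f ((\<lambda>k. L -` {k} \<inter> space M) ` (L ` space M)) n"
  let ?I = "itinerary f L n"
  have J: "?J - {{}} = (\<lambda>l. ?I -` {l} \<inter> space M) ` (?I ` space M)"
    by (rule dynamical_join_fibres[OF f_space])
  have fin: "finite (?I ` space M)" by (rule simple_functionD(1)[OF simple_itinerary])
  have finJ: "finite ?J" using J fin by (metis finite_Diff_insert finite.emptyI finite_imageI Diff_empty)
  have "partition_entropy M ?J = (\<Sum>C\<in>?J. eta (prob C))"
    by (simp add: partition_entropy_def eta_def sum_negf)
  also have "\<dots> = (\<Sum>C\<in>?J - {{}}. eta (prob C))"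
    using finJ by (intro sum.mono_neutral_right) auto
  also have "\<dots> = ent ?I"
    unfolding J ent_def by (subst sum.reindex) (auto simp: inj_on_def)
  finally show ?thesis by (simp add: ent_itinerary)
qed

end

subsection \<open>Approximation of measurable sets by unions of cylinders\<close>

context sft
begin

context
  fixes \<mu> assumes \<mu>: "\<mu> \<in> borel_prob_measures X"
begin

interpretation \<mu>: prob_space \<mu> using borel_prob_measuresD[OF \<mu>] by simp

lemma prefix_event: "{x \<in> X. map x [0..<m] \<in> W} \<in> sets \<mu>"
proof -
  have "{x \<in> X. map x [0..<m] \<in> W} = (\<Union>w\<in>{w \<in> W. length w = m}. cylinder X w)"
    by (auto simp: cylinder_def)
  also have "\<dots> \<in> sets \<mu>" by (intro sets.countable_UN'' cylinder_sets[OF \<mu>]) auto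
  finally show ?thesis .
qed

lemma diff_event:
  assumes "B \<in> sets \<mu>" shows "{x \<in> X. (x \<in> B) \<noteq> (map x [0..<m] \<in> W)} \<in> sets \<mu>"
proof -
  have "{x \<in> X. (x \<in> B) \<noteq> (map x [0..<m] \<in> W)}
      = (B - {x \<in> X. map x [0..<m] \<in> W}) \<union> ({x \<in> X. map x [0..<m] \<in> W} - B)"
    using sets.sets_into_space[OF assms] borel_prob_measuresD(3)[OF \<mu>] by auto
  then show ?thesis using assms prefix_event by auto
qed

text \<open>The approximation is claimed for all large lengths so that finitely many sets can be
  approximated at a common length, as the union case requires.\<close>

lemma approx_by_cylinders:
  assumes "B \<in> sets \<mu>" "\<delta> > 0"
  shows "\<exists>m. \<forall>m'\<ge>m. \<exists>W. measure \<mu> {x \<in> X. (x \<in> B) \<noteq> (map x [0..<m'] \<in> W)} < \<delta>"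
proof -
  have sets: "sets \<mu> = sigma_sets X (insert {} (range (cylinder X)))"
    using sets_restrict_cylinders[OF X_borel] borel_prob_measuresD(2)[OF \<mu>] by simp
  have "B \<in> sigma_sets X (insert {} (range (cylinder X)))" using assms(1) sets by simp
  then show ?thesis using assms(2)
  proof (induction arbitrary: \<delta> rule: sigma_sets.induct)
    case (Basic C)
    then consider "C = {}" | w where "C = cylinder X w" by auto
    then show ?case
    proof cases
      case 1
      then show ?thesis using Basic by (auto intro!: exI[of _ "{}"])
    next
      case (2 w)
      have empty: "{x \<in> X. (x \<in> C) \<noteq> (map x [0..<m] \<in> {v. take (length w) v = w})} = {}" if "m \<ge> length w" for m
        using that by (auto simp: 2 cylinder_def take_map min_def)
      show ?thesis
      proof (intro exI[of _ "length w"] allI impI exI[of _ "{v. take (length w) v = w}"])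
        fix m assume "length w \<le> m"
        then show "measure \<mu> {x \<in> X. (x \<in> C) \<noteq> (map x [0..<m] \<in> {v. take (length w) v = w})} < \<delta>"
          using Basic(2) by (simp only: empty measure_empty)
      qed
    qed
  next
    case Empty
    then show ?case by (auto intro!: exI[of _ "{}"])
  next
    case (Compl C)
    have compl: "{x \<in> X. (x \<in> X - C) \<noteq> (map x [0..<m] \<in> - W)} = {x \<in> X. (x \<in> C) \<noteq> (map x [0..<m] \<in> W)}" for m W
      by auto
    obtain m where m: "\<forall>m'\<ge>m. \<exists>W. measure \<mu> {x \<in> X. (x \<in> C) \<noteq> (map x [0..<m'] \<in> W)} < \<delta>"
      using Compl.IH[OF Compl.prems] by blast
    show ?case
    proof (intro exI[of _ m] allI impI)
      fix m' assume "m \<le> m'"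
      then obtain W where "measure \<mu> {x \<in> X. (x \<in> C) \<noteq> (map x [0..<m'] \<in> W)} < \<delta>" using m by blast
      then show "\<exists>W. measure \<mu> {x \<in> X. (x \<in> X - C) \<noteq> (map x [0..<m'] \<in> W)} < \<delta>"
        unfolding compl[symmetric] by blast
    qed
  next
    case (Union A)
    have A: "A i \<in> sets \<mu>" for i using Union.hyps sets by simp
    \<comment> \<open>Continuity from below replaces the countable union by a finite one at cost
      below \<open>\<delta> / 2\<close>; the \<open>N\<close> approximated sets share the other
      half, with \<open>Suc N\<close> avoiding division by 0.\<close>
    define U where "U n = (\<Union>i<n. A i)" for n
    have "incseq U" unfolding incseq_def U_def by (intro allI impI UN_mono) auto
    moreover have "range U \<subseteq> sets \<mu>" using A by (auto simp: U_def)
    ultimately have "(\<lambda>n. measure \<mu> (U n)) \<longlonglongrightarrow> measure \<mu> (\<Union>n. U n)"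
      using \<mu>.finite_Lim_measure_incseq by blast
    moreover have UA: "(\<Union>n. U n) = (\<Union>i. A i)" by (auto simp: U_def)
    ultimately have "\<forall>\<^sub>F n in sequentially. measure \<mu> (\<Union>i. A i) - \<delta> / 2 < measure \<mu> (U n)"
      using Union.prems by (intro order_tendstoD(1)) auto
    then obtain N where N: "measure \<mu> (\<Union>i. A i) - \<delta> / 2 < measure \<mu> (U N)"
      by (auto simp: eventually_sequentially)
    have "\<exists>m. \<forall>m'\<ge>m. \<exists>W. measure \<mu> {x \<in> X. (x \<in> A i) \<noteq> (map x [0..<m'] \<in> W)} < \<delta> / (2 * real (Suc N))" for i
      using Union.prems by (intro Union.IH) simp
    then have "\<exists>m. \<forall>i. \<forall>m'\<ge>m i. \<exists>W. measure \<mu> {x \<in> X. (x \<in> A i) \<noteq> (map x [0..<m'] \<in> W)} < \<delta> / (2 * real (Suc N))"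
      by (intro choice allI)
    then obtain m where m: "\<And>i m'. m' \<ge> m i \<Longrightarrow>
        \<exists>W. measure \<mu> {x \<in> X. (x \<in> A i) \<noteq> (map x [0..<m'] \<in> W)} < \<delta> / (2 * real (Suc N))" by blast
    show ?case
    proof (rule exI, intro allI impI)
      fix m' assume m': "Max (m ` {..N}) \<le> m'"
      have "\<forall>i. \<exists>W. i < N \<longrightarrow> measure \<mu> {x \<in> X. (x \<in> A i) \<noteq> (map x [0..<m'] \<in> W)} < \<delta> / (2 * real (Suc N))"
      proof
        fix i
        show "\<exists>W. i < N \<longrightarrow> measure \<mu> {x \<in> X. (x \<in> A i) \<noteq> (map x [0..<m'] \<in> W)} < \<delta> / (2 * real (Suc N))"
        proof (cases "i < N")
          case True
          then have "m i \<le> Max (m ` {..N})" by (intro Max_ge) auto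
          then show ?thesis using m[of i m'] m' by auto
        qed simp
      qed
      from choice[OF this] obtain W where
        W: "\<And>i. i < N \<Longrightarrow> measure \<mu> {x \<in> X. (x \<in> A i) \<noteq> (map x [0..<m'] \<in> W i)} < \<delta> / (2 * real (Suc N))"
        by blast
      let ?E = "\<lambda>i. {x \<in> X. (x \<in> A i) \<noteq> (map x [0..<m'] \<in> W i)}"
      have UX: "(\<Union>i. A i) \<in> sets \<mu>" "U N \<in> sets \<mu>" using A by (auto simp: U_def)
      have "measure \<mu> {x \<in> X. (x \<in> (\<Union>i. A i)) \<noteq> (map x [0..<m'] \<in> (\<Union>i<N. W i))}
          \<le> measure \<mu> (((\<Union>i. A i) - U N) \<union> (\<Union>i<N. ?E i))"
        using UX diff_event[OF A] by (intro \<mu>.finite_measure_mono) (auto simp: U_def)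
      also have "\<dots> \<le> measure \<mu> ((\<Union>i. A i) - U N) + measure \<mu> (\<Union>i<N. ?E i)"
        using UX diff_event[OF A] by (intro measure_Un_le) auto
      also have "measure \<mu> ((\<Union>i. A i) - U N) = measure \<mu> (\<Union>i. A i) - measure \<mu> (U N)"
        using UX by (intro \<mu>.finite_measure_Diff) (auto simp: U_def)
      also have "measure \<mu> (\<Union>i<N. ?E i) \<le> (\<Sum>i<N. measure \<mu> (?E i))"
        using diff_event[OF A] by (intro \<mu>.finite_measure_subadditive_finite) auto
      also have "\<dots> \<le> (\<Sum>i<N. \<delta> / (2 * real (Suc N)))" using W by (intro sum_mono less_imp_le) auto
      also have "\<dots> \<le> \<delta> / 2" using Union.prems by (simp add: field_simps)
      finally show "\<exists>W. measure \<mu> {x \<in> X. (x \<in> (\<Union>i. A i)) \<noteq> (map x [0..<m'] \<in> W)} < \<delta>"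
        using N by (intro exI[of _ "\<Union>i<N. W i"]) simp
    qed
  qed
qed

end

lemma funpow_shift: "(shift_map ^^ i) x j = x (i + j)"
  by (induction i arbitrary: x j) (auto simp: shift_map_def)

lemma cylinder_process:
  assumes \<mu>: "\<mu> \<in> invariant_measures X shift_map"
  shows "finite_process \<mu> {..<d} shift_map (\<lambda>x. x 0)"
    and "finite_process.pw \<mu> shift_map (\<lambda>x. x 0) = weight X \<mu>"
    and "itinerary shift_map (\<lambda>x. x 0) n x = map x [0..<n]"
proof -
  note inv = invariant_measuresD[OF \<mu>] and D = borel_prob_measuresD[OF invariant_measuresD(1)[OF \<mu>]]
  show it: "itinerary shift_map (\<lambda>x. x 0) n x = map x [0..<n]" for n x
    by (simp add: itinerary_def funpow_shift)
  have fibre: "(\<lambda>x. x 0) -` {a} \<inter> X = cylinder X [a]" for a by (auto simp: cylinder_def)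
  have "(\<lambda>x. x 0) ` X \<subseteq> {..<d}" by (auto simp: letters_X)
  then have "finite ((\<lambda>x. x 0) ` X)" by (rule finite_subset) simp
  then have "simple_function \<mu> (\<lambda>x. x 0)"
    unfolding simple_function_def D(3) fibre using cylinder_sets[OF inv(1)] by blast
  then show proc: "finite_process \<mu> {..<d} shift_map (\<lambda>x. x 0)"
    using D inv letters_X
    by (intro finite_process.intro finite_process_axioms.intro) (auto simp: K.finite_alphabet_axioms)
  show "finite_process.pw \<mu> shift_map (\<lambda>x. x 0) = weight X \<mu>"
    by (rule ext) (simp add: finite_process.pw_def[OF proc] weight_def cylinder_def it D(3))
qed

text \<open>The Kolmogorov-Sinai argument. Given the first \<open>n + m\<close> letters, the first
  \<open>n\<close> labels have conditional entropy at most \<open>n\<close> times that of one label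
  given \<open>m\<close> letters. The latter can be made at most \<open>e\<close>, because the
  fibres of \<open>L\<close> are nearly unions of cylinders, and the \<open>m\<close> extra letters
  do not affect the rate.\<close>

theorem entropy_rate_le_cylinders:
  assumes \<mu>: "\<mu> \<in> invariant_measures X shift_map" and L: "finite_process \<mu> K' shift_map L"
  shows "entropy_rate K' (finite_process.pw \<mu> shift_map L) \<le> entropy_rate {..<d} (weight X \<mu>)"
proof (rule field_le_epsilon)
  fix e :: real assume e: "e > 0"
  note inv = invariant_measuresD[OF \<mu>] and D = borel_prob_measuresD[OF invariant_measuresD(1)[OF \<mu>]]
  interpret L: finite_process \<mu> K' shift_map L by (rule L)
  interpret C: finite_process \<mu> "{..<d}" shift_map "\<lambda>x. x 0" by (rule cylinder_process[OF \<mu>])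
  note it = cylinder_process(3)[OF \<mu>]
  let ?\<alpha> = "\<lambda>n x. map x [0..<n]"
  have s\<alpha>: "simple_function \<mu> (?\<alpha> n)" for n
    using C.simple_itinerary[of n] by (simp add: it[abs_def])
  have st: "stationary {..<d} (weight X \<mu>)" using weight_mem[OF \<mu>] by (simp add: sft_weights_def)
  have ent\<alpha>: "L.ent (?\<alpha> n) = block_entropy {..<d} (weight X \<mu>) n" for n
    using C.ent_itinerary[of n] by (simp add: it[abs_def] cylinder_process(2)[OF \<mu>])
  have key: "L.ent (itinerary shift_map L n)
      \<le> block_entropy {..<d} (weight X \<mu>) (n + m) + real n * L.cond_ent L (?\<alpha> m)" for n m
  proof -
    have "L.ent (itinerary shift_map L n) \<le> L.ent (?\<alpha> (n + m)) + L.cond_ent (itinerary shift_map L n) (?\<alpha> (n + m))"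
      by (rule L.ent_le_cond_ent[OF L.simple_itinerary s\<alpha>])
    also have "L.cond_ent (itinerary shift_map L n) (?\<alpha> (n + m))
        \<le> (\<Sum>i<n. L.cond_ent (\<lambda>x. L ((shift_map ^^ i) x)) (?\<alpha> (n + m)))"
      unfolding itinerary_def[abs_def] by (intro L.cond_ent_map_le L.simple_shifted L.L s\<alpha>)
    also have "\<dots> \<le> (\<Sum>i<n. L.cond_ent L (?\<alpha> m))"
    proof (intro sum_mono)
      fix i assume "i \<in> {..<n}"
      then have i: "i + m \<le> n + m" by simp
      \<comment> \<open>The \<open>i\<close>-th label is conditioned on the \<open>m\<close> letters
        starting at position \<open>i\<close> alone; invariance then moves the pair back to time
        0.\<close>
      have "L.cond_ent (\<lambda>x. L ((shift_map ^^ i) x)) (?\<alpha> (n + m))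
          \<le> L.cond_ent (\<lambda>x. L ((shift_map ^^ i) x)) (\<lambda>x. take m (drop i (?\<alpha> (n + m) x)))"
        by (intro L.cond_ent_antimono L.simple_shifted L.L s\<alpha>)
      also have "\<dots> = L.cond_ent (\<lambda>x. L ((shift_map ^^ i) x)) (\<lambda>x. ?\<alpha> m ((shift_map ^^ i) x))"
        using i by (intro L.cond_ent_cong refl nth_equalityI) (auto simp: funpow_shift)
      also have "\<dots> = L.cond_ent L (?\<alpha> m)"
        unfolding L.cond_ent_def
        using L.ent_measure_preserving[OF L.f_iter s\<alpha>, of i m]
          L.ent_measure_preserving[OF L.f_iter simple_function_Pair[OF L.L s\<alpha>], of i m] by simp
      finally show "L.cond_ent (\<lambda>x. L ((shift_map ^^ i) x)) (?\<alpha> (n + m)) \<le> L.cond_ent L (?\<alpha> m)" .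
    qed
    finally show ?thesis by (simp add: ent\<alpha>)
  qed
  have bound: "entropy_rate K' L.pw \<le> entropy_rate {..<d} (weight X \<mu>) + L.cond_ent L (?\<alpha> m)" for m
  proof (rule LIMSEQ_le)
    show "(\<lambda>n. block_entropy K' L.pw n / real n) \<longlonglongrightarrow> entropy_rate K' L.pw"
      by (rule L.K.entropy_rate_tendsto[OF L.stationary_pw])
    show "(\<lambda>n. block_entropy {..<d} (weight X \<mu>) (n + m) / real n + L.cond_ent L (?\<alpha> m))
        \<longlonglongrightarrow> entropy_rate {..<d} (weight X \<mu>) + L.cond_ent L (?\<alpha> m)"
      by (intro tendsto_add tendsto_const K.tendsto_average[OF st])
    show "\<exists>N. \<forall>n\<ge>N. block_entropy K' L.pw n / real n
        \<le> block_entropy {..<d} (weight X \<mu>) (n + m) / real n + L.cond_ent L (?\<alpha> m)"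
      using key[of _ m] by (intro exI[of _ 1] allI impI) (auto simp: L.ent_itinerary field_simps)
  qed
  have "\<exists>m. L.cond_ent L (?\<alpha> m) \<le> e"
  proof -
    obtain ks where ks: "set ks = L ` space \<mu>" "distinct ks"
      using finite_distinct_list[OF simple_functionD(1)[OF L.L]] by blast
    define r where "r = length ks"
    define B where "B j = L -` {ks ! j} \<inter> space \<mu>" for j
    have B: "B j \<in> sets \<mu>" for j unfolding B_def by (rule simple_functionD(2)[OF L.L])
    \<comment> \<open>For probabilities p the bound p + 2 sqrt p is at most 3 sqrt p, so
      \<open>\<delta>\<close> makes each fibre contribute at most \<open>e / real (Suc r)\<close>;
      \<open>Suc r\<close> avoids division by 0.\<close>
    define \<delta> where "\<delta> = min 1 ((e / (3 * real (Suc r)))\<^sup>2)"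
    have \<delta>: "\<delta> > 0" using e by (simp add: \<delta>_def)
    have "\<exists>m. \<forall>m'\<ge>m. \<exists>W. measure \<mu> {x \<in> X. (x \<in> B j) \<noteq> (map x [0..<m'] \<in> W)} < \<delta>" for j
      by (rule approx_by_cylinders[OF inv(1) B \<delta>])
    then have "\<exists>m. \<forall>j. \<forall>m'\<ge>m j. \<exists>W. measure \<mu> {x \<in> X. (x \<in> B j) \<noteq> (map x [0..<m'] \<in> W)} < \<delta>"
      by (intro choice allI)
    then obtain m where m: "\<And>j m'. m' \<ge> m j \<Longrightarrow> \<exists>W. measure \<mu> {x \<in> X. (x \<in> B j) \<noteq> (map x [0..<m'] \<in> W)} < \<delta>"
      by blast
    define N where "N = (\<Sum>j<r. m j)"
    have indic: "L.cond_ent (\<lambda>x. x \<in> B j) (?\<alpha> N) \<le> e / real (Suc r)" if "j < r" for j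
    proof -
      have "m j \<le> N" unfolding N_def using that by (intro member_le_sum) auto
      then obtain W where W: "measure \<mu> {x \<in> X. (x \<in> B j) \<noteq> (map x [0..<N] \<in> W)} < \<delta>" using m by blast
      let ?p = "measure \<mu> {x \<in> X. (x \<in> B j) \<noteq> (map x [0..<N] \<in> W)}"
      have "L.cond_ent (\<lambda>x. x \<in> B j) (?\<alpha> N) \<le> ?p + 2 * sqrt ?p"
        using L.cond_ent_bool_le[OF B s\<alpha>, of j "\<lambda>l. l \<in> W" N] diff_event[OF inv(1) B] by (simp add: D(3))
      moreover have "?p \<le> sqrt ?p"
      proof -
        have "?p * ?p \<le> ?p" using mult_left_le_one_le[of ?p ?p] by (simp add: L.prob_le_1)
        then show ?thesis by (intro real_le_rsqrt) (simp add: power2_eq_square)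
      qed
      moreover have "sqrt ?p + 2 * sqrt ?p \<le> 3 * sqrt ((e / (3 * real (Suc r)))\<^sup>2)"
      proof -
        have "sqrt ?p \<le> sqrt ((e / (3 * real (Suc r)))\<^sup>2)"
          using W by (intro real_sqrt_le_mono) (simp only: \<delta>_def)
        then show ?thesis by linarith
      qed
      moreover have "3 * sqrt ((e / (3 * real (Suc r)))\<^sup>2) = e / real (Suc r)"
      proof -
        have "sqrt ((e / (3 * real (Suc r)))\<^sup>2) = e / (3 * real (Suc r))" using e by (intro real_sqrt_unique) auto
        then show ?thesis by (simp del: of_nat_Suc)
      qed
      ultimately show ?thesis by linarith
    qed
    \<comment> \<open>\<open>dec\<close> recovers the label from the list of memberships in the
      fibres, so \<open>L\<close> is a function of finitely many indicators.\<close>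
    define dec where "dec l = ks ! (LEAST j. j < r \<and> l ! j)" for l
    have dec: "L x = dec (map (\<lambda>j. x \<in> B j) [0..<r])" if x: "x \<in> space \<mu>" for x
    proof -
      obtain j where j: "j < r" "ks ! j = L x"
        using ks(1) x by (metis imageI in_set_conv_nth r_def)
      have uniq: "i = j" if "i < r" "x \<in> B i" for i
      proof -
        have "ks ! i = ks ! j" using that(2) j(2) by (simp add: B_def)
        then show ?thesis using nth_eq_iff_index_eq[OF ks(2)] that(1) j(1) by (simp add: r_def)
      qed
      have "(LEAST i. i < r \<and> map (\<lambda>j. x \<in> B j) [0..<r] ! i) = j"
      proof (rule Least_equality)
        show "j < r \<and> map (\<lambda>j. x \<in> B j) [0..<r] ! j" using j x by (simp add: B_def)
        show "j \<le> i" if "i < r \<and> map (\<lambda>j. x \<in> B j) [0..<r] ! i" for i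
        proof -
          have "i < r" "x \<in> B i" using that by auto
          then show ?thesis using uniq by blast
        qed
      qed
      then show ?thesis by (simp add: dec_def j)
    qed
    have sB: "simple_function \<mu> (\<lambda>x. x \<in> B j)" for j by (rule L.simple_function_bool[OF B])
    have "L.cond_ent L (?\<alpha> N) = L.cond_ent (\<lambda>x. dec (map (\<lambda>j. x \<in> B j) [0..<r])) (?\<alpha> N)"
      using dec by (intro L.cond_ent_cong) auto
    also have "\<dots> \<le> L.cond_ent (\<lambda>x. map (\<lambda>j. x \<in> B j) [0..<r]) (?\<alpha> N)"
      by (intro L.cond_ent_comp_le L.simple_function_map sB s\<alpha>)
    also have "\<dots> \<le> (\<Sum>j<r. L.cond_ent (\<lambda>x. x \<in> B j) (?\<alpha> N))"
      by (intro L.cond_ent_map_le sB s\<alpha>)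
    also have "\<dots> \<le> (\<Sum>j<r. e / real (Suc r))" using indic by (intro sum_mono) auto
    also have "\<dots> \<le> e" using e by (simp add: field_simps)
    finally show ?thesis by blast
  qed
  then show "entropy_rate K' L.pw \<le> entropy_rate {..<d} (weight X \<mu>) + e"
    using bound by (meson add_left_mono order_trans)
qed

text \<open>A finite partition becomes a labelling with its own atoms as alphabet, each point being
  labelled by the atom containing it, so its rate is bounded by that of the cylinders; the partition
  by the first letter attains the bound.\<close>

theorem measure_entropy_eq:
  assumes \<mu>: "\<mu> \<in> invariant_measures X shift_map"
  shows "measure_entropy \<mu> shift_map = ereal (entropy_rate {..<d} (weight X \<mu>))"
proof -
  note inv = invariant_measuresD[OF \<mu>] and D = borel_prob_measuresD[OF invariant_measuresD(1)[OF \<mu>]]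
  interpret C: finite_process \<mu> "{..<d}" shift_map "\<lambda>x. x 0" by (rule cylinder_process[OF \<mu>])
  let ?h = "\<lambda>P. lim (\<lambda>n. partition_entropy \<mu> (dynamical_join (space \<mu>) shift_map P n) / real n)"
  have upper: "?h P \<le> entropy_rate {..<d} (weight X \<mu>)"
    if P: "finite P" "P \<subseteq> sets \<mu>" "partition_on (space \<mu>) P" for P
  proof -
    define L where "L x = (THE C. C \<in> P \<and> x \<in> C)" for x
    have L: "L x = C" if "C \<in> P" "x \<in> C" for x C
      unfolding L_def using that disjointD[OF partition_onD2[OF P(3)]] by (intro the_equality) auto
    have ex: "\<exists>C\<in>P. x \<in> C" if "x \<in> space \<mu>" for x using that partition_onD1[OF P(3)] by auto
    have sub: "C \<subseteq> space \<mu>" if "C \<in> P" for C using that P(2) sets.sets_into_space by blast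
    have L_mem: "x \<in> L x \<and> L x \<in> P" if "x \<in> space \<mu>" for x
      using ex[OF that] L by (elim bexE) simp
    have fibre: "L -` {C} \<inter> space \<mu> = C" if "C \<in> P" for C
      using L[OF that] L_mem sub[OF that] by auto
    have LP: "L ` space \<mu> = P"
    proof (intro equalityI subsetI)
      fix C assume C: "C \<in> P"
      then obtain x where "x \<in> C" using partition_onD3[OF P(3)] by (metis ex_in_conv)
      then show "C \<in> L ` space \<mu>" using L[OF C] sub[OF C] by (intro image_eqI[of _ _ x]) auto
    qed (use L_mem in auto)
    have "finite_process \<mu> P shift_map L"
    proof (intro finite_process.intro finite_process_axioms.intro D inv)
      show "finite_alphabet P" by unfold_locales (rule P)
      show "simple_function \<mu> L" unfolding simple_function_def LP using P fibre by auto
    qed (simp add: LP)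
    then interpret L: finite_process \<mu> P shift_map L .
    have PP: "(\<lambda>k. L -` {k} \<inter> space \<mu>) ` (L ` space \<mu>) = P" unfolding LP using fibre by auto
    have "?h P = entropy_rate P L.pw"
      unfolding L.partition_entropy_join[unfolded PP] by (simp add: entropy_rate_def)
    then show ?thesis using entropy_rate_le_cylinders[OF \<mu> L.finite_process_axioms] by simp
  qed
  let ?P = "(\<lambda>k. (\<lambda>x. x 0) -` {k} \<inter> space \<mu>) ` ((\<lambda>x. x 0) ` space \<mu>)"
  have "finite ?P" using simple_functionD(1)[OF C.L] by auto
  moreover have "?P \<subseteq> sets \<mu>" using simple_functionD(2)[OF C.L] by auto
  moreover have "partition_on (space \<mu>) ?P" by (rule partition_onI) (auto simp: disjnt_def)
  moreover have "?h ?P = entropy_rate {..<d} (weight X \<mu>)"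
    unfolding C.partition_entropy_join cylinder_process(2)[OF \<mu>] by (simp add: entropy_rate_def)
  ultimately show ?thesis
    unfolding measure_entropy_def using upper
    by (intro antisym SUP_least SUP_upper2[of ?P]) auto
qed

end

section \<open>Topological entropy\<close>

context sft
begin

definition language :: "nat \<Rightarrow> nat list set" where
  "language n = {w \<in> words {..<d} n. cylinder X w \<noteq> {}}"

lemma finite_language: "finite (language n)"
  by (simp add: language_def)

lemma prefix_language: "x \<in> X \<Longrightarrow> map x [0..<n] \<in> language n"
  using letters_X by (auto simp: language_def words_def cylinder_def)

lemma shift_iter_in_X: "x \<in> X \<Longrightarrow> (shift_map ^^ n) x \<in> X"
  by (rule funpow_closed[OF shift_in_X])

lemma card_language_add: "card (language (m + n)) \<le> card (language m) * card (language n)"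
proof -
  have "(\<lambda>w. (take m w, drop m w)) ` language (m + n) \<subseteq> language m \<times> language n"
  proof (rule image_subsetI)
    fix w assume w: "w \<in> language (m + n)"
    then obtain x where x: "x \<in> X" "map x [0..<m + n] = w"
      by (auto simp: language_def cylinder_def words_def)
    have "take m w = map x [0..<m]" using x(2) by (auto simp: take_map)
    moreover have "drop m w = map ((shift_map ^^ m) x) [0..<n]"
      by (rule nth_equalityI) (auto simp: x(2)[symmetric] funpow_shift)
    ultimately show "(take m w, drop m w) \<in> language m \<times> language n"
      using prefix_language[OF x(1)] prefix_language[OF shift_iter_in_X[OF x(1)]] by simp
  qed
  moreover have "inj_on (\<lambda>w. (take m w, drop m w)) (language (m + n))"
    by (rule inj_onI) (metis append_take_drop_id prod.inject)
  ultimately have "card (language (m + n)) \<le> card (language m \<times> language n)"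
    using finite_language by (intro card_inj_on_le) auto
  then show ?thesis by (simp add: card_cartesian_product)
qed

abbreviation letter_cover :: "(nat \<Rightarrow> nat) set set" where
  "letter_cover \<equiv> (\<lambda>a. cylinder X [a]) ` {..<d}"

lemma open_cover_letters: "open_cover (top_of_set X) letter_cover"
proof -
  have "openin (top_of_set X) (cylinder X [a])" for a
  proof -
    have "open ((\<lambda>x :: nat \<Rightarrow> nat. x 0) -` {a})"
      by (rule open_vimage) (auto intro: discrete_topology_class.open_discrete)
    moreover have "cylinder X [a] = X \<inter> ((\<lambda>x. x 0) -` {a})" by (auto simp: cylinder_def)
    ultimately show ?thesis by (simp add: openin_open_Int)
  qed
  moreover have "\<Union>letter_cover = X" using letters_X by (auto simp: cylinder_def)
  ultimately show ?thesis by (auto simp: open_cover_def)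
qed

lemma dynamical_join_letters: "dynamical_join X shift_map letter_cover n = cylinder X ` words {..<d} n"
proof -
  have cyl: "X \<inter> (\<Inter>i<n. (shift_map ^^ i) -` cylinder X [w ! i]) = cylinder X w" if "length w = n" for w
    unfolding cylinder_def that[symmetric] map_upt_eq_iff using shift_iter_in_X
    by (auto simp: funpow_shift)
  show ?thesis
  proof (intro equalityI subsetI)
    fix C assume "C \<in> dynamical_join X shift_map letter_cover n"
    then obtain u where u: "C = X \<inter> (\<Inter>i<n. (shift_map ^^ i) -` u i)" "\<forall>i<n. u i \<in> letter_cover"
      unfolding dynamical_join_def by blast
    then have "\<forall>i. \<exists>a. i < n \<longrightarrow> a < d \<and> u i = cylinder X [a]" by blast
    from choice[OF this] obtain a where a: "\<forall>i<n. a i < d \<and> u i = cylinder X [a i]" by blast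
    have "C = cylinder X (map a [0..<n])"
      using cyl[of "map a [0..<n]"] a unfolding u(1) by simp
    moreover have "map a [0..<n] \<in> words {..<d} n" using a by (auto simp: words_def)
    ultimately show "C \<in> cylinder X ` words {..<d} n" by blast
  next
    fix C assume "C \<in> cylinder X ` words {..<d} n"
    then obtain w where w: "C = cylinder X w" "length w = n" "set w \<subseteq> {..<d}" by (auto simp: words_def)
    have "C = X \<inter> (\<Inter>i<n. (shift_map ^^ i) -` cylinder X [w ! i])" using cyl[OF w(2)] w(1) by simp
    moreover have "\<forall>i<n. cylinder X [w ! i] \<in> letter_cover" using w(2,3) nth_mem by blast
    ultimately show "C \<in> dynamical_join X shift_map letter_cover n"
      unfolding dynamical_join_def by (intro CollectI exI[of _ "\<lambda>i. cylinder X [w ! i]"] conjI)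
  qed
qed

text \<open>Cylinders of distinct words of equal length are disjoint, so no nonempty one can be
  omitted from a cover.\<close>

lemma min_subcover_letters: "min_subcover_card X (dynamical_join X shift_map letter_cover n) = card (language n)"
  unfolding min_subcover_card_def dynamical_join_letters
proof (rule Least_equality)
  have eqw: "v = w" if "x \<in> cylinder X v" "x \<in> cylinder X w" "length v = length w" for x v w
    using that by (auto simp: cylinder_def)
  have "inj_on (cylinder X) (language n)"
    using eqw by (intro inj_onI) (fastforce simp: language_def words_def)
  then have "card (cylinder X ` language n) = card (language n)" by (rule card_image)
  moreover have "X \<subseteq> \<Union>(cylinder X ` language n)"
    using prefix_language by (fastforce simp: cylinder_def)
  ultimately show "\<exists>\<V>\<subseteq>cylinder X ` words {..<d} n. finite \<V> \<and> X \<subseteq> \<Union>\<V> \<and> card \<V> = card (language n)"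
    using finite_language by (intro exI[of _ "cylinder X ` language n"]) (auto simp: language_def)
  fix k assume "\<exists>\<V>\<subseteq>cylinder X ` words {..<d} n. finite \<V> \<and> X \<subseteq> \<Union>\<V> \<and> card \<V> = k"
  then obtain \<V> where V: "\<V> \<subseteq> cylinder X ` words {..<d} n" "finite \<V>" "X \<subseteq> \<Union>\<V>" "card \<V> = k" by blast
  have "cylinder X ` language n \<subseteq> \<V>"
  proof (rule image_subsetI)
    fix w assume w: "w \<in> language n"
    then obtain x where x: "x \<in> cylinder X w" "length w = n" by (auto simp: language_def words_def)
    then have "x \<in> X" by (simp add: cylinder_def)
    then obtain C where "C \<in> \<V>" "x \<in> C" using V(3) by blast
    then obtain v where "cylinder X v \<in> \<V>" "x \<in> cylinder X v" "length v = n" using V(1) by (auto simp: words_def)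
    then show "cylinder X w \<in> \<V>" using eqw[of x v w] x by simp
  qed
  then show "card (language n) \<le> k"
    using card_mono[OF V(2)] \<open>card (cylinder X ` language n) = card (language n)\<close> V(4) by metis
qed

text \<open>The easy half of the variational principle: block entropy is at most the logarithm of
  the number of words in the language. The cover by first letters bounds the supremum from
  below.\<close>

lemma entropy_rate_le_topological_entropy:
  assumes \<mu>: "\<mu> \<in> invariant_measures X shift_map"
  shows "ereal (entropy_rate {..<d} (weight X \<mu>)) \<le> topological_entropy (top_of_set X) shift_map"
proof -
  note D = borel_prob_measuresD[OF invariant_measuresD(1)[OF \<mu>]]
  have st: "stationary {..<d} (weight X \<mu>)" using weight_mem[OF \<mu>] by (simp add: sft_weights_def)
  obtain x where x: "x \<in> X" using prob_space.not_empty[OF D(1)] D(3) by auto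
  define a where "a n = ln (real (card (language n)))" for n
  have pos: "card (language n) > 0" for n
    using prefix_language[OF x, of n] finite_language by (auto simp: card_gt_0_iff)
  have "a (m + n) \<le> a m + a n" for m n
  proof -
    have "a (m + n) \<le> ln (real (card (language m) * card (language n)))"
      unfolding a_def using pos card_language_add[of m n] by (intro ln_mono) (auto simp del: of_nat_mult)
    then show ?thesis using pos by (simp add: a_def ln_mult)
  qed
  moreover have "0 \<le> a n" for n using pos[of n] by (simp add: a_def)
  ultimately have "convergent (\<lambda>n. a n / real n)" by (intro fekete)
  then have lim: "(\<lambda>n. a n / real n) \<longlonglongrightarrow> lim (\<lambda>n. a n / real n)" by (simp add: convergent_LIMSEQ_iff)
  have "block_entropy {..<d} (weight X \<mu>) n \<le> a n" for n
    unfolding a_def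
    by (rule K.block_entropy_le_ln_card[OF st]) (auto simp: language_def weight_def)
  then have "entropy_rate {..<d} (weight X \<mu>) \<le> lim (\<lambda>n. a n / real n)"
    by (intro LIMSEQ_le[OF K.entropy_rate_tendsto[OF st] lim] exI[of _ 0] allI impI divide_right_mono) auto
  also have "lim (\<lambda>n. a n / real n) = lim (\<lambda>n. ln (real (min_subcover_card (topspace (top_of_set X))
      (dynamical_join (topspace (top_of_set X)) shift_map letter_cover n))) / real n)"
    by (simp add: a_def min_subcover_letters)
  finally show ?thesis
    unfolding topological_entropy_def using open_cover_letters
    by (intro SUP_upper2[of letter_cover]) auto
qed

section \<open>Zero-temperature measures\<close>

definition dominant_measures :: "(nat \<Rightarrow> nat) measure set" where
  "dominant_measures = {\<mu> \<in> invariant_measures X shift_map.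
     \<exists>k. dominant {..<d} (\<lambda>a b. A a b = 1) k (weight X \<mu>)}"

text \<open>For fixed \<open>k\<close>, take two members with the same charged words of length
  \<open>k + 1\<close>: dominance of the one with the smaller rate forces them to coincide. So each
  \<open>S k\<close> injects into a finite power set.\<close>

lemma countable_dominant_measures: "countable dominant_measures"
proof -
  define S where "S k = {\<mu> \<in> invariant_measures X shift_map. dominant {..<d} (\<lambda>a b. A a b = 1) k (weight X \<mu>)}" for k
  have "countable (S k)" for k
  proof -
    define supp where "supp \<mu> = {v \<in> words {..<d} (Suc k). weight X \<mu> v \<noteq> 0}" for \<mu>
    have *: "\<mu> = \<nu>" if "\<mu> \<in> S k" "\<nu> \<in> S k" "supp \<mu> = supp \<nu>"
      "entropy_rate {..<d} (weight X \<mu>) \<le> entropy_rate {..<d} (weight X \<nu>)" for \<mu> \<nu>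
    proof -
      have "\<forall>v\<in>words {..<d} (Suc k). weight X \<nu> v \<noteq> 0 \<longrightarrow> weight X \<mu> v \<noteq> 0"
        using that(3) by (auto simp: supp_def)
      then have "weight X \<nu> = weight X \<mu>"
        using that(1,2,4) weight_mem[of \<nu>] unfolding S_def dominant_def by blast
      then show ?thesis using weight_inj that(1,2) invariant_measuresD(1) by (auto simp: S_def)
    qed
    have "inj_on supp (S k)" by (intro inj_onI) (metis * linear)
    moreover have "finite (supp ` S k)"
      by (rule finite_subset[of _ "Pow (words {..<d} (Suc k))"]) (auto simp: supp_def)
    ultimately show ?thesis by (meson finite_imageD countable_finite)
  qed
  moreover have "dominant_measures = (\<Union>k. S k)" by (auto simp: dominant_measures_def S_def)
  ultimately show ?thesis by simp
qed

lemma dominant_measures_ergodic: "dominant_measures \<subseteq> ergodic_measures X shift_map"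
proof
  fix \<mu> assume "\<mu> \<in> dominant_measures"
  then obtain k where \<mu>: "\<mu> \<in> invariant_measures X shift_map" "dominant {..<d} (\<lambda>a b. A a b = 1) k (weight X \<mu>)"
    by (auto simp: dominant_measures_def)
  show "\<mu> \<in> ergodic_measures X shift_map"
    by (rule ergodicI[OF \<mu>(1)]) (rule K.dominant_extremal[OF \<mu>(2)])
qed

lemma zero_temperature_maximizing:
  assumes \<phi>: "\<phi> \<in> LC_k k X" and k: "k \<ge> 1" and zt: "zero_temperature_measure X shift_map \<phi> \<nu>"
  shows "\<nu> \<in> invariant_measures X shift_map"
    and "maximizing_weight {..<d} (\<lambda>a b. A a b = 1) k (\<lambda>w. \<phi> (SOME x. x \<in> cylinder X w)) (weight X \<nu>)"
proof -
  obtain m where eq: "\<And>t. t \<ge> 0 \<Longrightarrow> equilibrium_state X shift_map (\<lambda>x. t * \<phi> x) (m t)"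
    and lim: "weak_star_limit X m \<nu> at_top"
    using zt by (auto simp: zero_temperature_measure_def)
  have inv: "m t \<in> invariant_measures X shift_map" if "t \<ge> 0" for t
    using eq[OF that] by (simp add: equilibrium_state_def)
  have \<nu>: "\<nu> \<in> borel_prob_measures X" using lim by (simp add: weak_star_limit_def)
  define h where "h c = entropy_rate {..<d} c" for c
  define L where "L c = (\<Sum>w\<in>words {..<d} k. \<phi> (SOME x. x \<in> cylinder X w) * c w)" for c :: "nat list \<Rightarrow> real"
  define c where "c t = weight X (m t)" for t
  define s where "s = weight X \<nu>"
  have ev0: "\<forall>\<^sub>F t :: real in at_top. t \<ge> 0" by (rule eventually_ge_at_top)
  have c_mem: "c t \<in> weights" if "t \<ge> 0" for t unfolding c_def by (rule weight_mem[OF inv[OF that]])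
  then have c_st: "stationary {..<d} (c t)" if "t \<ge> 0" for t using that by (simp add: sft_weights_def)
  have c_lim: "((\<lambda>t. c t w) \<longlongrightarrow> s w) at_top" for w
    unfolding c_def s_def
    by (rule weak_star_limit_weight[OF lim]) (use ev0 in eventually_elim, rule invariant_measuresD(1)[OF inv])
  \<comment> \<open>A weak-star limit is a priori only a probability measure; invariance passes to
    it through these finite sums of weights.\<close>
  have "(\<Sum>a<d. s (a # w)) = s w" for w
  proof (rule tendsto_unique[OF _ _ c_lim])
    have "((\<lambda>t. \<Sum>a<d. c t (a # w)) \<longlongrightarrow> (\<Sum>a<d. s (a # w))) at_top"
      by (intro tendsto_sum c_lim)
    moreover have "\<forall>\<^sub>F t in at_top. (\<Sum>a<d. c t (a # w)) = c t w"
      using ev0 by eventually_elim (rule K.stationary_Cons[OF c_st])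
    ultimately show "((\<lambda>t. c t w) \<longlongrightarrow> (\<Sum>a<d. s (a # w))) at_top" by (rule Lim_transform_eventually)
  qed simp
  then show inv\<nu>: "\<nu> \<in> invariant_measures X shift_map"
    unfolding s_def by (rule invariantI[OF \<nu>])
  have s_mem: "s \<in> weights" unfolding s_def by (rule weight_mem[OF inv\<nu>])
  then have s_st: "stationary {..<d} s" by (simp add: sft_weights_def)
  have L_lim: "((\<lambda>t. L (c t)) \<longlongrightarrow> L s) at_top"
    unfolding L_def by (intro tendsto_sum tendsto_mult_left c_lim)
  \<comment> \<open>Every admissible weight is realized by an invariant measure, so the equilibrium
    inequality holds against arbitrary \<open>b\<close>.\<close>
  have pressure: "h b + t * L b \<le> h (c t) + t * L (c t)" if b: "b \<in> weights" and t: "t \<ge> 0" for b t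
  proof -
    obtain \<beta> where \<beta>: "\<beta> \<in> invariant_measures X shift_map" "weight X \<beta> = b"
      using ex_invariant_measure[OF b] by blast
    have int: "(\<integral>x. t * \<phi> x \<partial>\<mu>) = t * L (weight X \<mu>)" if "\<mu> \<in> invariant_measures X shift_map" for \<mu>
      using integral_LC[OF invariant_measuresD(1)[OF that] \<phi>] by (simp add: L_def)
    have "measure_entropy \<beta> shift_map + ereal (\<integral>x. t * \<phi> x \<partial>\<beta>)
        \<le> measure_entropy (m t) shift_map + ereal (\<integral>x. t * \<phi> x \<partial>m t)"
      using eq[OF t] \<beta>(1) by (auto simp: equilibrium_state_def)
    then show ?thesis
      unfolding measure_entropy_eq[OF \<beta>(1)] measure_entropy_eq[OF inv[OF t]] int[OF \<beta>(1)] int[OF inv[OF t]]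
      by (simp add: \<beta>(2) h_def c_def)
  qed
  \<comment> \<open>A bound on all the entropies \<open>h (c t)\<close>, so that their contribution
    \<open>B / t\<close> disappears as \<open>t\<close> grows.\<close>
  define B where "B = ln (real (card (words {..<d} 1)))"
  have h_le: "h (c t) \<le> B" if "t \<ge> 0" for t
    using K.entropy_rate_le_average[OF c_st[OF that], of 1] K.block_entropy_le_ln_card[OF c_st[OF that], of "words {..<d} 1" 1]
    by (simp add: h_def B_def)
  have L_max: "L b \<le> L s" if b: "b \<in> weights" for b
  proof -
    have "((\<lambda>t. L (c t) + B / t) \<longlongrightarrow> L s + 0) at_top"
      by (intro tendsto_add L_lim tendsto_divide_0[OF tendsto_const] filterlim_at_top_imp_at_infinity filterlim_ident)
    moreover have "\<forall>\<^sub>F t in at_top. L b \<le> L (c t) + B / t"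
      using eventually_gt_at_top[of 0]
    proof eventually_elim
      case (elim t)
      have "0 \<le> h b" using b unfolding h_def by (intro K.entropy_rate_nonneg) (simp add: sft_weights_def)
      then have "t * L b \<le> t * L (c t) + B" using pressure[OF b, of t] h_le[of t] elim by linarith
      then show ?case using elim by (simp add: field_simps)
    qed
    ultimately show ?thesis using tendsto_lowerbound by force
  qed
  have h_max: "h b \<le> h s" if b: "b \<in> weights" and Lb: "L b = L s" for b
  proof -
    \<comment> \<open>Here \<open>L (c t) \<le> L b\<close>, so the pressure inequality leaves
      \<open>h b \<le> h (c t)\<close>. The length \<open>n\<close> is fixed while \<open>t\<close>
      tends to infinity, as block entropies are continuous in the weights; the limit in
      \<open>n\<close> comes afterwards.\<close>
    have *: "h b \<le> block_entropy {..<d} s n / real n" if n: "n > 0" for n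
    proof (rule tendsto_lowerbound)
      have "((\<lambda>t. eta (c t w)) \<longlongrightarrow> eta (s w)) at_top" for w
        using K.stationary_nonneg[OF c_st] K.stationary_le_1[OF c_st]
        by (intro tendsto_eta c_lim eventually_mono[OF ev0])
      then show "((\<lambda>t. block_entropy {..<d} (c t) n / real n) \<longlongrightarrow> block_entropy {..<d} s n / real n) at_top"
        unfolding block_entropy_def using n by (intro tendsto_intros) auto
      show "\<forall>\<^sub>F t in at_top. h b \<le> block_entropy {..<d} (c t) n / real n"
        using ev0
      proof eventually_elim
        case (elim t)
        have "t * L (c t) \<le> t * L b" using L_max[OF c_mem[OF elim]] Lb elim by (simp add: mult_left_mono)
        then have "h b \<le> h (c t)" using pressure[OF b elim] by linarith
        also have "\<dots> \<le> block_entropy {..<d} (c t) n / real n"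
          unfolding h_def by (rule K.entropy_rate_le_average[OF c_st[OF elim] n])
        finally show ?case .
      qed
    qed simp
    show ?thesis
      unfolding h_def[of s]
      by (rule LIMSEQ_le_const[OF K.entropy_rate_tendsto[OF s_st]]) (use * in \<open>auto intro: exI[of _ 1]\<close>)
  qed
  show "maximizing_weight {..<d} (\<lambda>a b. A a b = 1) k (\<lambda>w. \<phi> (SOME x. x \<in> cylinder X w)) (weight X \<nu>)"
    using k s_mem L_max h_max unfolding L_def h_def s_def by unfold_locales auto
qed

text \<open>All the components have the same rate as \<open>\<nu>\<close>, so the entropy of
  \<open>\<nu>\<close> is attained by any one of them and is not merely an average of their
  entropies.\<close>

lemma zero_temperature_decomposition:
  assumes \<phi>: "\<phi> \<in> LC X" and zt: "zero_temperature_measure X shift_map \<phi> \<nu>"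
  shows "finite_convex_sum dominant_measures \<nu>"
    and "\<exists>\<mu>\<in>dominant_measures. measure_entropy \<nu> shift_map = measure_entropy \<mu> shift_map"
proof -
  obtain k0 where "\<phi> \<in> LC_k k0 X" using \<phi> by (auto simp: LC_def)
  \<comment> \<open>The order is raised to at least 1, as the Markov argument requires; a function
    of \<open>k0\<close> coordinates also depends on no more than \<open>max 1 k0\<close>.\<close>
  moreover have "LC_k k0 X \<subseteq> LC_k (max 1 k0) X"
    unfolding LC_k_def by (intro Collect_mono impI ballI) (meson less_max_iff_disj)
  ultimately have \<phi>: "\<phi> \<in> LC_k (max 1 k0) X" by blast
  note inv = zero_temperature_maximizing(1)[OF \<phi> _ zt, simplified]
  interpret W: maximizing_weight "{..<d}" "\<lambda>a b. A a b = 1" "max 1 k0" "\<lambda>w. \<phi> (SOME x. x \<in> cylinder X w)" "weight X \<nu>"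
    by (rule zero_temperature_maximizing(2)[OF \<phi> _ zt]) simp
  obtain F z where F: "finite F" "F \<noteq> {}" "sum z F = 1" "\<And>w. weight X \<nu> w = (\<Sum>c\<in>F. z c * c w)"
    and Fc: "\<And>c. c \<in> F \<Longrightarrow> dominant {..<d} (\<lambda>a b. A a b = 1) (max 1 k0) c"
      "\<And>c. c \<in> F \<Longrightarrow> entropy_rate {..<d} c = entropy_rate {..<d} (weight X \<nu>)" "\<And>c. c \<in> F \<Longrightarrow> 0 \<le> z c"
    using W.dominant_decomposition by blast
  have "\<forall>c\<in>F. \<exists>\<mu>\<in>invariant_measures X shift_map. weight X \<mu> = c"
    using Fc(1) by (auto simp: dominant_def intro: ex_invariant_measure)
  then have "\<forall>c\<in>F. \<exists>\<mu>. \<mu> \<in> invariant_measures X shift_map \<and> weight X \<mu> = c" by blast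
  from bchoice[OF this] obtain g where g: "\<And>c. c \<in> F \<Longrightarrow> g c \<in> invariant_measures X shift_map"
    "\<And>c. c \<in> F \<Longrightarrow> weight X (g c) = c" by blast
  have inj: "inj_on g F" by (rule inj_on_inverseI) (rule g(2))
  have gD: "g c \<in> dominant_measures" if "c \<in> F" for c
    using g[OF that] Fc(1)[OF that] by (auto simp: dominant_measures_def)
  have sets: "sets \<mu> = sets \<nu>" if "\<mu> \<in> g ` F" for \<mu>
    using that g(1) inv invariant_measuresD(1) borel_prob_measuresD(2) by (metis imageE)
  show "finite_convex_sum dominant_measures \<nu>"
    unfolding finite_convex_sum_def
  proof (intro exI[of _ "g ` F"] exI[of _ "\<lambda>\<mu>. z (weight X \<mu>)"] conjI ballI)
    show "finite (g ` F)" "g ` F \<subseteq> dominant_measures" using F(1) gD by auto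
    show "0 \<le> z (weight X \<mu>)" "sets \<mu> = sets \<nu>" if "\<mu> \<in> g ` F" for \<mu>
      using that sets Fc(3) g(2) by auto
    show "(\<Sum>\<mu>\<in>g ` F. z (weight X \<mu>)) = 1"
      using F(3) g(2) by (simp add: sum.reindex[OF inj])
    fix B assume "B \<in> sets \<nu>"
    then show "measure \<nu> B = (\<Sum>\<mu>\<in>g ` F. z (weight X \<mu>) * measure \<mu> B)"
      using g F(4) invariant_measuresD(1) inv
      by (intro measure_eq_sum_of_cylinders[OF X_borel]) (auto simp: sum.reindex[OF inj])
  qed
  obtain c where "c \<in> F" using F(2) by blast
  then show "\<exists>\<mu>\<in>dominant_measures. measure_entropy \<nu> shift_map = measure_entropy \<mu> shift_map"
    using gD g Fc(2) by (intro bexI[of _ "g c"]) (auto simp: measure_entropy_eq inv)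
qed

end

theorem corollary1:
  fixes d :: nat and A :: "nat \<Rightarrow> nat \<Rightarrow> nat" and X :: "(nat \<Rightarrow> nat) set"
  assumes "d \<ge> 1"
    and "\<forall>i<d. \<forall>j<d. A i j \<in> {0, 1}"
    and X: "X = subshift d A"
    and "\<forall>a<d. \<exists>x\<in>X. \<exists>n. x n = a"
    and "topologically_transitive (top_of_set X) shift_map"
  shows "\<exists>(M_univ :: (nat \<Rightarrow> nat) measure set) (E_univ :: ereal set).
           countable M_univ \<and> M_univ \<subseteq> ergodic_measures X shift_map \<and>
           countable E_univ \<and> E_univ = {measure_entropy \<mu> shift_map | \<mu>. \<mu> \<in> M_univ} \<and>
           E_univ \<subseteq> {0 .. topological_entropy (top_of_set X) shift_map} \<and>
           (\<forall>\<phi>\<in>LC X. \<forall>\<nu>. zero_temperature_measure X shift_map \<phi> \<nu> \<longrightarrow>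
              finite_convex_sum M_univ \<nu> \<and> measure_entropy \<nu> shift_map \<in> E_univ)"
proof -
  interpret sft d A X by unfold_locales (rule X)
  let ?E = "{measure_entropy \<mu> shift_map | \<mu>. \<mu> \<in> dominant_measures}"
  have "countable ?E"
    using countable_dominant_measures by (simp add: setcompr_eq_image)
  moreover have "?E \<subseteq> {0 .. topological_entropy (top_of_set X) shift_map}"
  proof
    fix e assume "e \<in> ?E"
    then obtain \<mu> where \<mu>: "\<mu> \<in> invariant_measures X shift_map" "e = measure_entropy \<mu> shift_map"
      by (auto simp: dominant_measures_def)
    then show "e \<in> {0 .. topological_entropy (top_of_set X) shift_map}"
      using entropy_rate_le_topological_entropy[OF \<mu>(1)] weight_mem[OF \<mu>(1)] K.entropy_rate_nonneg
      by (simp add: measure_entropy_eq sft_weights_def)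
  qed
  moreover have "\<forall>\<phi>\<in>LC X. \<forall>\<nu>. zero_temperature_measure X shift_map \<phi> \<nu> \<longrightarrow>
      finite_convex_sum dominant_measures \<nu> \<and> measure_entropy \<nu> shift_map \<in> ?E"
    using zero_temperature_decomposition by fastforce
  ultimately show ?thesis
    using countable_dominant_measures dominant_measures_ergodic
    by (intro exI[of _ dominant_measures] exI[of _ ?E]) blast
qed

end
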